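(* Let $(\phi,\mu,\mathbf{v},p,\rho)$ be a sufficiently smooth solution on $\Omega\times(0,T)$ of the dimensionless quasi-incompressible Navier--Stokes--Cahn--Hilliard system \begin{align*} &\partial_t\phi+\mathbf{v}\cdot\nabla\phi+\phi\,\nabla\cdot\mathbf{v}=\tfrac{1}{\mathrm{Pe}}\Delta\mu,\\ &\mu=\tfrac{1}{\mathrm{Cn}}f'(\phi)-\mathrm{Cn}\,\Delta\phi-\tfrac{p}{\hat\rho(\phi)}\hat\rho',\\ &\rho\big(\partial_t\mathbf{v}+(\mathbf{v}\cdot\nabla)\mathbf{v}\big)=-\tfrac{1}{\mathrm{We}}\Big(\nabla p+\phi\nabla\mu-\tfrac{p}{\hat\rho(\phi)}\hat\rho'\,\nabla\phi\Big)+\tfrac{1}{\mathrm{Re}}\nabla\cdot\big(2\mathbf{D}(\mathbf{v})+\lambda(\nabla\cdot\mathbf{v})\mathbf{I}\big)-\tfrac{1}{\mathrm{Fr}^2}\hat\rho(\phi)\,\boldsymbol{\jmath},\\ &\nabla\cdot\mathbf{v}=\tfrac{\alpha}{\mathrm{Pe}}\Delta\mu,\\ &\partial_t\rho+\nabla\cdot(\rho\mathbf{v})=0, \end{align*} subject to the boundary conditions $\nabla\phi\cdot\mathbf{n}=\nabla\mu\cdot\mathbf{n}=0$ and $\mathbf{v}=\mathbf{0}$ on $\partial\Omega$. Assume $\rho>0$ and $\hat\rho(\phi)>0$ in $\Omega\times(0,T)$. Then for all $t\in(0,T)$ $$\frac{d}{dt}E(t)=-\frac{1}{\mathrm{Re}}\|\nabla\mathbf{v}\|_{L^2(\Omega)}^2-\frac{1+\lambda}{\mathrm{Re}}\|\nabla\cdot\mathbf{v}\|_{L^2(\Omega)}^2-\frac{1}{\mathrm{Pe}\,\mathrm{We}}\|\nabla\mu\|_{L^2(\Omega)}^2\le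 0,$$ where $$E(t)=\int_\Omega\Big(\tfrac12\rho|\mathbf{v}|^2+\tfrac{1}{\mathrm{We}\,\mathrm{Cn}}f(\phi)+\tfrac{\mathrm{Cn}}{2\,\mathrm{We}}|\nabla\phi|^2+\tfrac{1}{\mathrm{Fr}^2}\hat\rho(\phi)\,y\Big)\,d\Omega .$$
   Context: $\Omega\subset\mathbb{R}^d$, $d\in\{2,3\}$, is a bounded domain with Lipschitz boundary and outward unit normal $\mathbf{n}$; $y$ denotes the vertical coordinate and $\boldsymbol{\jmath}$ the vertical unit vector (so $\nabla y=\boldsymbol{\jmath}$). The constants $\mathrm{Pe},\mathrm{Cn},\mathrm{We},\mathrm{Re}>0$ and $\mathrm{Fr}^{-2}\ge0$ are given, and $\lambda\ge -2/d$. The constant component densities satisfy $\rho_1,\rho_2>0$; $\alpha:=\frac{\rho_2-\rho_1}{\rho_2+\rho_1}$. The algebraic mixture density is $\hat\rho(\phi):=\frac{1+\phi}{2}+\frac{\rho_2}{\rho_1}\frac{1-\phi}{2}$, whose derivative $\hat\rho':=\frac{d\hat\rho}{d\phi}=\frac12\big(1-\frac{\rho_2}{\rho_1}\big)$ is constant. $\mathbf{D}(\mathbf{v})=\frac12(\nabla\mathbf{v}+\nabla\mathbf{v}^T)$. The double-well potential is $f(\phi)=(\phi+1)^2$ for $\phi<-1$, $f(\phi)=\frac14(\phi^2-1)^2$ for $\phi\in[-1,1]$, $f(\phi)=(\phi-1)^2$ for $\phi>1$. $\|\nabla\mathbf{v}\|_{L^2}^2=\int_\Omega\nabla\mathbf{v}:\nabla\mathbf{v}\,d\Omega$.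 *)

theory Defs
  imports "HOL-Analysis.Analysis"
begin

definition fpot :: "real \<Rightarrow> real" where
  "fpot s = (if s < -1 then (s + 1)^2 else if s \<le> 1 then (1/4) * (s^2 - 1)^2 else (s - 1)^2)"

definition rhohat :: "real \<Rightarrow> real \<Rightarrow> real \<Rightarrow> real" where
  "rhohat rho1 rho2 s = (1 + s) / 2 + (rho2 / rho1) * ((1 - s) / 2)"

definition rhohat' :: "real \<Rightarrow> real \<Rightarrow> real" where
  "rhohat' rho1 rho2 = (1/2) * (1 - rho2 / rho1)"

definition alpha_const :: "real \<Rightarrow> real \<Rightarrow> real" where
  "alpha_const rho1 rho2 = (rho2 - rho1) / (rho2 + rho1)"

definition dx :: "'n::finite \<Rightarrow> (real^'n \<Rightarrow> real \<Rightarrow> real) \<Rightarrow> real^'n \<Rightarrow> real \<Rightarrow> real" where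
  "dx i u x t = deriv (\<lambda>s. u (x + s *\<^sub>R axis i 1) t) 0"

definition dt :: "(real^'n \<Rightarrow> real \<Rightarrow> real) \<Rightarrow> real^'n \<Rightarrow> real \<Rightarrow> real" where
  "dt u x t = deriv (\<lambda>s. u x s) t"

definition grad :: "(real^'n::finite \<Rightarrow> real \<Rightarrow> real) \<Rightarrow> real^'n \<Rightarrow> real \<Rightarrow> real^'n" where
  "grad u x t = (\<chi> i. dx i u x t)"

definition lap :: "(real^'n::finite \<Rightarrow> real \<Rightarrow> real) \<Rightarrow> real^'n \<Rightarrow> real \<Rightarrow> real" where
  "lap u x t = (\<Sum>i\<in>UNIV. dx i (dx i u) x t)"

definition vcomp :: "(real^'n \<Rightarrow> real \<Rightarrow> real^'n) \<Rightarrow> 'n \<Rightarrow> real^'n \<Rightarrow> real \<Rightarrow> real" where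
  "vcomp v k = (\<lambda>x t. v x t $ k)"

definition divg :: "(real^'n::finite \<Rightarrow> real \<Rightarrow> real^'n) \<Rightarrow> real^'n \<Rightarrow> real \<Rightarrow> real" where
  "divg v x t = (\<Sum>i\<in>UNIV. dx i (vcomp v i) x t)"

fun Ck :: "nat \<Rightarrow> 'a::euclidean_space set \<Rightarrow> ('a \<Rightarrow> real) \<Rightarrow> bool" where
  "Ck 0 U f = continuous_on U f"
| "Ck (Suc k) U f = (f differentiable_on U \<and>
      (\<forall>b\<in>Basis. Ck k U (\<lambda>z. frechet_derivative f (at z) b)))"

definition smooth_field :: "nat \<Rightarrow> (real^'n::finite) set \<Rightarrow> real \<Rightarrow> (real^'n \<Rightarrow> real \<Rightarrow> real) \<Rightarrow> bool" where
  "smooth_field k \<Omega> T u \<longleftrightarrow>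
     (\<exists>U. open U \<and> closure \<Omega> \<times> {0<..<T} \<subseteq> U \<and> Ck k U (\<lambda>z. u (fst z) (snd z)))"

text \<open>Bounded domain with Lipschitz boundary: near every boundary point, after a
  rigid motion, Omega is the region strictly below the graph of a Lipschitz
  function of the remaining d-1 coordinates.\<close>
definition lipschitz_domain :: "(real^'n::finite) set \<Rightarrow> bool" where
  "lipschitz_domain \<Omega> \<longleftrightarrow> open \<Omega> \<and> connected \<Omega> \<and> bounded \<Omega> \<and> \<Omega> \<noteq> {} \<and>
     (\<forall>x\<in>frontier \<Omega>. \<exists>(Q::real^'n \<Rightarrow> real^'n) (k::'n) (g::real^'n \<Rightarrow> real) (L::real) (r::real).
        orthogonal_transformation Q \<and> r > 0 \<and>
        (\<forall>z w. \<bar>g z - g w\<bar> \<le> L * norm (z - w)) \<and>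
        (\<forall>z. g z = g (z - (z $ k) *\<^sub>R axis k 1)) \<and>
        (\<forall>z\<in>ball x r. z \<in> \<Omega> \<longleftrightarrow> Q (z - x) $ k < g (Q (z - x))))"

text \<open>n is the outward unit normal of Omega at the boundary point x (exists at
  almost every boundary point of a Lipschitz domain).\<close>
definition outward_normal :: "(real^'n::finite) set \<Rightarrow> real^'n \<Rightarrow> real^'n \<Rightarrow> bool" where
  "outward_normal \<Omega> x n \<longleftrightarrow> x \<in> frontier \<Omega> \<and> norm n = 1 \<and>
     (\<forall>\<epsilon>>0. \<exists>\<delta>>0. \<forall>z\<in>ball x \<delta>. z \<noteq> x \<longrightarrow>
        ((z - x) \<bullet> n \<le> - \<epsilon> * norm (z - x) \<longrightarrow> z \<in> \<Omega>) \<and>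
        ((z - x) \<bullet> n \<ge> \<epsilon> * norm (z - x) \<longrightarrow> z \<notin> \<Omega>))"

end

(* Testing the momentum equation with v, the phase equation with mu + (p / rhohat) rhohat' and using the
   mass balance, every term of the time derivative of the energy density is a dissipation term or part
   of the divergence of one flux field F; the pressure and gravity terms combine because the algebraic
   density satisfies rhohat' (d/dt phi + v . grad phi) = - rhohat div v.  On the boundary v vanishes, so F reduces to
   multiples of grad phi and grad mu, which are tangential there.

   The divergence theorem on a Lipschitz domain is needed for fields that are tangential wherever the
   outward normal exists.  Localised to a chart {gamma > 0} with gamma (z + s e) = gamma z - s, the
   difference quotient is moved from the field G to the indicator of the domain; averaging
   along e and Rademacher's theorem for gamma then identify the limit with an integral of multiples of
   G . grad gamma over boundary points, which vanishes.  Rademacher's theorem is derived from Vitali's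
   covering theorem: one-dimensional differentiability a.e., transfer to lines, linearity of the
   directional derivative from its integrals over boxes, and a countable dense set of directions. *)

theory Submission
  imports Defs
begin

section \<open>Almost everywhere differentiability along lines\<close>

text \<open>The conditions on \<open>phi\<close> and \<open>mu\<close> are given only where
  \<open>outward_normal\<close> holds, and the graph of a Lipschitz function is a null set for the
  volume, so an almost-everywhere statement in space says nothing about it directly. The shift
  identity for gamma bridges this gap: gamma is differentiable at z exactly when it is
  differentiable at the boundary point z + gamma(z) e, with the same derivative. Rademacher's
  theorem in the volume therefore controls the boundary without any surface measure, and since only
  the vanishing of the boundary integrand matters, no surface integral has to be defined. The
  derivative of gamma along e is -1, so its gradient cannot vanish and yields a normal at every
  point of differentiability on the graph. In the flux the coefficient 1 + lambda arises from div (2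
  D(v)) = Delta v + grad div v; the bound lambda >= -2/d enters through 1 + lambda >= 0.\<close>

lemma nn_integral_lborel_shift:
  fixes f :: "'a::euclidean_space \<Rightarrow> ennreal"
  assumes [measurable]: "f \<in> borel_measurable borel"
  shows "(\<integral>\<^sup>+z. f (z + c) \<partial>lborel) = (\<integral>\<^sup>+z. f z \<partial>lborel)"
proof -
  have "(\<integral>\<^sup>+z. f z \<partial>lborel) = (\<integral>\<^sup>+z. f z \<partial>distr lborel borel ((+) c))"
    by (simp add: lborel_distr_plus)
  also have "\<dots> = (\<integral>\<^sup>+z. f (z + c) \<partial>lborel)"
    by (subst nn_integral_distr) (auto simp: add.commute)
  finally show ?thesis by simp
qed

text \<open>The measure of the translate of \<open>N\<close> by \<open>- s *\<^sub>R v\<close> is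
  averaged over \<open>s\<close> in [0, 1]. By translation invariance the average is the measure of
  \<open>N\<close>; after exchanging the integrals it is an integral of measures of line sections.
  This avoids splitting the space into \<open>v\<close> and a complement.\<close>

lemma null_sets_along_lines:
  fixes N :: "'a::euclidean_space set"
  assumes [measurable]: "N \<in> sets borel"
    and null: "\<And>z. {s::real. z + s *\<^sub>R v \<in> N} \<in> null_sets lborel"
  shows "N \<in> null_sets lborel"
proof -
  let ?f = "\<lambda>s z. indicator {0..1::real} s * (indicator N (z + s *\<^sub>R v) :: ennreal)"
  have "(\<integral>\<^sup>+s. \<integral>\<^sup>+z. ?f s z \<partial>lborel \<partial>lborel)
      = (\<integral>\<^sup>+s. indicator {0..1::real} s * emeasure lborel N \<partial>lborel)"
    by (intro nn_integral_cong, subst nn_integral_cmult)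
      (auto simp: nn_integral_lborel_shift[of "indicator N"])
  also have "\<dots> = emeasure lborel N"
    by (subst nn_integral_multc) simp_all
  finally have 1: "(\<integral>\<^sup>+s. \<integral>\<^sup>+z. ?f s z \<partial>lborel \<partial>lborel) = emeasure lborel N" .
  have "(\<integral>\<^sup>+s. \<integral>\<^sup>+z. ?f s z \<partial>lborel \<partial>lborel) = (\<integral>\<^sup>+z. \<integral>\<^sup>+s. ?f s z \<partial>lborel \<partial>lborel)"
    by (rule lborel_pair.Fubini'[symmetric]) simp
  also have "\<dots> = (\<integral>\<^sup>+(z::'a). 0 \<partial>lborel)"
  proof (intro nn_integral_cong)
    fix z :: 'a
    have "(\<integral>\<^sup>+s. ?f s z \<partial>lborel) \<le> (\<integral>\<^sup>+s. indicator {s. z + s *\<^sub>R v \<in> N} s \<partial>lborel)"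
      by (intro nn_integral_mono) (auto split: split_indicator)
    also have "\<dots> = 0" using null[of z] by (subst nn_integral_indicator) auto
    finally show "(\<integral>\<^sup>+s. ?f s z \<partial>lborel) = 0" by simp
  qed
  finally show ?thesis using 1 by auto
qed

text \<open>Here the difference quotients in direction \<open>v\<close> drop below \<open>r\<close>
  and rise above \<open>s\<close> at arbitrarily small increments. A bounded quotient without a
  limit oscillates across some pair of rationals \<open>r < s\<close>, so countably many of these
  sets contain all points where the directional derivative of a Lipschitz function fails to
  exist.\<close>

definition slope_gap :: "('a::euclidean_space \<Rightarrow> real) \<Rightarrow> 'a \<Rightarrow> real \<Rightarrow> real \<Rightarrow> 'a set" where
  "slope_gap f v r s = {z. (\<exists>\<^sub>F h in at 0. (f (z + h *\<^sub>R v) - f z) / h < r)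
                         \<and> (\<exists>\<^sub>F h in at 0. s < (f (z + h *\<^sub>R v) - f z) / h)}"

lemma frequently_at_0:
  "(\<exists>\<^sub>F h in at (0::real). P h) \<longleftrightarrow> (\<forall>n::nat. \<exists>h. h \<noteq> 0 \<and> \<bar>h\<bar> < 1 / Suc n \<and> P h)"
proof -
  have "(\<exists>\<^sub>F h in at (0::real). P h) \<longleftrightarrow> (\<forall>d>0. \<exists>h. h \<noteq> 0 \<and> \<bar>h\<bar> < d \<and> P h)"
    unfolding frequently_def eventually_at dist_real_def by auto
  also have "\<dots> \<longleftrightarrow> (\<forall>n::nat. \<exists>h. h \<noteq> 0 \<and> \<bar>h\<bar> < 1 / Suc n \<and> P h)"
  proof (intro iffI allI impI)
    fix d :: real
    assume *: "\<forall>n::nat. \<exists>h. h \<noteq> 0 \<and> \<bar>h\<bar> < 1 / Suc n \<and> P h" and "d > 0"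
    then obtain n where "1 / Suc n < d" using nat_approx_posE by blast
    with * show "\<exists>h. h \<noteq> 0 \<and> \<bar>h\<bar> < d \<and> P h" by (meson less_trans)
  qed auto
  finally show ?thesis .
qed

text \<open>By \<open>frequently_at_0\<close> each condition is a countable intersection over the
  radii 1/(n+1). For a fixed radius the union over \<open>h\<close> is uncountable, but it is a
  union of open sets, so a G-delta set results.\<close>

lemma borel_slope_gap:
  assumes f: "continuous_on UNIV (f :: 'a::euclidean_space \<Rightarrow> real)"
  shows "slope_gap f v r s \<in> sets borel"
proof -
  have c: "continuous_on UNIV (\<lambda>z. (f (z + h *\<^sub>R v) - f z) / h)" if "h \<noteq> 0" for h
    using that by (intro continuous_intros f continuous_on_compose2[OF f]) auto
  have o1: "open {z. (f (z + h *\<^sub>R v) - f z) / h < r}" if "h \<noteq> 0" for h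
    using c[OF that] by (intro open_Collect_less) auto
  have o2: "open {z. s < (f (z + h *\<^sub>R v) - f z) / h}" if "h \<noteq> 0" for h
    using c[OF that] by (intro open_Collect_less) auto
  have "slope_gap f v r s =
    (\<Inter>n::nat. \<Union>h\<in>{h. h \<noteq> 0 \<and> \<bar>h\<bar> < 1 / Suc n}. {z. (f (z + h *\<^sub>R v) - f z) / h < r}) \<inter>
    (\<Inter>n::nat. \<Union>h\<in>{h. h \<noteq> 0 \<and> \<bar>h\<bar> < 1 / Suc n}. {z. s < (f (z + h *\<^sub>R v) - f z) / h})"
    unfolding slope_gap_def frequently_at_0 by auto
  also have "\<dots> \<in> sets borel"
    using o1 o2 by (intro sets.Int sets.countable_INT'' borel_open open_UN) auto
  finally show ?thesis .
qed

text \<open>Closed intervals are closed balls around their midpoints, and the covering theorem only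
  asks that a point lie in the ball, not that it be the centre. This matters because the intervals
  to be used have the point \<open>x\<close> as an end.\<close>

lemma vitali_intervals:
  fixes U S :: "real set"
  assumes U: "open U" "S \<subseteq> U"
    and P: "\<And>x d. x \<in> S \<Longrightarrow> 0 < d \<Longrightarrow> \<exists>p q. p < q \<and> x \<in> {p..q} \<and> q - p < d \<and> P p q"
  obtains C where "countable C" "\<And>p q. (p, q) \<in> C \<Longrightarrow> p < q \<and> {p..q} \<subseteq> U \<and> P p q"
    "disjoint_family_on (\<lambda>(p, q). {p..q}) C"
    "negligible (S - (\<Union>(p, q)\<in>C. {p..q}))"
proof -
  define K where "K = {(p, q). p < q \<and> {p..q} \<subseteq> U \<and> P p q}"
  define a :: "real \<times> real \<Rightarrow> real" where "a = (\<lambda>(p, q). (p + q) / 2)"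
  define r :: "real \<times> real \<Rightarrow> real" where "r = (\<lambda>(p, q). (q - p) / 2)"
  have cb: "cball (a i) (r i) = (case i of (p, q) \<Rightarrow> {p..q})" for i
    by (auto simp: a_def r_def cball_eq_atLeastAtMost field_simps split: prod.split)
  have cov: "\<exists>i. i \<in> K \<and> x \<in> cball (a i) (r i) \<and> r i < d" if x: "x \<in> S" and d: "0 < d" for x d
  proof -
    obtain e where e: "e > 0" "ball x e \<subseteq> U" using openE[OF U(1), of x] x U(2) by blast
    obtain p q where pq: "p < q" "x \<in> {p..q}" "q - p < min d e" "P p q"
      using P[OF x, of "min d e"] d e by auto
    have "{p..q} \<subseteq> U"
      using pq e(2) by (auto simp: subset_iff ball_def dist_real_def)
    then show ?thesis using pq unfolding cb
      by (intro exI[of _ "(p, q)"]) (auto simp: K_def r_def)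
  qed
  have pos: "\<And>i. i \<in> K \<Longrightarrow> 0 < r i" by (auto simp: K_def r_def)
  obtain C where "countable C" "C \<subseteq> K"
     "pairwise (\<lambda>i j. disjnt (cball (a i) (r i)) (cball (a j) (r j))) C"
     "negligible (S - (\<Union>i \<in> C. cball (a i) (r i)))"
    by (rule Vitali_covering_theorem_cballs[OF pos cov]) (assumption | erule that; assumption)+
  then show ?thesis
    by (intro that[of C]) (auto simp: K_def cb pairwise_def disjnt_def disjoint_family_on_def)
qed

text \<open>A difference quotient is symmetric in its two points, so an increment of either sign
  yields a short interval with \<open>x\<close> at one end and the same slope.\<close>

lemma frequently_slope_interval:
  fixes g :: "real \<Rightarrow> real"
  assumes "\<exists>\<^sub>F h in at 0. Q ((g (x + h) - g x) / h)" "0 < d"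
  shows "\<exists>p q. p < q \<and> x \<in> {p..q} \<and> q - p < d \<and> Q ((g q - g p) / (q - p))"
proof -
  obtain h where h: "h \<noteq> 0" "\<bar>h\<bar> < d" "Q ((g (x + h) - g x) / h)"
    using assms by (auto simp: frequently_def eventually_at dist_real_def)
  show ?thesis
  proof (cases "h > 0")
    case True
    then show ?thesis using h by (intro exI[of _ x] exI[of _ "x + h"]) auto
  next
    case False
    have "(g x - g (x + h)) / (x - (x + h)) = (g (x + h) - g x) / h"
      using h by (simp add: field_simps)
    then show ?thesis using h False by (intro exI[of _ "x + h"] exI[of _ x]) auto
  qed
qed

text \<open>Lebesgue measure is compared with the Stieltjes measure of \<open>g\<close> by two
  successive Vitali coverings: intervals \<open>C\<close> of slope below \<open>r\<close> inside an
  open set of nearly minimal measure, and intervals \<open>W\<close> of slope above \<open>s\<close>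
  inside those of \<open>C\<close>. Then \<open>s\<close> times the measure of the set is at most
  the Stieltjes mass of \<open>W\<close>, hence of \<open>C\<close>, hence at most \<open>r\<close>
  times the nearly minimal measure. For \<open>r \<le> 0\<close> the set is empty because slopes of
  a monotone function are nonnegative.\<close>

lemma slope_gap_mono_null:
  fixes g :: "real \<Rightarrow> real"
  assumes mono: "mono g" and cont: "continuous_on UNIV g" and rs: "r < s"
  shows "slope_gap g 1 r s \<in> null_sets lborel"
proof (cases "r > 0")
  case False
  have "0 \<le> (g (x + h) - g x) / h" for x h
    using monoD[OF mono, of x "x + h"] monoD[OF mono, of "x + h" x]
    by (cases "h \<ge> 0") (auto simp: divide_nonneg_nonneg intro: divide_nonpos_nonpos)
  then have "\<not> (\<exists>\<^sub>F h in at 0. (g (x + h) - g x) / h < r)" for x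
    using False by (auto simp: frequently_def not_less intro!: always_eventually)
      (meson order_trans)
  then show ?thesis by (simp add: slope_gap_def)
next
  case r: True
  let ?\<mu> = "interval_measure g"
  have \<mu>: "emeasure ?\<mu> {p..q} = ennreal (g q - g p)" if "p \<le> q" for p q
    using that mono cont by (intro emeasure_interval_measure_Icc) (auto dest: monoD)
  have meas: "slope_gap g 1 r s \<in> sets borel" by (rule borel_slope_gap[OF cont])
  \<comment> \<open>Cutting with a ball makes the measure \<open>m\<close> finite, so that
    \<open>s * m \<le> r * m\<close> can force \<open>m = 0\<close>.\<close>
  have "slope_gap g 1 r s \<inter> ball 0 (real n) \<in> null_sets lborel" for n
  proof -
    define B where "B = slope_gap g 1 r s \<inter> ball 0 (real n)"
    have B[measurable]: "B \<in> sets borel" unfolding B_def using meas by auto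
    have "emeasure lborel B \<le> emeasure lborel (ball (0::real) (real n))"
      by (intro emeasure_mono) (auto simp: B_def)
    also have "\<dots> < \<infinity>" by (intro emeasure_bounded_finite bounded_ball)
    finally have fin: "emeasure lborel B < \<infinity>" .
    have key: "ennreal s * emeasure lborel B \<le> ennreal r * (emeasure lborel B + ennreal e)"
      if e: "e > 0" for e :: real
    proof -
      obtain U where U: "open U" "B \<subseteq> U" "emeasure lborel (U - B) < ennreal e"
        using outer_regular_lborel[OF B e] by blast
      have [measurable]: "U \<in> sets borel" using U by auto
      have freq1: "\<exists>\<^sub>F h in at 0. (g (x + h) - g x) / h < r"
        and freq2: "\<exists>\<^sub>F h in at 0. s < (g (x + h) - g x) / h" if "x \<in> B" for x
        using that by (auto simp: B_def slope_gap_def)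
      note fs1 = frequently_slope_interval[of "\<lambda>y. y < r", OF freq1]
      note fs2 = frequently_slope_interval[of "\<lambda>y. s < y", OF freq2]
      obtain C where C: "countable C"
        "\<And>p q. (p, q) \<in> C \<Longrightarrow> p < q \<and> {p..q} \<subseteq> U \<and> (g q - g p) / (q - p) < r"
        "disjoint_family_on (\<lambda>(p, q). {p..q}) C"
        "negligible (B - (\<Union>(p, q)\<in>C. {p..q}))"
        by (rule vitali_intervals[OF U(1,2) fs1]) (assumption | erule that; assumption)+
      \<comment> \<open>The second covering has to live in an open set; passing to the open
        intervals loses only the countably many end points of \<open>C\<close>.\<close>
      define V where "V = (\<Union>(p, q)\<in>C. {p<..<q})"
      have V: "open V" unfolding V_def by auto
      have BV: "B \<inter> V \<subseteq> V" by auto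
      obtain W where W: "countable W"
        "\<And>p q. (p, q) \<in> W \<Longrightarrow> p < q \<and> {p..q} \<subseteq> V \<and> s < (g q - g p) / (q - p)"
        "disjoint_family_on (\<lambda>(p, q). {p..q}) W"
        "negligible (B \<inter> V - (\<Union>(p, q)\<in>W. {p..q}))"
        by (rule vitali_intervals[OF V BV fs2]) (erule IntD1 | assumption | erule that; assumption)+
      have neg: "negligible (B - (\<Union>(p, q)\<in>W. {p..q}))"
      proof (rule negligible_subset)
        have "negligible (fst ` C \<union> snd ` C)"
          using C(1) by (auto intro!: negligible_iff_null_sets[THEN iffD2] countable_imp_null_set_lborel null_sets_completionI)
        then show "negligible ((B - (\<Union>(p, q)\<in>C. {p..q})) \<union> (fst ` C \<union> snd ` C)
            \<union> (B \<inter> V - (\<Union>(p, q)\<in>W. {p..q})))"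
          using C(4) W(4) by (intro negligible_Un) auto
        show "B - (\<Union>(p, q)\<in>W. {p..q}) \<subseteq> (B - (\<Union>(p, q)\<in>C. {p..q})) \<union> (fst ` C \<union> snd ` C)
            \<union> (B \<inter> V - (\<Union>(p, q)\<in>W. {p..q}))"
        proof
          fix x assume x: "x \<in> B - (\<Union>(p, q)\<in>W. {p..q})"
          show "x \<in> (B - (\<Union>(p, q)\<in>C. {p..q})) \<union> (fst ` C \<union> snd ` C)
            \<union> (B \<inter> V - (\<Union>(p, q)\<in>W. {p..q}))"
          proof (cases "x \<in> (\<Union>(p, q)\<in>C. {p..q})")
            case True
            then obtain p q where pq: "(p, q) \<in> C" "p \<le> x" "x \<le> q" by auto
            show ?thesis
            proof (cases "x = p \<or> x = q")
              case True
              then have "x \<in> fst ` C \<union> snd ` C" using pq(1) by force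
              then show ?thesis by blast
            next
              case False
              then have "x \<in> V" unfolding V_def using pq by (intro UN_I[of "(p, q)"]) auto
              then show ?thesis using x by blast
            qed
          qed (use x in blast)
        qed
      qed
      have [measurable]: "(\<Union>(p, q)\<in>W. {p..q}) \<in> sets borel"
        "(\<Union>(p, q)\<in>C. {p..q}) \<in> sets borel"
        using W(1) C(1) by (auto intro!: sets.countable_UN')
      have nul: "B - (\<Union>(p, q)\<in>W. {p..q}) \<in> null_sets lborel"
        using neg by (simp add: negligible_iff_null_sets null_sets_completion_iff)
      have "emeasure lborel B \<le> emeasure lborel ((\<Union>(p, q)\<in>W. {p..q}) \<union> (B - (\<Union>(p, q)\<in>W. {p..q})))"
        by (intro emeasure_mono) auto
      also have "\<dots> = emeasure lborel (\<Union>(p, q)\<in>W. {p..q})"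
        using nul by (intro emeasure_Un_null_set) auto
      finally have "ennreal s * emeasure lborel B
          \<le> ennreal s * emeasure lborel (\<Union>(p, q)\<in>W. {p..q})"
        by (rule mult_left_mono) simp
      also have "\<dots> = ennreal s * (\<integral>\<^sup>+i. emeasure lborel (case i of (p, q) \<Rightarrow> {p..q}) \<partial>count_space W)"
        using W by (subst emeasure_UN_countable) auto
      also have "\<dots> = (\<integral>\<^sup>+i. ennreal s * emeasure lborel (case i of (p, q) \<Rightarrow> {p..q}) \<partial>count_space W)"
        by (rule nn_integral_cmult[symmetric]) simp
      also have "\<dots> \<le> (\<integral>\<^sup>+i. emeasure ?\<mu> (case i of (p, q) \<Rightarrow> {p..q}) \<partial>count_space W)"
      proof (intro nn_integral_mono, clarsimp split: prod.split)
        fix p q assume "(p, q) \<in> W"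
        from W(2)[OF this] r rs show "ennreal s * emeasure lborel {p..q} \<le> emeasure ?\<mu> {p..q}"
          by (auto simp: \<mu> ennreal_mult[symmetric] field_simps intro!: ennreal_leI)
      qed
      also have "\<dots> = emeasure ?\<mu> (\<Union>(p, q)\<in>W. {p..q})"
        using W by (subst emeasure_UN_countable) auto
      also have "\<dots> \<le> emeasure ?\<mu> (\<Union>(p, q)\<in>C. {p..q})"
      proof (rule emeasure_mono)
        have "(\<Union>(p, q)\<in>W. {p..q}) \<subseteq> V" using W(2) by auto
        also have "V \<subseteq> (\<Union>(p, q)\<in>C. {p..q})" unfolding V_def by (intro UN_mono) auto
        finally show "(\<Union>(p, q)\<in>W. {p..q}) \<subseteq> (\<Union>(p, q)\<in>C. {p..q})" .
      qed simp
      also have "\<dots> = (\<integral>\<^sup>+i. emeasure ?\<mu> (case i of (p, q) \<Rightarrow> {p..q}) \<partial>count_space C)"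
        using C by (subst emeasure_UN_countable) auto
      also have "\<dots> \<le> (\<integral>\<^sup>+i. ennreal r * emeasure lborel (case i of (p, q) \<Rightarrow> {p..q}) \<partial>count_space C)"
      proof (intro nn_integral_mono, clarsimp split: prod.split)
        fix p q assume "(p, q) \<in> C"
        from C(2)[OF this] r rs show "emeasure ?\<mu> {p..q} \<le> ennreal r * emeasure lborel {p..q}"
          by (auto simp: \<mu> ennreal_mult[symmetric] field_simps intro!: ennreal_leI)
      qed
      also have "\<dots> = ennreal r * (\<integral>\<^sup>+i. emeasure lborel (case i of (p, q) \<Rightarrow> {p..q}) \<partial>count_space C)"
        by (rule nn_integral_cmult) simp
      also have "\<dots> = ennreal r * emeasure lborel (\<Union>(p, q)\<in>C. {p..q})"
        using C by (subst emeasure_UN_countable) auto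
      also have "\<dots> \<le> ennreal r * emeasure lborel U"
        using C(2) by (intro mult_left_mono emeasure_mono) auto
      also have "emeasure lborel U = emeasure lborel (B \<union> (U - B))"
        using U(2) by (intro arg_cong[where f = "emeasure lborel"]) auto
      also have "\<dots> = emeasure lborel B + emeasure lborel (U - B)"
        by (intro plus_emeasure[symmetric]) auto
      also have "ennreal r * \<dots> \<le> ennreal r * (emeasure lborel B + ennreal e)"
        using U(3) by (intro mult_left_mono add_left_mono) auto
      finally show ?thesis .
    qed
    obtain m where m: "emeasure lborel B = ennreal m" "m \<ge> 0"
      using fin by (cases "emeasure lborel B") auto
    have "s * m \<le> r * m + e" if "e > 0" for e
    proof -
      \<comment> \<open>The error enters \<open>key\<close> multiplied by \<open>r\<close>, hence
        the choice \<open>e / r\<close>.\<close>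
      have "ennreal s * ennreal m \<le> ennreal r * (ennreal m + ennreal (e / r))"
        using key[of "e / r"] that r m by auto
      then have "ennreal (s * m) \<le> ennreal (r * (m + e / r))"
        using that r rs m by (simp add: ennreal_mult ennreal_plus)
      then have "s * m \<le> r * (m + e / r)" using that r m by (subst (asm) ennreal_le_iff) auto
      then show ?thesis using r by (simp add: distrib_left)
    qed
    then have "s * m \<le> r * m" by (rule field_le_epsilon)
    then have "m = 0" using m rs by (metis mult_less_cancel_right not_le less_le)
    then show ?thesis using m B by (auto simp: B_def)
  qed
  then have "(\<Union>n. slope_gap g 1 r s \<inter> ball 0 (real n)) \<in> null_sets lborel" by (rule null_sets_UN)
  also have "(\<Union>n. slope_gap g 1 r s \<inter> ball 0 (real n)) = slope_gap g 1 r s"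
    by (auto simp: reals_Archimedean2)
  finally show ?thesis .
qed

text \<open>On a line with direction \<open>v\<close> the function is Lipschitz with constant
  \<open>K = L * norm v\<close>, so adding \<open>K * t\<close> makes it monotone. This raises every
  slope by \<open>K\<close> and moves the gap from \<open>r\<close>, \<open>s\<close> to
  \<open>r + K\<close>, \<open>s + K\<close>.\<close>

lemma slope_gap_null:
  fixes f :: "'a::euclidean_space \<Rightarrow> real"
  assumes lip: "L-lipschitz_on UNIV f" and rs: "r < s"
  shows "slope_gap f v r s \<in> null_sets lborel"
proof (rule null_sets_along_lines[of _ v])
  have cont: "continuous_on UNIV f" using lip by (rule lipschitz_on_continuous_on)
  then show "slope_gap f v r s \<in> sets borel" by (rule borel_slope_gap)
  fix z
  define K where "K = L * norm v"
  define g where "g t = f (z + t *\<^sub>R v) + K * t" for t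
  have lg: "\<bar>f (z + t *\<^sub>R v) - f (z + u *\<^sub>R v)\<bar> \<le> K * \<bar>t - u\<bar>" for t u
    using lipschitz_onD[OF lip, of "z + t *\<^sub>R v" "z + u *\<^sub>R v"]
    by (simp add: K_def dist_norm scaleR_diff_left[symmetric] mult_ac)
  have "mono g"
  proof (rule monoI)
    fix x y :: real assume "x \<le> y"
    then show "g x \<le> g y" using lg[of x y] by (simp add: g_def algebra_simps)
  qed
  moreover have "continuous_on UNIV g" unfolding g_def
    by (intro continuous_intros continuous_on_compose2[OF cont]) auto
  ultimately have "slope_gap g 1 (r + K) (s + K) \<in> null_sets lborel"
    using rs by (intro slope_gap_mono_null) auto
  moreover have "{t. z + t *\<^sub>R v \<in> slope_gap f v r s} = slope_gap g 1 (r + K) (s + K)"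
  proof -
    have "(g (t + h) - g t) / h = (f (z + t *\<^sub>R v + h *\<^sub>R v) - f (z + t *\<^sub>R v)) / h + K" if "h \<noteq> 0" for h t
      using that by (simp add: g_def scaleR_add_left algebra_simps add_divide_distrib diff_divide_distrib)
    then have "(\<exists>\<^sub>F h in at 0. (g (t + h) - g t) / h < r + K)
        \<longleftrightarrow> (\<exists>\<^sub>F h in at 0. (f (z + t *\<^sub>R v + h *\<^sub>R v) - f (z + t *\<^sub>R v)) / h < r)"
      "(\<exists>\<^sub>F h in at 0. s + K < (g (t + h) - g t) / h)
        \<longleftrightarrow> (\<exists>\<^sub>F h in at 0. s < (f (z + t *\<^sub>R v + h *\<^sub>R v) - f (z + t *\<^sub>R v)) / h)" for t
      by (intro frequently_cong[OF eventually_at_topological[THEN iffD2]]; force)+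
    then show ?thesis by (simp add: slope_gap_def)
  qed
  ultimately show "{t. z + t *\<^sub>R v \<in> slope_gap f v r s} \<in> null_sets lborel" by simp
qed

lemma lipschitz_slope_bound:
  fixes f :: "'a::euclidean_space \<Rightarrow> real"
  assumes "L-lipschitz_on UNIV f"
  shows "\<bar>(f (z + h *\<^sub>R v) - f z) / h\<bar> \<le> L * norm v"
proof (cases "h = 0")
  case True
  then show ?thesis using lipschitz_on_nonneg[OF assms] by simp
next
  case False
  have "\<bar>f (z + h *\<^sub>R v) - f z\<bar> \<le> (L * norm v) * \<bar>h\<bar>"
    using lipschitz_onD[OF assms, of "z + h *\<^sub>R v" z] by (simp add: dist_norm mult_ac)
  then show ?thesis using False by (simp add: abs_divide pos_divide_le_eq)
qed

text \<open>The limit is the supremum of the eventual lower bounds, that is the lower limit; the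
  bound \<open>K\<close> makes it a real number. Above it, two rationals \<open>r < s\<close> can be
  inserted below any \<open>a\<close>: the quotient is frequently below \<open>r\<close>, so by
  hypothesis not frequently above \<open>s\<close>.\<close>

lemma slope_limit_exists:
  fixes q :: "real \<Rightarrow> real"
  assumes bd: "\<And>h. \<bar>q h\<bar> \<le> K"
    and no: "\<And>r s. r \<in> \<rat> \<Longrightarrow> s \<in> \<rat> \<Longrightarrow> r < s \<Longrightarrow> \<not> ((\<exists>\<^sub>F h in at 0. q h < r) \<and> (\<exists>\<^sub>F h in at 0. s < q h))"
  shows "\<exists>l. (q \<longlongrightarrow> l) (at 0)"
proof -
  define A where "A = {r. \<forall>\<^sub>F h in at 0. r \<le> q h}"
  have ne: "- K \<in> A" using bd by (auto simp: A_def abs_le_iff intro!: always_eventually) (metis minus_le_iff)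
  have ub: "r \<le> K" if "r \<in> A" for r
  proof -
    have "\<forall>\<^sub>F h in at 0. r \<le> q h" using that by (simp add: A_def)
    then have "\<forall>\<^sub>F h in at (0::real). r \<le> K"
      by (rule eventually_mono) (meson abs_le_D1 bd order_trans)
    then show ?thesis by simp
  qed
  have bdd: "bdd_above A" using ub by (auto simp: bdd_above_def)
  define l where "l = Sup A"
  have "(q \<longlongrightarrow> l) (at 0)"
  proof (rule order_tendstoI)
    fix a assume "a < l"
    then obtain r where "r \<in> A" "a < r" using less_cSup_iff[of A a] ne bdd by (auto simp: l_def)
    then show "\<forall>\<^sub>F h in at 0. a < q h" unfolding A_def mem_Collect_eq
      by (metis (mono_tags, lifting) eventually_mono order_less_le_trans)
  next
    fix a assume "l < a"
    obtain r where r: "r \<in> \<rat>" "l < r" "r < a" using Rats_dense_in_real[OF \<open>l < a\<close>] by auto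
    obtain s where s: "s \<in> \<rat>" "r < s" "s < a" using Rats_dense_in_real[OF \<open>r < a\<close>] by auto
    have "r \<notin> A" using r cSup_upper[OF _ bdd, of r] by (auto simp: l_def)
    then have "\<exists>\<^sub>F h in at 0. q h < r" by (simp add: A_def not_eventually not_le)
    with no r s have "\<not> (\<exists>\<^sub>F h in at 0. s < q h)" by blast
    then have "\<forall>\<^sub>F h in at 0. q h \<le> s" by (simp add: not_frequently not_less)
    then show "\<forall>\<^sub>F h in at 0. q h < a" by eventually_elim (use s in simp)
  qed
  then show ?thesis ..
qed

lemma AE_directional_derivative:
  fixes f :: "'a::euclidean_space \<Rightarrow> real"
  assumes lip: "L-lipschitz_on UNIV f"
  shows "AE z in lborel. \<exists>l. ((\<lambda>h. (f (z + h *\<^sub>R v) - f z) / h) \<longlongrightarrow> l) (at 0)"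
proof -
  have "AE z in lborel. \<forall>p\<in>\<rat> \<times> \<rat>. fst p < snd p \<longrightarrow> z \<notin> slope_gap f v (fst p) (snd p)"
    using slope_gap_null[OF lip]
    by (subst AE_ball_countable) (auto simp: countable_rat intro!: AE_not_in)
  then show ?thesis
    by eventually_elim (rule slope_limit_exists[OF lipschitz_slope_bound[OF lip]],
      auto simp: slope_gap_def)
qed

section \<open>Rademacher's theorem\<close>

lemma integral_lborel_shift:
  fixes f :: "'a::euclidean_space \<Rightarrow> real"
  assumes [measurable]: "f \<in> borel_measurable borel"
  shows "(\<integral>z. f (z + c) \<partial>lborel) = (\<integral>z. f z \<partial>lborel)"
proof -
  have "(\<integral>z. f z \<partial>lborel) = (\<integral>z. f z \<partial>distr lborel borel ((+) c))"
    by (simp add: lborel_distr_plus)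
  also have "\<dots> = (\<integral>z. f (z + c) \<partial>lborel)"
    by (subst integral_distr) (auto simp: add.commute)
  finally show ?thesis by simp
qed

text \<open>Shifting by the bound \<open>K\<close> makes \<open>(D z + K) / K\<close> nonnegative
  almost everywhere. The measure with this density gives every box its volume, so it is Lebesgue
  measure, and uniqueness of densities forces the density to be 1.\<close>

lemma AE_zero_if_box_integrals_zero:
  fixes D :: "'a::euclidean_space \<Rightarrow> real"
  assumes [measurable]: "D \<in> borel_measurable borel"
    and bd: "AE z in lborel. \<bar>D z\<bar> \<le> K" and K: "K > 0"
    and zero: "\<And>l u. (\<integral>z. indicator (box l u) z * D z \<partial>lborel) = 0"
  shows "AE z in lborel. D z = 0"
proof -
  let ?M = "density lborel (\<lambda>z. ennreal ((D z + K) / K))"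
  have "lborel = ?M"
  proof (rule lborel_eqI)
    fix l u :: 'a assume lu: "\<And>b. b \<in> Basis \<Longrightarrow> l \<bullet> b \<le> u \<bullet> b"
    have int: "integrable lborel (\<lambda>z. indicator (box l u) z * D z)"
    proof (rule integrableI_bounded_set[of "box l u" _ _ K])
      show "emeasure lborel (box l u) < \<infinity>" by (rule emeasure_bounded_finite[OF bounded_box])
      show "AE x in lborel. x \<in> box l u \<longrightarrow> norm (indicator (box l u) x * D x) \<le> K"
        using bd by eventually_elim auto
    qed auto
    have int1: "integrable lborel (indicator (box l u) :: 'a \<Rightarrow> real)"
      by (intro integrable_real_indicator emeasure_bounded_finite bounded_box) simp
    have "emeasure ?M (box l u) = (\<integral>\<^sup>+z. ennreal (indicator (box l u) z * ((D z + K) / K)) \<partial>lborel)"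
      by (subst emeasure_density) (auto intro!: nn_integral_cong split: split_indicator)
    also have "(\<lambda>z. indicator (box l u) z * ((D z + K) / K))
        = (\<lambda>z. (indicator (box l u) z * D z) / K + indicator (box l u) z)"
      using K by (auto simp: fun_eq_iff field_simps split: split_indicator)
    also have "(\<integral>\<^sup>+z. ennreal ((indicator (box l u) z * D z) / K + indicator (box l u) z) \<partial>lborel)
        = ennreal (\<integral>z. (indicator (box l u) z * D z) / K + indicator (box l u) z \<partial>lborel)"
    proof (rule nn_integral_eq_integral)
      show "AE z in lborel. 0 \<le> (indicator (box l u) z * D z) / K + indicator (box l u) z"
        using bd K by (auto simp: field_simps abs_le_iff split: split_indicator)
    qed (intro Bochner_Integration.integrable_add integrable_divide int int1)
    also have "(\<integral>z. (indicator (box l u) z * D z) / K + indicator (box l u) z \<partial>lborel) = measure lborel (box l u)"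
      by (subst Bochner_Integration.integral_add)
        (auto intro!: integrable_divide int int1 simp: zero)
    also have "ennreal \<dots> = (\<Prod>b\<in>Basis. (u - l) \<bullet> b)"
      using lu by (subst measure_lborel_box) auto
    finally show "emeasure ?M (box l u) = (\<Prod>b\<in>Basis. (u - l) \<bullet> b)" .
  qed simp
  then have "density lborel (\<lambda>z. 1) = ?M" by (simp add: density_1)
  then have "AE z in lborel. 1 = ennreal ((D z + K) / K)"
    by (subst (asm) sigma_finite_measure.density_unique_iff[OF lborel.sigma_finite_measure_axioms]) auto
  with bd show ?thesis
  proof eventually_elim
    case (elim z)
    then have "(D z + K) / K = 1" by (metis ennreal_eq_1)
    then show ?case using K by (simp add: field_simps)
  qed
qed

section \<open>Directional derivatives of Lipschitz functions and their linearity\<close>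

definition dq :: "('a::euclidean_space \<Rightarrow> real) \<Rightarrow> 'a \<Rightarrow> real \<Rightarrow> 'a \<Rightarrow> real" where
  "dq f v h z = (f (z + h *\<^sub>R v) - f z) / h"

text \<open>Taking the limit along the fixed sequence 1/(n+1) makes this measurable in
  \<open>z\<close>; by \<open>dq_tendsto_ddir\<close> it is the directional derivative wherever that
  exists.\<close>

definition ddir :: "('a::euclidean_space \<Rightarrow> real) \<Rightarrow> 'a \<Rightarrow> 'a \<Rightarrow> real" where
  "ddir f v z = lim (\<lambda>n. dq f v (1 / Suc n) z)"

lemma filterlim_inverse_Suc: "filterlim (\<lambda>n. 1 / real (Suc n)) (at 0) sequentially"
  by (rule filterlim_atI) (auto intro!: LIMSEQ_Suc[OF lim_1_over_n] simp del: of_nat_Suc)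

lemma dq_measurable[measurable]:
  assumes "f \<in> borel_measurable borel"
  shows "dq f v h \<in> borel_measurable borel"
  using assms unfolding dq_def[abs_def] by measurable

lemma ddir_measurable[measurable]:
  assumes [measurable]: "f \<in> borel_measurable borel"
  shows "ddir f v \<in> borel_measurable borel"
  unfolding ddir_def[abs_def] by (rule borel_measurable_lim_metric) measurable

lemma dq_tendsto_ddir:
  assumes "((\<lambda>h. dq f v h z) \<longlongrightarrow> l) (at 0)"
  shows "ddir f v z = l"
  unfolding ddir_def by (rule limI) (rule filterlim_compose[OF assms filterlim_inverse_Suc])

locale lipschitz_function =
  fixes f :: "'a::euclidean_space \<Rightarrow> real" and L
  assumes lip: "L-lipschitz_on UNIV f"
begin

lemma L_nonneg: "L \<ge> 0" using lip by (rule lipschitz_on_nonneg)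

lemma cont: "continuous_on UNIV f" using lip by (rule lipschitz_on_continuous_on)

lemma f_measurable[measurable]: "f \<in> borel_measurable borel"
  using cont by (rule borel_measurable_continuous_onI)

lemma dq_bound: "\<bar>dq f v h z\<bar> \<le> L * norm v"
  unfolding dq_def by (rule lipschitz_slope_bound[OF lip])

lemma AE_dq: "AE z in lborel. ((\<lambda>h. dq f v h z) \<longlongrightarrow> ddir f v z) (at 0)"
  using AE_directional_derivative[OF lip, of v]
proof eventually_elim
  case (elim z)
  then obtain l where "((\<lambda>h. dq f v h z) \<longlongrightarrow> l) (at 0)" unfolding dq_def by blast
  with dq_tendsto_ddir[OF this] show ?case by simp
qed

lemma AE_dq_seq: "AE z in lborel. (\<lambda>n. dq f v (1 / Suc n) z) \<longlonglongrightarrow> ddir f v z"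
  using AE_dq[of v] by eventually_elim (rule filterlim_compose[OF _ filterlim_inverse_Suc])

lemma AE_ddir_bound: "AE z in lborel. \<bar>ddir f v z\<bar> \<le> L * norm v"
  using AE_dq_seq[of v]
proof eventually_elim
  case (elim z)
  show ?case
    by (rule tendsto_upperbound[OF tendsto_rabs[OF elim]]) (auto simp: dq_bound)
qed

text \<open>Dominated convergence; the moving indicator converges off the boundary of the box, which
  is a null set. The displacement \<open>w\<close> is present because additivity of the derivative
  produces a quotient evaluated at \<open>z + h *\<^sub>R w\<close>, whose shift is moved to the
  box.\<close>

lemma box_integral_limit:
  fixes l u w :: 'a
  shows "(\<lambda>n. \<integral>z. indicator (box l u) (z - (1 / Suc n) *\<^sub>R w) * dq f v (1 / Suc n) z \<partial>lborel)
     \<longlonglongrightarrow> (\<integral>z. indicator (box l u) z * ddir f v z \<partial>lborel)"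
proof -
  obtain R where R: "box l u \<subseteq> ball 0 R"
    using bounded_box[of l u] bounded_subset_ballD by blast
  let ?B = "cball 0 (R + norm w) :: 'a set"
  show ?thesis
  proof (rule integral_dominated_convergence[where w = "\<lambda>z. indicator ?B z * (L * norm v)"])
    show "integrable lborel (\<lambda>z. indicator ?B z * (L * norm v))"
      by (intro integrable_mult_left integrable_real_indicator emeasure_bounded_finite bounded_cball) simp
    have "negligible (cbox l u - box l u)" by (rule negligible_frontier_interval)
    then have "cbox l u - box l u \<in> null_sets lborel"
      by (simp add: negligible_iff_null_sets null_sets_completion_iff)
    then have "AE z in lborel. z \<notin> cbox l u - box l u" by (rule AE_not_in)
    with AE_dq_seq[of v]
    show "AE z in lborel. (\<lambda>n. indicator (box l u) (z - (1 / Suc n) *\<^sub>R w) * dq f v (1 / Suc n) z)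
        \<longlonglongrightarrow> indicator (box l u) z * ddir f v z"
    proof eventually_elim
      case (elim z)
      have lim: "(\<lambda>n. z - (1 / Suc n) *\<^sub>R w) \<longlonglongrightarrow> z - 0 *\<^sub>R w"
        by (intro tendsto_intros LIMSEQ_Suc[OF lim_1_over_n])
      have "(\<lambda>n. indicator (box l u) (z - (1 / Suc n) *\<^sub>R w) :: real) \<longlonglongrightarrow> indicator (box l u) z"
      proof (cases "z \<in> box l u")
        case True
        have "\<forall>\<^sub>F n in sequentially. z - (1 / Suc n) *\<^sub>R w \<in> box l u"
          using topological_tendstoD[OF lim open_box, of l u] True by simp
        then have "\<forall>\<^sub>F n in sequentially. indicator (box l u) (z - (1 / Suc n) *\<^sub>R w) = (1::real)"
          by eventually_elim simp
        then show ?thesis using True by (simp add: tendsto_eventually)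
      next
        case False
        then have "z \<in> - cbox l u" using elim by auto
        then have "\<forall>\<^sub>F n in sequentially. z - (1 / Suc n) *\<^sub>R w \<in> - cbox l u"
          using topological_tendstoD[OF lim open_Compl[OF closed_cbox], of l u] by simp
        then have "\<forall>\<^sub>F n in sequentially. indicator (box l u) (z - (1 / Suc n) *\<^sub>R w) = (0::real)"
          by eventually_elim (use box_subset_cbox[of l u] in \<open>auto simp: indicator_def\<close>)
        then show ?thesis using False by (simp add: tendsto_eventually)
      qed
      then show ?case using elim(1) by (rule tendsto_mult)
    qed
    fix n
    show "AE z in lborel. norm (indicator (box l u) (z - (1 / Suc n) *\<^sub>R w) * dq f v (1 / Suc n) z)
        \<le> indicator ?B z * (L * norm v)"
    proof (rule AE_I2)
      fix z :: 'a
      have "z \<in> ?B" if "z - (1 / Suc n) *\<^sub>R w \<in> box l u"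
      proof -
        have "norm (z - (1 / Suc n) *\<^sub>R w) < R" using that R by auto
        moreover have "norm ((1 / Suc n) *\<^sub>R w) \<le> norm w"
          by (simp add: divide_le_eq mult_le_cancel_left1)
        ultimately show ?thesis
          using norm_triangle_ineq[of "z - (1 / Suc n) *\<^sub>R w" "(1 / Suc n) *\<^sub>R w"] by simp
      qed
      then show "norm (indicator (box l u) (z - (1 / Suc n) *\<^sub>R w) * dq f v (1 / Suc n) z)
        \<le> indicator ?B z * (L * norm v)"
        using dq_bound[of v "1 / Suc n" z] L_nonneg by (auto simp: indicator_def abs_mult)
    qed
  qed measurable
qed

lemma integrable_box_bounded:
  assumes [measurable]: "g \<in> borel_measurable borel" and bd: "AE z in lborel. \<bar>g z\<bar> \<le> K"
  shows "integrable lborel (\<lambda>z. indicator (box l (u::'a)) z * g z :: real)"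
proof (rule integrableI_bounded_set[of "box l u" _ _ K])
  show "emeasure lborel (box l u) < \<infinity>" by (rule emeasure_bounded_finite[OF bounded_box])
  show "AE x in lborel. x \<in> box l u \<longrightarrow> norm (indicator (box l u) x * g x) \<le> K"
    using bd by eventually_elim auto
qed auto

text \<open>The increment along \<open>v + w\<close> splits into one along \<open>w\<close> from
  \<open>z\<close> and one along \<open>v\<close> from \<open>z + h *\<^sub>R w\<close>. The second
  has a moving base point, so its limit cannot be taken pointwise; integrated over a box, a
  translation moves the shift to the box, where it disappears in the limit. Equality of all box
  integrals then gives equality almost everywhere.\<close>

lemma AE_ddir_add: "AE z in lborel. ddir f (v + w) z = ddir f v z + ddir f w z"
proof -
  let ?D = "\<lambda>z. ddir f (v + w) z - (ddir f v z + ddir f w z)"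
  have "AE z in lborel. ?D z = 0"
  proof (rule AE_zero_if_box_integrals_zero)
    show "AE z in lborel. \<bar>?D z\<bar> \<le> L * norm (v + w) + L * norm v + L * norm w + 1"
      using AE_ddir_bound[of "v + w"] AE_ddir_bound[of v] AE_ddir_bound[of w]
      by eventually_elim linarith
    show "0 < L * norm (v + w) + L * norm v + L * norm w + 1"
      using L_nonneg by (intro add_nonneg_pos) auto
    fix l u :: 'a
    let ?I = "\<lambda>w n. \<integral>z. indicator (box l u) z * dq f w (1 / Suc n) z \<partial>lborel"
    have split: "?I (v + w) n
      = (\<integral>z. indicator (box l u) (z - (1 / Suc n) *\<^sub>R w) * dq f v (1 / Suc n) z \<partial>lborel) + ?I w n" for n
    proof -
      define h where "h = 1 / real (Suc n)"
      have i: "integrable lborel (\<lambda>z. indicator (box l u) z * dq f v h (z + h *\<^sub>R w))"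
        by (rule integrable_box_bounded[OF _ AE_I2[OF dq_bound]]) measurable
      have j: "integrable lborel (\<lambda>z. indicator (box l u) z * dq f w h z)"
        by (rule integrable_box_bounded[OF _ AE_I2[OF dq_bound]]) measurable
      have "(\<integral>z. indicator (box l u) (z - h *\<^sub>R w) * dq f v h z \<partial>lborel)
        = (\<integral>z. indicator (box l u) (z + h *\<^sub>R w - h *\<^sub>R w) * dq f v h (z + h *\<^sub>R w) \<partial>lborel)"
        by (rule integral_lborel_shift[symmetric]) measurable
      also have "\<dots> = (\<integral>z. indicator (box l u) z * dq f v h (z + h *\<^sub>R w) \<partial>lborel)" by simp
      finally have "(\<integral>z. indicator (box l u) (z - h *\<^sub>R w) * dq f v h z \<partial>lborel)
          + (\<integral>z. indicator (box l u) z * dq f w h z \<partial>lborel)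
        = (\<integral>z. indicator (box l u) z * dq f v h (z + h *\<^sub>R w) + indicator (box l u) z * dq f w h z \<partial>lborel)"
        using i j by simp
      also have "\<dots> = (\<integral>z. indicator (box l u) z * dq f (v + w) h z \<partial>lborel)"
        by (intro Bochner_Integration.integral_cong)
          (auto simp: dq_def indicator_def add_divide_distrib[symmetric] scaleR_add_right add_ac)
      finally show ?thesis by (simp add: h_def)
    qed
    have "?I (v + w) \<longlonglongrightarrow> (\<integral>z. indicator (box l u) z * ddir f v z \<partial>lborel)
        + (\<integral>z. indicator (box l u) z * ddir f w z \<partial>lborel)"
      unfolding split using box_integral_limit[of l u 0 w]
      by (intro tendsto_add box_integral_limit) simp_all
    moreover have "?I (v + w) \<longlonglongrightarrow> (\<integral>z. indicator (box l u) z * ddir f (v + w) z \<partial>lborel)"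
      using box_integral_limit[of l u 0 "v + w"] by simp
    ultimately have eq: "(\<integral>z. indicator (box l u) z * ddir f (v + w) z \<partial>lborel)
      = (\<integral>z. indicator (box l u) z * ddir f v z \<partial>lborel)
        + (\<integral>z. indicator (box l u) z * ddir f w z \<partial>lborel)"
      by (rule LIMSEQ_unique[rotated])
    have int: "integrable lborel (\<lambda>z. indicator (box l u) z * ddir f w z)" for w
      by (rule integrable_box_bounded[OF _ AE_ddir_bound]) measurable
    show "(\<integral>z. indicator (box l u) z * ?D z \<partial>lborel) = 0"
      using eq int by (simp add: right_diff_distrib distrib_left)
  qed measurable
  then show ?thesis by eventually_elim simp
qed

lemma AE_ddir_scaleR: "AE z in lborel. ddir f (c *\<^sub>R v) z = c * ddir f v z"
  using AE_dq[of v]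
proof eventually_elim
  case (elim z)
  show ?case
  proof (cases "c = 0")
    case True
    have "((\<lambda>h. dq f 0 h z) \<longlongrightarrow> 0) (at 0)" by (simp add: dq_def)
    then show ?thesis using True dq_tendsto_ddir by auto
  next
    case False
    have "filterlim (\<lambda>h. h * c) (at 0) (at 0)"
    proof (rule filterlim_atI)
      show "((\<lambda>h. h * c) \<longlongrightarrow> 0) (at 0)" by (rule tendsto_eq_intros | simp)+
      show "\<forall>\<^sub>F h in at 0. h * c \<noteq> 0" using False by (simp add: eventually_at_filter)
    qed
    from filterlim_compose[OF elim this]
    have "((\<lambda>h. c * dq f v (h * c) z) \<longlongrightarrow> c * ddir f v z) (at 0)" by (intro tendsto_intros)
    moreover have "(\<lambda>h. c * dq f v (h * c) z) = (\<lambda>h. dq f (c *\<^sub>R v) h z)"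
      using False by (auto simp: dq_def)
    ultimately show ?thesis using dq_tendsto_ddir by metis
  qed
qed

text \<open>The exceptional null set depends on \<open>v\<close>, so this cannot be used for all
  directions at once.\<close>

lemma AE_ddir_linear:
  "AE z in lborel. ddir f v z = (\<Sum>b\<in>Basis. (v \<bullet> b) * ddir f b z)"
proof -
  have "AE z in lborel. ddir f (\<Sum>b\<in>A. (v \<bullet> b) *\<^sub>R b) z = (\<Sum>b\<in>A. (v \<bullet> b) * ddir f b z)"
    if "finite A" for A using that
  proof (induction A)
    case empty
    show ?case using AE_ddir_scaleR[of 0 0] by simp
  next
    case (insert a A)
    show ?case
      using insert.IH AE_ddir_scaleR[of "v \<bullet> a" a]
        AE_ddir_add[of "(v \<bullet> a) *\<^sub>R a" "\<Sum>b\<in>A. (v \<bullet> b) *\<^sub>R b"]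
      by eventually_elim (simp add: insert.hyps)
  qed
  from this[OF finite_Basis] show ?thesis by (simp add: euclidean_representation)
qed

text \<open>Convergence in each direction of \<open>W\<close> becomes uniform over the unit sphere
  by compactness: finitely many directions of \<open>W\<close> approximate all unit vectors. The
  Lipschitz bound on \<open>f\<close> and the boundedness of \<open>g\<close> carry the estimate
  from such a direction to a nearby one.\<close>

lemma has_derivative_from_dense_directions:
  fixes z :: 'a
  assumes dense: "\<And>U. open U \<Longrightarrow> U \<noteq> {} \<Longrightarrow> \<exists>w\<in>W. w \<in> U"
    and lim: "\<And>w. w \<in> W \<Longrightarrow> ((\<lambda>h. dq f w h z) \<longlongrightarrow> g w) (at 0)"
    and g: "bounded_linear g"
  shows "(f has_derivative g) (at z)"
proof -
  obtain G where G: "G > 0" "\<And>x. norm (g x) \<le> norm x * G"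
    using bounded_linear.pos_bounded[OF g] by auto
  show ?thesis unfolding has_derivative_at_alt
  proof (intro conjI allI impI)
    show "bounded_linear g" by (rule g)
    fix e :: real assume e: "0 < e"
    \<comment> \<open>Replacing a unit vector by a net direction costs \<open>L * \<delta>\<close>
      for \<open>f\<close> and \<open>G * \<delta>\<close> for \<open>g\<close>, together
      \<open>e / 2\<close>; the other half is the error of the quotient in the net
      direction.\<close>
    define \<delta> where "\<delta> = e / (2 * (L + G))"
    obtain Q where Q: "Q = L + G" by simp
    have LG: "Q > 0" using L_nonneg G Q by simp
    have \<delta>: "\<delta> > 0" using e LG by (simp add: \<delta>_def Q)
    have "sphere (0::'a) 1 \<subseteq> (\<Union>w\<in>W. ball w \<delta>)"
    proof
      fix x :: 'a
      obtain w where "w \<in> W" "w \<in> ball x \<delta>" using dense[of "ball x \<delta>"] \<delta> by auto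
      then show "x \<in> (\<Union>w\<in>W. ball w \<delta>)" by (auto simp: dist_commute)
    qed
    then obtain C where C: "C \<subseteq> W" "finite C" "sphere (0::'a) 1 \<subseteq> (\<Union>w\<in>C. ball w \<delta>)"
      using compactE_image[OF compact_sphere, of W "\<lambda>w. ball w \<delta>"] by (metis open_ball)
    have "\<forall>\<^sub>F h in at 0. \<forall>w\<in>C. \<bar>dq f w h z - g w\<bar> < e / 2"
    proof (rule eventually_ball_finite[OF C(2)], rule ballI)
      fix w assume "w \<in> C"
      with lim C(1) have "((\<lambda>h. dq f w h z) \<longlongrightarrow> g w) (at 0)" by blast
      then show "\<forall>\<^sub>F h in at 0. \<bar>dq f w h z - g w\<bar> < e / 2"
        using tendstoD[of _ "g w" "at 0" "e / 2"] e by (auto simp: dist_real_def)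
    qed
    then obtain d where d: "d > 0" "\<And>h w. h \<noteq> 0 \<Longrightarrow> \<bar>h\<bar> < d \<Longrightarrow> w \<in> C \<Longrightarrow> \<bar>dq f w h z - g w\<bar> < e / 2"
      by (auto simp: eventually_at dist_real_def)
    show "\<exists>d>0. \<forall>y. norm (y - z) < d \<longrightarrow> norm (f y - f z - g (y - z)) \<le> e * norm (y - z)"
    proof (intro exI[of _ d] conjI allI impI d(1))
      fix y assume y: "norm (y - z) < d"
      show "norm (f y - f z - g (y - z)) \<le> e * norm (y - z)"
      proof (cases "y = z")
        case True
        then show ?thesis using g by (simp add: linear_simps)
      next
        case False
        define h where "h = norm (y - z)"
        define x where "x = (y - z) /\<^sub>R h"
        have h: "h > 0" "h < d" using False y by (auto simp: h_def)
        have yz: "y - z = h *\<^sub>R x" "y = z + h *\<^sub>R x" using h by (auto simp: x_def)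
        have "norm x = 1" using h by (simp add: x_def h_def)
        then obtain w where w: "w \<in> C" "dist w x < \<delta>" using C(3) by auto
        have 1: "\<bar>f y - f (z + h *\<^sub>R w)\<bar> \<le> L * (h * \<delta>)"
        proof -
          have "\<bar>f y - f (z + h *\<^sub>R w)\<bar> \<le> L * norm (h *\<^sub>R x - h *\<^sub>R w)"
            using lipschitz_onD[OF lip, of y "z + h *\<^sub>R w"] by (simp add: dist_norm yz)
          also have "norm (h *\<^sub>R x - h *\<^sub>R w) = h * dist w x"
            using h by (simp add: scaleR_diff_right[symmetric] dist_norm norm_minus_commute)
          also have "L * (h * dist w x) \<le> L * (h * \<delta>)"
            using w h L_nonneg by (intro mult_left_mono) auto
          finally show ?thesis .
        qed
        have 2: "\<bar>f (z + h *\<^sub>R w) - f z - h * g w\<bar> \<le> h * (e / 2)"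
        proof -
          have "f (z + h *\<^sub>R w) - f z - h * g w = h * (dq f w h z - g w)"
            using h by (simp add: dq_def field_simps)
          then show ?thesis using d(2)[of h w] h w by (simp add: abs_mult)
        qed
        have 3: "\<bar>h * g w - h * g x\<bar> \<le> h * (\<delta> * G)"
        proof -
          have "\<bar>g w - g x\<bar> \<le> dist w x * G"
            using G(2)[of "w - x"] g by (simp add: linear_simps dist_norm)
          also have "\<dots> \<le> \<delta> * G" using w G(1) by (intro mult_right_mono) auto
          finally show ?thesis using h by (simp add: abs_mult right_diff_distrib[symmetric])
        qed
        have "g (y - z) = h * g x" using g by (simp add: yz linear_simps)
        then have "\<bar>f y - f z - g (y - z)\<bar> \<le> L * (h * \<delta>) + h * (e / 2) + h * (\<delta> * G)"
          using 1 2 3 by linarith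
        also have "\<dots> = h * (\<delta> * (L + G) + e / 2)" by (simp add: algebra_simps)
        also have "\<delta> * (L + G) = e / 2" using LG unfolding \<delta>_def Q[symmetric] by simp
        finally show ?thesis by (simp add: h_def mult.commute)
      qed
    qed
  qed
qed

theorem rademacher:
  "AE z in lborel. (f has_derivative (\<lambda>v. \<Sum>b\<in>Basis. (v \<bullet> b) * ddir f b z)) (at z)"
proof -
  obtain W :: "'a set" where W: "countable W" "\<And>U. open U \<Longrightarrow> U \<noteq> {} \<Longrightarrow> \<exists>w\<in>W. w \<in> U"
    using countable_dense_setE by blast
  have "AE z in lborel. \<forall>w\<in>W. ((\<lambda>h. dq f w h z) \<longlongrightarrow> (\<Sum>b\<in>Basis. (w \<bullet> b) * ddir f b z)) (at 0)"
  proof (subst AE_ball_countable[OF W(1)], rule ballI)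
    fix w
    show "AE z in lborel. ((\<lambda>h. dq f w h z) \<longlongrightarrow> (\<Sum>b\<in>Basis. (w \<bullet> b) * ddir f b z)) (at 0)"
      using AE_dq[of w] AE_ddir_linear[of w] by eventually_elim simp
  qed
  then show ?thesis
  proof eventually_elim
    case (elim z)
    show ?case
      by (rule has_derivative_from_dense_directions[OF W(2)])
        (use elim in \<open>auto intro!: bounded_linear_intros\<close>)
  qed
qed

end

section \<open>Boundary layers below a Lipschitz graph\<close>

lemma integrable_bounded_support:
  fixes f :: "'a::euclidean_space \<Rightarrow> real"
  assumes [measurable]: "f \<in> borel_measurable borel"
    and bd: "\<And>z. \<bar>f z\<bar> \<le> K" and supp: "\<And>z. norm z > R \<Longrightarrow> f z = 0"
  shows "integrable lborel f"
proof (rule integrableI_bounded_set[of "cball 0 R" _ _ K])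
  show "emeasure lborel (cball (0::'a) R) < \<infinity>" by (rule emeasure_bounded_finite[OF bounded_cball])
qed (use bd supp in \<open>auto simp: not_le[symmetric]\<close>)

lemma has_derivative_dq:
  assumes "(f has_derivative f') (at z)"
  shows "((\<lambda>h. dq f v h z) \<longlongrightarrow> f' v) (at 0)"
proof -
  have f: "(f has_derivative f') (at (z + 0 *\<^sub>R v))" using assms by simp
  have "((\<lambda>h::real. z + h *\<^sub>R v) has_derivative (\<lambda>h. h *\<^sub>R v)) (at 0)"
    by (auto intro!: derivative_eq_intros)
  from has_derivative_compose[OF this f]
  have "((\<lambda>h. f (z + h *\<^sub>R v)) has_derivative (\<lambda>h. f' (h *\<^sub>R v))) (at 0)" .
  moreover have "(\<lambda>h. f' (h *\<^sub>R v)) = (*) (f' v)"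
    using linear_scale[OF has_derivative_linear[OF assms]] by (simp add: fun_eq_iff mult.commute)
  ultimately have "((\<lambda>h. f (z + h *\<^sub>R v)) has_field_derivative f' v) (at 0)"
    by (simp add: has_field_derivative_def)
  then show ?thesis by (simp add: DERIV_def dq_def)
qed

text \<open>The gradient is an explicit argument, so the divergence of a family \<open>F b\<close>
  can be written as the sum of \<open>g b z \<bullet> b\<close> and products keep a computable
  gradient.\<close>

definition C1_on :: "'a::euclidean_space set \<Rightarrow> ('a \<Rightarrow> real) \<Rightarrow> ('a \<Rightarrow> 'a) \<Rightarrow> bool" where
  "C1_on W f g \<longleftrightarrow> open W \<and> (\<forall>z\<in>W. (f has_derivative (\<lambda>h. g z \<bullet> h)) (at z)) \<and> continuous_on W g"

lemma C1_on_continuous: "C1_on W f g \<Longrightarrow> continuous_on W f"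
  unfolding C1_on_def
  by (metis continuous_at_imp_continuous_on has_derivative_continuous)

lemma C1_on_gradient_unique:
  assumes "(f has_derivative (\<lambda>h. g \<bullet> h)) (at z)" "(f has_derivative (\<lambda>h. g' \<bullet> h)) (at z)"
  shows "g = g'"
  using has_derivative_unique[OF assms] by (metis vector_eq_rdot)

section \<open>Compactly supported C1 functions and their difference quotients\<close>

locale C1_compact =
  fixes G :: "'a::euclidean_space \<Rightarrow> real" and g R
  assumes C1: "C1_on UNIV G g" and supp: "\<And>z. norm z > R \<Longrightarrow> G z = 0"
begin

lemma G_deriv: "(G has_derivative (\<lambda>h. g z \<bullet> h)) (at z)"
  using C1 by (auto simp: C1_on_def)

lemma G_cont: "continuous_on UNIV G" using C1 by (rule C1_on_continuous)

lemma g_cont: "continuous_on UNIV g" using C1 by (auto simp: C1_on_def)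

lemma G_measurable[measurable]: "G \<in> borel_measurable borel"
  using G_cont by (rule borel_measurable_continuous_onI)

lemma g_measurable[measurable]: "g \<in> borel_measurable borel"
  using g_cont by (rule borel_measurable_continuous_onI)

lemma supp_g: assumes "norm z > R" shows "g z = 0"
proof -
  have "((\<lambda>z. 0) has_derivative (\<lambda>h. g z \<bullet> h)) (at z)"
  proof (rule has_derivative_transform_within_open[OF G_deriv])
    show "open (- cball (0::'a) R)" by auto
    show "z \<in> - cball (0::'a) R" using assms by simp
  qed (simp add: supp)
  from C1_on_gradient_unique[OF this, of 0] show ?thesis by simp
qed

lemma G_bounded: obtains K where "K \<ge> 0" "\<And>z. \<bar>G z\<bar> \<le> K"
proof -
  have "bounded (G ` cball 0 R)"
    by (intro compact_imp_bounded compact_continuous_image continuous_on_subset[OF G_cont]) auto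
  then obtain K where K: "\<And>z. z \<in> cball 0 R \<Longrightarrow> \<bar>G z\<bar> \<le> K"
    unfolding bounded_iff real_norm_def by blast
  have "\<bar>G z\<bar> \<le> max 0 K" for z
    using K[of z] supp[of z] by (cases "norm z > R") auto
  then show ?thesis by (intro that[of "max 0 K"]) auto
qed

lemma g_bounded: obtains K where "K \<ge> 0" "\<And>z. norm (g z) \<le> K"
proof -
  have "bounded (g ` cball 0 R)"
    by (intro compact_imp_bounded compact_continuous_image continuous_on_subset[OF g_cont]) auto
  then obtain K where K: "\<And>z. z \<in> cball 0 R \<Longrightarrow> norm (g z) \<le> K"
    unfolding bounded_iff by blast
  have "norm (g z) \<le> max 0 K" for z
    using K[of z] supp_g[of z] by (cases "norm z > R") auto
  then show ?thesis by (intro that[of "max 0 K"]) auto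
qed

lemma G_lipschitz: obtains K where "K-lipschitz_on UNIV G"
proof -
  obtain K where K: "K \<ge> 0" "\<And>z. norm (g z) \<le> K" using g_bounded by blast
  have "norm (G x - G y) \<le> K * norm (x - y)" for x y
  proof (rule differentiable_bound[OF convex_UNIV])
    show "(G has_derivative (\<lambda>h. g z \<bullet> h)) (at z within UNIV)" for z using G_deriv by simp
    show "onorm (\<lambda>h. g z \<bullet> h) \<le> K" for z
      by (rule onorm_bound[OF K(1)])
        (metis Cauchy_Schwarz_ineq2 K(2) mult_right_mono norm_ge_zero order_trans real_norm_def)
  qed auto
  then have "K-lipschitz_on UNIV G" using K(1) by (auto simp: lipschitz_on_def dist_norm)
  then show ?thesis by (rule that)
qed

lemma dq_integral_limit:
  assumes [measurable]: "S \<in> sets borel"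
  shows "(\<lambda>n. \<integral>z. indicator S z * dq G b (1 / Suc n) z \<partial>lborel)
     \<longlonglongrightarrow> (\<integral>z. indicator S z * (g z \<bullet> b) \<partial>lborel)"
proof -
  obtain K where K: "K-lipschitz_on UNIV G" using G_lipschitz .
  interpret lipschitz_function G K by standard (rule K)
  let ?B = "cball 0 (R + norm b) :: 'a set"
  show ?thesis
  proof (rule integral_dominated_convergence[where w = "\<lambda>z. indicator ?B z * (K * norm b)"])
    show "integrable lborel (\<lambda>z. indicator ?B z * (K * norm b))"
      by (intro integrable_mult_left integrable_real_indicator emeasure_bounded_finite bounded_cball) simp
    show "AE z in lborel. (\<lambda>n. indicator S z * dq G b (1 / Suc n) z) \<longlonglongrightarrow> indicator S z * (g z \<bullet> b)"
      by (intro AE_I2 tendsto_mult tendsto_const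
          filterlim_compose[OF has_derivative_dq[OF G_deriv] filterlim_inverse_Suc])
    fix n
    show "AE z in lborel. norm (indicator S z * dq G b (1 / Suc n) z) \<le> indicator ?B z * (K * norm b)"
    proof (rule AE_I2)
      fix z :: 'a
      have "dq G b (1 / Suc n) z = 0" if "z \<notin> ?B"
      proof -
        have "norm ((1 / Suc n) *\<^sub>R b) \<le> norm b" by (simp add: divide_le_eq mult_le_cancel_left1)
        then have "norm (z + (1 / Suc n) *\<^sub>R b) > R"
          using that norm_triangle_ineq4[of "z + (1 / Suc n) *\<^sub>R b" "(1 / Suc n) *\<^sub>R b"] by simp
        moreover have "norm z > R" using that norm_ge_zero[of b] by (simp del: norm_ge_zero)
        ultimately show ?thesis by (simp add: dq_def supp)
      qed
      then show "norm (indicator S z * dq G b (1 / Suc n) z) \<le> indicator ?B z * (K * norm b)"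
        using dq_bound[of b "1 / Suc n" z] L_nonneg by (auto simp: indicator_def)
    qed
  qed measurable
qed

text \<open>Moving the difference quotient from the function to the indicator of the domain replaces the
  volume integral by one over a thin layer along the boundary.\<close>
lemma boundary_layer_limit:
  assumes [measurable]: "S \<in> sets borel"
  shows "(\<lambda>n. \<integral>z. G z * ((indicator S (z - (1 / Suc n) *\<^sub>R b) - indicator S z) / (1 / Suc n)) \<partial>lborel)
     \<longlonglongrightarrow> (\<integral>z. indicator S z * (g z \<bullet> b) \<partial>lborel)"
proof -
  obtain K where K: "K \<ge> 0" "\<And>z. \<bar>G z\<bar> \<le> K" using G_bounded by blast
  have eq: "(\<integral>z. G z * ((indicator S (z - h *\<^sub>R b) - indicator S z) / h) \<partial>lborel)
      = (\<integral>z. indicator S z * dq G b h z \<partial>lborel)" for h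
  proof -
    have i: "integrable lborel (\<lambda>z. indicator S z * G z / h)"
    proof -
      have "integrable lborel (\<lambda>z. indicator S z * G z)"
        by (rule integrable_bounded_support[of _ K R])
          (auto simp: supp K indicator_def)
      then show ?thesis by simp
    qed
    have j: "integrable lborel (\<lambda>z. indicator S (z - h *\<^sub>R b) * G z / h)"
    proof -
      have "integrable lborel (\<lambda>z. indicator S (z - h *\<^sub>R b) * G z)"
        by (rule integrable_bounded_support[of _ K R])
          (auto simp: supp K indicator_def)
      then show ?thesis by simp
    qed
    have k: "integrable lborel (\<lambda>z. indicator S z * G (z + h *\<^sub>R b) / h)"
    proof -
      have "integrable lborel (\<lambda>z. indicator S z * G (z + h *\<^sub>R b))"
      proof (rule integrable_bounded_support[of _ K "R + norm (h *\<^sub>R b)"])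
        fix z :: 'a assume "norm z > R + norm (h *\<^sub>R b)"
        then have "norm (z + h *\<^sub>R b) > R"
          using norm_triangle_ineq4[of "z + h *\<^sub>R b" "h *\<^sub>R b"] by simp
        then show "indicator S z * G (z + h *\<^sub>R b) = 0" by (simp add: supp)
      qed (auto simp: K indicator_def)
      then show ?thesis by simp
    qed
    have "(\<integral>z. indicator S (z - h *\<^sub>R b) * G z / h \<partial>lborel)
      = (\<integral>z. indicator S (z + h *\<^sub>R b - h *\<^sub>R b) * G (z + h *\<^sub>R b) / h \<partial>lborel)"
      by (rule integral_lborel_shift[symmetric]) measurable
    then have s: "(\<integral>z. indicator S (z - h *\<^sub>R b) * G z / h \<partial>lborel)
      = (\<integral>z. indicator S z * G (z + h *\<^sub>R b) / h \<partial>lborel)" by simp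
    have "(\<integral>z. G z * ((indicator S (z - h *\<^sub>R b) - indicator S z) / h) \<partial>lborel)
      = (\<integral>z. indicator S (z - h *\<^sub>R b) * G z / h - indicator S z * G z / h \<partial>lborel)"
      by (intro Bochner_Integration.integral_cong) (auto simp: field_simps diff_divide_distrib)
    also have "\<dots> = (\<integral>z. indicator S z * G (z + h *\<^sub>R b) / h - indicator S z * G z / h \<partial>lborel)"
      unfolding Bochner_Integration.integral_diff[OF j i] Bochner_Integration.integral_diff[OF k i] s ..
    also have "\<dots> = (\<integral>z. indicator S z * dq G b h z \<partial>lborel)"
      by (intro Bochner_Integration.integral_cong) (auto simp: dq_def field_simps diff_divide_distrib)
    finally show ?thesis .
  qed
  show ?thesis unfolding eq by (rule dq_integral_limit[OF assms])
qed

end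

section \<open>Continuous functions integrated against differences of half-line indicators\<close>

context
  fixes \<phi> :: "real \<Rightarrow> real"
  assumes cont: "continuous_on UNIV \<phi>"
begin

lemma phi_measurable: "\<phi> \<in> borel_measurable borel"
  using cont by (rule borel_measurable_continuous_onI)

text \<open>The difference of the two indicators is, up to sign, the indicator of the interval
  between \<open>a\<close> and \<open>x\<close>. The reference value \<open>c\<close> is free:
  \<open>c = \<phi> a\<close> gives the limit of the quotients, \<open>c = 0\<close> a bound uniform
  in the position.\<close>

lemma step_difference_integral_bound:
  assumes \<epsilon>: "\<And>s. min x a \<le> s \<Longrightarrow> s \<le> max x a \<Longrightarrow> \<bar>\<phi> s - c\<bar> \<le> \<epsilon>"
  shows "integrable lborel (\<lambda>s. \<phi> s * (indicator {..<x} s - indicator {..<a} s))"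
    "\<bar>(\<integral>s. \<phi> s * (indicator {..<x} s - indicator {..<a} s) \<partial>lborel) - c * (x - a)\<bar> \<le> \<epsilon> * \<bar>x - a\<bar>"
proof -
  note phi_measurable[measurable]
  let ?D = "\<lambda>s. indicator {..<x} s - indicator {..<a} s :: real"
  let ?I = "{min x a..<max x a}"
  define \<sigma> :: real where "\<sigma> = (if a \<le> x then 1 else -1)"
  have D: "?D = (\<lambda>s. \<sigma> * indicator ?I s)"
    by (auto simp: \<sigma>_def fun_eq_iff indicator_def)
  have iI: "integrable lborel (indicator ?I :: real \<Rightarrow> real)" by simp
  then have iD: "integrable lborel ?D" unfolding D by (intro integrable_mult_right) auto
  have "(\<integral>s. ?D s \<partial>lborel) = \<sigma> * measure lborel ?I" unfolding D by simp
  also have "\<dots> = x - a" by (auto simp: \<sigma>_def min_def max_def)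
  finally have ID: "(\<integral>s. ?D s \<partial>lborel) = x - a" .
  have iF: "integrable lborel (\<lambda>s. (\<phi> s - c) * ?D s)"
  proof (rule integrableI_bounded_set[of ?I _ _ \<epsilon>])
    show "AE s in lborel. s \<in> ?I \<longrightarrow> norm ((\<phi> s - c) * ?D s) \<le> \<epsilon>"
      using \<epsilon> by (intro AE_I2) (auto simp: D \<sigma>_def indicator_def abs_mult)
  qed (auto simp: D)
  have eq: "(\<lambda>s. \<phi> s * ?D s) = (\<lambda>s. (\<phi> s - c) * ?D s + c * ?D s)"
    by (auto simp: algebra_simps)
  show "integrable lborel (\<lambda>s. \<phi> s * ?D s)"
    unfolding eq using iF iD by (intro Bochner_Integration.integrable_add integrable_mult_right) auto
  have "(\<integral>s. \<phi> s * ?D s \<partial>lborel) - c * (x - a) = (\<integral>s. (\<phi> s - c) * ?D s \<partial>lborel)"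
    unfolding eq using iF iD ID by simp
  also have "\<bar>\<dots>\<bar> \<le> (\<integral>s. \<epsilon> * indicator ?I s \<partial>lborel)"
    unfolding real_norm_def[symmetric]
  proof (rule Bochner_Integration.integral_norm_bound_integral[OF iF])
    show "integrable lborel (\<lambda>s. \<epsilon> * indicator ?I s)" using iI by (intro integrable_mult_right)
    show "norm ((\<phi> s - c) * ?D s) \<le> \<epsilon> * indicator ?I s" for s
      using \<epsilon>[of s] by (auto simp: D \<sigma>_def indicator_def abs_mult)
  qed
  also have "\<dots> = \<epsilon> * \<bar>x - a\<bar>" by (auto simp: min_def max_def)
  finally show "\<bar>(\<integral>s. \<phi> s * ?D s \<partial>lborel) - c * (x - a)\<bar> \<le> \<epsilon> * \<bar>x - a\<bar>" .
qed

text \<open>If the end point \<open>\<alpha> n\<close> leaves \<open>a\<close> with velocity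
  \<open>d\<close>, the quotient of the indicators acts in the limit as \<open>d\<close> times a
  point mass at \<open>a\<close>.\<close>

lemma step_difference_quotient_limit:
  assumes lim: "(\<lambda>n. (\<alpha> n - a) / h n) \<longlonglongrightarrow> d" and h: "h \<longlonglongrightarrow> 0" "\<And>n. h n > 0"
  shows "(\<lambda>n. \<integral>s. \<phi> s * ((indicator {..<\<alpha> n} s - indicator {..<a} s) / h n) \<partial>lborel)
     \<longlonglongrightarrow> \<phi> a * d"
proof -
  let ?q = "\<lambda>n. (\<alpha> n - a) / h n"
  let ?I = "\<lambda>n. \<integral>s. \<phi> s * ((indicator {..<\<alpha> n} s - indicator {..<a} s) / h n) \<partial>lborel"
  have "(\<lambda>n. ?q n * h n) \<longlonglongrightarrow> d * 0" by (intro tendsto_mult lim h)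
  moreover have "?q n * h n = \<alpha> n - a" for n using h(2)[of n] by simp
  ultimately have al: "(\<lambda>n. \<alpha> n - a) \<longlonglongrightarrow> 0" by simp
  have "(\<lambda>n. ?I n - \<phi> a * ?q n) \<longlonglongrightarrow> 0"
  proof (rule tendstoI)
    fix \<epsilon> :: real assume \<epsilon>: "\<epsilon> > 0"
    \<comment> \<open>The quotients are eventually bounded by \<open>\<bar>d\<bar> + 1\<close>, so
      an oscillation of \<open>\<phi>\<close> below \<open>\<eta>\<close> costs at most
      \<open>\<epsilon> / 2\<close>.\<close>
    define \<eta> where "\<eta> = \<epsilon> / (2 * (\<bar>d\<bar> + 1))"
    have \<eta>: "\<eta> > 0" using \<epsilon> by (simp add: \<eta>_def)
    have "isCont \<phi> a" using cont by (simp add: continuous_on_eq_continuous_at)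
    then obtain \<delta> where \<delta>: "\<delta> > 0" "\<And>s. \<bar>s - a\<bar> < \<delta> \<Longrightarrow> \<bar>\<phi> s - \<phi> a\<bar> < \<eta>"
      using \<eta> unfolding continuous_at_eps_delta by (auto simp: dist_real_def)
    have "\<forall>\<^sub>F n in sequentially. \<bar>\<alpha> n - a\<bar> < \<delta>"
      using tendstoD[OF al \<delta>(1)] by simp
    moreover have "\<forall>\<^sub>F n in sequentially. \<bar>?q n - d\<bar> < 1"
      using tendstoD[OF lim, of 1] by (simp add: dist_real_def)
    ultimately show "\<forall>\<^sub>F n in sequentially. dist (?I n - \<phi> a * ?q n) 0 < \<epsilon>"
    proof eventually_elim
      case (elim n)
      have "\<bar>(\<integral>s. \<phi> s * (indicator {..<\<alpha> n} s - indicator {..<a} s) \<partial>lborel) - \<phi> a * (\<alpha> n - a)\<bar>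
          \<le> \<eta> * \<bar>\<alpha> n - a\<bar>"
      proof (rule step_difference_integral_bound(2))
        fix s assume "min (\<alpha> n) a \<le> s" "s \<le> max (\<alpha> n) a"
        then have "\<bar>s - a\<bar> < \<delta>" using elim(1) by (auto simp: min_def max_def split: if_splits)
        then show "\<bar>\<phi> s - \<phi> a\<bar> \<le> \<eta>" using \<delta>(2) less_imp_le by blast
      qed
      then have "\<bar>(\<integral>s. \<phi> s * (indicator {..<\<alpha> n} s - indicator {..<a} s) \<partial>lborel) - \<phi> a * (\<alpha> n - a)\<bar> / h n
          \<le> \<eta> * \<bar>\<alpha> n - a\<bar> / h n"
        using h(2)[of n] by (intro divide_right_mono) auto
      moreover have "?I n - \<phi> a * ?q n
        = ((\<integral>s. \<phi> s * (indicator {..<\<alpha> n} s - indicator {..<a} s) \<partial>lborel) - \<phi> a * (\<alpha> n - a)) / h n"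
        by (simp only: times_divide_eq_right integral_divide_zero
            diff_divide_distrib[of _ "\<phi> a * (\<alpha> n - a)"])
      ultimately have "\<bar>?I n - \<phi> a * ?q n\<bar> \<le> \<eta> * \<bar>?q n\<bar>"
        using h(2)[of n] by (simp add: abs_divide)
      also have "\<dots> \<le> \<eta> * (\<bar>d\<bar> + 1)" using elim(2) \<eta> by (intro mult_left_mono) auto
      also have "\<dots> = \<epsilon> / 2"
      proof -
        obtain Q where Q: "\<bar>d\<bar> + 1 = Q" "Q > 0" by (metis abs_ge_zero add_nonneg_pos zero_less_one)
        show ?thesis using Q(2) unfolding \<eta>_def Q(1) by simp
      qed
      finally show ?case using \<epsilon> by simp
    qed
  qed
  from tendsto_add[OF this tendsto_mult[OF tendsto_const[of "\<phi> a"] lim]] show ?thesis by simp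
qed

end

text \<open>The layer integrand \<open>H n\<close> is of size \<open>1 / h n\<close> on a layer of
  comparable thickness, so it has no useful pointwise limit. Its average \<open>J n\<close> along
  \<open>e\<close> is bounded uniformly in \<open>n\<close> and converges wherever
  \<open>\<gamma>\<close> is differentiable, since on each line parallel to \<open>e\<close> the
  domain is a half-line ending at the graph. By translation invariance the integral changes only by
  the constant factor \<open>c\<close>.\<close>

lemma divergence_below_graph:
  fixes \<gamma> :: "'a::euclidean_space \<Rightarrow> real" and G :: "'a \<Rightarrow> 'a \<Rightarrow> real" and g :: "'a \<Rightarrow> 'a \<Rightarrow> 'a"
  assumes lip: "L-lipschitz_on UNIV \<gamma>"
    and shift: "\<And>z s. \<gamma> (z + s *\<^sub>R e) = \<gamma> z - s"
    and C1: "\<And>b. b \<in> Basis \<Longrightarrow> C1_compact (G b) (g b) R"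
    and tangential: "\<And>y D. \<gamma> y = 0 \<Longrightarrow> (\<gamma> has_derivative D) (at y) \<Longrightarrow> (\<Sum>b\<in>Basis. G b y * D b) = 0"
  shows "(\<integral>z. indicator {z. 0 < \<gamma> z} z * (\<Sum>b\<in>Basis. g b z \<bullet> b) \<partial>lborel) = 0"
proof -
  interpret \<gamma>: lipschitz_function \<gamma> L by standard (rule lip)
  define S where "S = {z. 0 < \<gamma> z}"
  have S[measurable]: "S \<in> sets borel"
    unfolding S_def by (intro borel_open open_Collect_less \<gamma>.cont continuous_on_const)
  define h where "h n = 1 / real (Suc n)" for n
  have h: "h n > 0" "h \<longlonglongrightarrow> 0" for n
  proof -
    show "h n > 0" by (simp add: h_def)
    show "h \<longlonglongrightarrow> 0" unfolding h_def[abs_def] by (rule LIMSEQ_Suc[OF lim_1_over_n])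
  qed
  have Gm: "G b \<in> borel_measurable borel" if "b \<in> Basis" for b
    using C1_compact.G_measurable[OF C1[OF that]] .
  \<comment> \<open>Both the sum over \<open>b\<close> and the averaging must precede the limit: the
    tangency condition cancels only the complete sum.\<close>
  define H where "H n z = (\<Sum>b\<in>Basis. G b z * ((indicator S (z - h n *\<^sub>R b) - indicator S z) / h n))" for n z
  have "\<exists>M\<ge>0. \<forall>z. \<bar>G b z\<bar> \<le> M" if "b \<in> Basis" for b
    by (rule C1_compact.G_bounded[OF C1[OF that]]) blast
  then have "\<forall>b\<in>Basis. \<exists>M\<ge>0. \<forall>z. \<bar>G b z\<bar> \<le> M" by blast
  from bchoice[OF this] obtain M
    where M: "\<And>b. b \<in> Basis \<Longrightarrow> M b \<ge> 0" "\<And>b z. b \<in> Basis \<Longrightarrow> \<bar>G b z\<bar> \<le> M b"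
    by blast
  have supp: "G b z = 0" if "b \<in> Basis" "norm z > R" for b z
    using C1_compact.supp[OF C1[OF that(1)] that(2)] .
  have Htm: "(\<lambda>z. G b z * ((indicator S (z - h n *\<^sub>R b) - indicator S z) / h n)) \<in> borel_measurable borel"
    if "b \<in> Basis" for b n
  proof -
    have [measurable]: "G b \<in> borel_measurable borel" by (rule Gm[OF that])
    show ?thesis by measurable
  qed
  have Hm[measurable]: "H n \<in> borel_measurable borel" for n
    unfolding H_def[abs_def] by (intro borel_measurable_sum Htm)
  have Hterm: "\<bar>G b z * ((indicator S (z - h n *\<^sub>R b) - indicator S z) / h n)\<bar> \<le> M b * (1 / h n)"
    if "b \<in> Basis" for b z n
    unfolding abs_mult using h(1)[of n] M[OF that]
    by (intro mult_mono) (auto simp: indicator_def)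
  have Hi: "integrable lborel (\<lambda>z. G b z * ((indicator S (z - h n *\<^sub>R b) - indicator S z) / h n))"
    if "b \<in> Basis" for b n
    by (rule integrable_bounded_support[OF Htm[OF that] Hterm[OF that], where R = R])
      (use that in \<open>simp add: supp\<close>)
  have Hb: "\<bar>H n z\<bar> \<le> (\<Sum>b\<in>Basis. M b * (1 / h n))" for n z
    unfolding H_def by (rule order_trans[OF sum_abs sum_mono[OF Hterm]])
  have Hs: "H n z = 0" if "norm z > R" for n z
    unfolding H_def using that supp by simp
  have "(\<lambda>n. \<Sum>b\<in>Basis. \<integral>z. G b z * ((indicator S (z - h n *\<^sub>R b) - indicator S z) / h n) \<partial>lborel)
    \<longlonglongrightarrow> (\<Sum>b\<in>Basis. \<integral>z. indicator S z * (g b z \<bullet> b) \<partial>lborel)"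
    unfolding h_def by (intro tendsto_sum C1_compact.boundary_layer_limit[OF C1] S)
  moreover have "(\<Sum>b\<in>Basis. \<integral>z. indicator S z * (g b z \<bullet> b) \<partial>lborel)
      = (\<integral>z. indicator S z * (\<Sum>b\<in>Basis. g b z \<bullet> b) \<partial>lborel)"
  proof (subst Bochner_Integration.integral_sum[symmetric])
    fix b :: 'a assume b: "b \<in> Basis"
    interpret G: C1_compact "G b" "g b" R by (rule C1[OF b])
    obtain K where K: "K \<ge> 0" "\<And>z. norm (g b z) \<le> K" using G.g_bounded by blast
    show "integrable lborel (\<lambda>z. indicator S z * (g b z \<bullet> b))"
    proof (rule integrable_bounded_support[of _ K R])
      fix z
      have "\<bar>g b z \<bullet> b\<bar> \<le> K"
        using Basis_le_norm[OF b, of "g b z"] K(2)[of z] by linarith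
      then show "\<bar>indicator S z * (g b z \<bullet> b)\<bar> \<le> K" using K(1) by (auto simp: indicator_def)
    qed (auto simp: G.supp_g)
  qed (simp add: sum_distrib_left)
  ultimately have lim1: "(\<lambda>n. \<integral>z. H n z \<partial>lborel) \<longlonglongrightarrow> (\<integral>z. indicator S z * (\<Sum>b\<in>Basis. g b z \<bullet> b) \<partial>lborel)"
    unfolding H_def using Hi by (subst Bochner_Integration.integral_sum) auto
  \<comment> \<open>A continuous weight of compact support keeps \<open>J n\<close> compactly
    supported; continuity lets its product with \<open>G b\<close> be evaluated at the end point of
    the half-line.\<close>
  define \<theta> :: "real \<Rightarrow> real" where "\<theta> s = max 0 (1 - \<bar>s\<bar>)" for s
  have \<theta>c: "continuous_on UNIV \<theta>" unfolding \<theta>_def by (intro continuous_intros)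
  then have [measurable]: "\<theta> \<in> borel_measurable borel" by (rule borel_measurable_continuous_onI)
  have \<theta>b: "0 \<le> \<theta> s" "\<theta> s \<le> 1" "\<bar>s\<bar> > 1 \<Longrightarrow> \<theta> s = 0" for s by (auto simp: \<theta>_def)
  have \<theta>i: "integrable lborel \<theta>"
    by (rule integrable_bounded_support[of _ 1 1]) (use \<theta>b in auto)
  define c where "c = (\<integral>s. \<theta> s \<partial>lborel)"
  \<comment> \<open>Only positivity of \<open>c\<close> matters, for it is divided out at the end;
    the weight is at least 1/2 on this interval of length 1.\<close>
  have "(\<integral>s. (1/2) * indicator {-(1/2)..1/2::real} s \<partial>lborel) \<le> c" unfolding c_def
  proof (rule integral_mono[OF _ \<theta>i])
    show "integrable lborel (\<lambda>s. (1/2) * indicator {-(1/2)..1/2::real} s :: real)"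
      by (intro integrable_mult_right) simp
  qed (auto simp: \<theta>_def indicator_def)
  then have c: "c > 0" by simp
  define J where "J n z = (\<integral>s. \<theta> s * H n (z + s *\<^sub>R e) \<partial>lborel)" for n z
  have Jm[measurable]: "J n \<in> borel_measurable borel" for n
    unfolding J_def[abs_def] by measurable
  have fub: "(\<integral>z. J n z \<partial>lborel) = c * (\<integral>z. H n z \<partial>lborel)" for n
  proof -
    have "integrable lborel (\<lambda>p::real \<times> 'a. \<theta> (fst p) * H n (snd p + fst p *\<^sub>R e))"
    proof (rule integrable_bounded_support[of _ "\<Sum>b\<in>Basis. M b * (1 / h n)" "1 + (R + norm e)"])
      fix p :: "real \<times> 'a"
      have "\<bar>\<theta> (fst p) * H n (snd p + fst p *\<^sub>R e)\<bar> \<le> 1 * (\<Sum>b\<in>Basis. M b * (1 / h n))"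
        unfolding abs_mult using \<theta>b Hb by (intro mult_mono) auto
      then show "\<bar>\<theta> (fst p) * H n (snd p + fst p *\<^sub>R e)\<bar> \<le> (\<Sum>b\<in>Basis. M b * (1 / h n))" by simp
      assume p: "norm p > 1 + (R + norm e)"
      show "\<theta> (fst p) * H n (snd p + fst p *\<^sub>R e) = 0"
      proof (cases "\<bar>fst p\<bar> > 1")
        case False
        have "norm p \<le> \<bar>fst p\<bar> + norm (snd p)" using norm_Pair_le[of "fst p" "snd p"] by simp
        then have "norm (snd p) > R + norm e" using p False by linarith
        moreover have "norm (fst p *\<^sub>R e) \<le> norm e"
          using False by (simp add: mult_left_le_one_le)
        ultimately have "norm (snd p + fst p *\<^sub>R e) > R"
          using norm_triangle_ineq4[of "snd p + fst p *\<^sub>R e" "fst p *\<^sub>R e"] by simp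
        then show ?thesis by (simp add: Hs)
      qed (simp add: \<theta>b)
    qed (subst borel_prod[symmetric], measurable)
    then have "integrable (lborel \<Otimes>\<^sub>M lborel) (\<lambda>(s, z). \<theta> s * H n (z + s *\<^sub>R e))"
      by (simp add: lborel_prod split_beta')
    then have "(\<integral>z. \<integral>s. \<theta> s * H n (z + s *\<^sub>R e) \<partial>lborel \<partial>lborel)
        = (\<integral>s. \<integral>z. \<theta> s * H n (z + s *\<^sub>R e) \<partial>lborel \<partial>lborel)"
      by (rule lborel_pair.Fubini_integral)
    also have "\<dots> = (\<integral>s. \<theta> s * (\<integral>z. H n z \<partial>lborel) \<partial>lborel)"
      by (simp add: integral_lborel_shift)
    also have "\<dots> = c * (\<integral>z. H n z \<partial>lborel)" by (simp add: c_def)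
    finally show ?thesis by (simp add: J_def)
  qed
  have Gc: "continuous_on UNIV (\<lambda>s. \<theta> s * G b (z + s *\<^sub>R e))" if "b \<in> Basis" for b z
    by (intro continuous_intros \<theta>c continuous_on_compose2[OF C1_compact.G_cont[OF C1[OF that]]]) auto
  have \<theta>G: "\<bar>\<theta> s * G b (z + s *\<^sub>R e)\<bar> \<le> M b" if "b \<in> Basis" for b z s
  proof -
    have "\<bar>\<theta> s * G b (z + s *\<^sub>R e)\<bar> \<le> 1 * M b"
      unfolding abs_mult using \<theta>b M[OF that] by (intro mult_mono) auto
    then show ?thesis by simp
  qed
  \<comment> \<open>The unit slope along \<open>e\<close> turns both indicators into half-line
    indicators in \<open>s\<close>, with end points \<open>\<gamma> (z - h n *\<^sub>R b)\<close>
    and \<open>\<gamma> z\<close>.\<close>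
  have ind: "indicator S (z + s *\<^sub>R e - h n *\<^sub>R b) = (indicator {..<\<gamma> (z - h n *\<^sub>R b)} s :: real)"
    "indicator S (z + s *\<^sub>R e) = (indicator {..<\<gamma> z} s :: real)" for z s n b
    using shift[of "z - h n *\<^sub>R b" s] shift[of z s]
    by (auto simp: S_def indicator_def algebra_simps)
  have Jeq: "J n z = (\<Sum>b\<in>Basis. \<integral>s. (\<theta> s * G b (z + s *\<^sub>R e))
      * ((indicator {..<\<gamma> (z - h n *\<^sub>R b)} s - indicator {..<\<gamma> z} s) / h n) \<partial>lborel)" for n z
  proof -
    have "J n z = (\<integral>s. (\<Sum>b\<in>Basis. (\<theta> s * G b (z + s *\<^sub>R e))
      * ((indicator {..<\<gamma> (z - h n *\<^sub>R b)} s - indicator {..<\<gamma> z} s) / h n)) \<partial>lborel)"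
      unfolding J_def H_def ind by (simp add: sum_distrib_left mult.assoc)
    also have "\<dots> = (\<Sum>b\<in>Basis. \<integral>s. (\<theta> s * G b (z + s *\<^sub>R e))
      * ((indicator {..<\<gamma> (z - h n *\<^sub>R b)} s - indicator {..<\<gamma> z} s) / h n) \<partial>lborel)"
    proof (rule Bochner_Integration.integral_sum)
      fix b :: 'a assume b: "b \<in> Basis"
      show "integrable lborel (\<lambda>s. (\<theta> s * G b (z + s *\<^sub>R e))
        * ((indicator {..<\<gamma> (z - h n *\<^sub>R b)} s - indicator {..<\<gamma> z} s) / h n))"
        using integrable_divide[OF step_difference_integral_bound(1)[OF Gc[OF b], where c = 0 and \<epsilon> = "M b"]]
          \<theta>G[OF b] by simp
    qed
    finally show ?thesis .
  qed
  \<comment> \<open>Measured along \<open>e\<close>, the layer has thickness at most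
    \<open>L * norm b * h n\<close>, which cancels the division by \<open>h n\<close>.\<close>
  have Jb: "\<bar>J n z\<bar> \<le> (\<Sum>b\<in>Basis. M b * (L * norm b))" for n z
  proof -
    have "\<bar>\<integral>s. (\<theta> s * G b (z + s *\<^sub>R e))
      * ((indicator {..<\<gamma> (z - h n *\<^sub>R b)} s - indicator {..<\<gamma> z} s) / h n) \<partial>lborel\<bar> \<le> M b * (L * norm b)"
      if b: "b \<in> Basis" for b
    proof -
      have "\<bar>(\<integral>s. (\<theta> s * G b (z + s *\<^sub>R e))
          * (indicator {..<\<gamma> (z - h n *\<^sub>R b)} s - indicator {..<\<gamma> z} s) \<partial>lborel) - 0 * (\<gamma> (z - h n *\<^sub>R b) - \<gamma> z)\<bar>
          \<le> M b * \<bar>\<gamma> (z - h n *\<^sub>R b) - \<gamma> z\<bar>"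
        by (rule step_difference_integral_bound(2)[OF Gc[OF b]]) (use \<theta>G[OF b] in simp)
      also have "\<dots> \<le> M b * ((L * norm b) * h n)"
        using lipschitz_onD[OF lip, of "z - h n *\<^sub>R b" z] h(1)[of n] M(1)[OF b]
        by (intro mult_left_mono) (auto simp: dist_norm mult_ac)
      finally show ?thesis using h(1)[of n] by (simp add: abs_divide pos_divide_le_eq mult_ac)
    qed
    then show ?thesis unfolding Jeq by (intro order_trans[OF sum_abs] sum_mono)
  qed
  have Js: "J n z = 0" if "norm z > R + norm e" for n z
  proof -
    have *: "\<theta> s * H n (z + s *\<^sub>R e) = 0" for s
    proof (cases "\<bar>s\<bar> > 1")
      case False
      have "norm (s *\<^sub>R e) \<le> norm e" using False by (simp add: mult_left_le_one_le)
      then have "norm (z + s *\<^sub>R e) > R"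
        using norm_triangle_ineq4[of "z + s *\<^sub>R e" "s *\<^sub>R e"] that by simp
      then show ?thesis by (simp add: Hs)
    qed (simp add: \<theta>b)
    show ?thesis unfolding J_def * by simp
  qed
  have "(\<lambda>n. \<integral>z. J n z \<partial>lborel) \<longlonglongrightarrow> integral\<^sup>L lborel (\<lambda>z::'a. 0)"
  proof (rule integral_dominated_convergence
      [where w = "\<lambda>z. indicator (cball 0 (R + norm e)) z * (\<Sum>b\<in>Basis. M b * (L * norm b))"])
    show "integrable lborel (\<lambda>z::'a. indicator (cball 0 (R + norm e)) z * (\<Sum>b\<in>Basis. M b * (L * norm b)))"
      by (intro integrable_mult_left integrable_real_indicator emeasure_bounded_finite bounded_cball) simp
    fix n
    show "AE z in lborel. norm (J n z) \<le> indicator (cball 0 (R + norm e)) z * (\<Sum>b\<in>Basis. M b * (L * norm b))"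
      using Jb Js by (intro AE_I2) (auto simp: indicator_def not_le)
  next
    show "AE z in lborel. (\<lambda>n. J n z) \<longlonglongrightarrow> 0"
      using \<gamma>.rademacher
    proof eventually_elim
      case (elim z)
      define D where "D = (\<lambda>v. \<Sum>b\<in>Basis. (v \<bullet> b) * ddir \<gamma> b z)"
      have D: "(\<gamma> has_derivative D) (at z)" using elim by (simp add: D_def)
      \<comment> \<open>This is the point where the line through \<open>z\<close> in direction
        \<open>e\<close> meets the graph; \<open>\<gamma>\<close> has the same derivative there as
        at \<open>z\<close>.\<close>
      define y where "y = z + \<gamma> z *\<^sub>R e"
      have y: "\<gamma> y = 0" by (simp add: y_def shift)
      have Dy: "(\<gamma> has_derivative D) (at y)"
      proof -
        have eq: "\<gamma> (w - \<gamma> z *\<^sub>R e) - \<gamma> z = \<gamma> w" for w using shift[of "w - \<gamma> z *\<^sub>R e" "\<gamma> z"] by simp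
        have "((\<lambda>w. \<gamma> (w - \<gamma> z *\<^sub>R e) - \<gamma> z) has_derivative D) (at y)"
        proof -
          have "((\<lambda>w. w - \<gamma> z *\<^sub>R e) has_derivative (\<lambda>w. w)) (at y)"
            by (auto intro!: derivative_eq_intros)
          moreover have "(\<gamma> has_derivative D) (at (y - \<gamma> z *\<^sub>R e))" using D by (simp add: y_def)
          ultimately have "((\<lambda>w. \<gamma> (w - \<gamma> z *\<^sub>R e)) has_derivative D) (at y)"
            by (rule has_derivative_compose)
          from has_derivative_diff[OF this has_derivative_const[of "\<gamma> z"]] show ?thesis by simp
        qed
        then show ?thesis by (simp only: eq)
      qed
      \<comment> \<open>The translated domain samples \<open>\<gamma>\<close> at
        \<open>z - h n *\<^sub>R b\<close>, hence the derivative in direction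
        \<open>- b\<close>.\<close>
      have "(\<lambda>n. J n z) \<longlonglongrightarrow> (\<Sum>b\<in>Basis. (\<theta> (\<gamma> z) * G b (z + \<gamma> z *\<^sub>R e)) * D (- b))"
        unfolding Jeq
      proof (rule tendsto_sum)
        fix b :: 'a assume b: "b \<in> Basis"
        have "(\<lambda>n. dq \<gamma> (- b) (h n) z) \<longlonglongrightarrow> D (- b)"
          unfolding h_def by (rule filterlim_compose[OF has_derivative_dq[OF D] filterlim_inverse_Suc])
        then have "(\<lambda>n. (\<gamma> (z - h n *\<^sub>R b) - \<gamma> z) / h n) \<longlonglongrightarrow> D (- b)" by (simp add: dq_def)
        from step_difference_quotient_limit[OF Gc[OF b] this h(2) h(1)]
        show "(\<lambda>n. \<integral>s. (\<theta> s * G b (z + s *\<^sub>R e))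
          * ((indicator {..<\<gamma> (z - h n *\<^sub>R b)} s - indicator {..<\<gamma> z} s) / h n) \<partial>lborel)
          \<longlonglongrightarrow> (\<theta> (\<gamma> z) * G b (z + \<gamma> z *\<^sub>R e)) * D (- b)" .
      qed
      moreover have "(\<Sum>b\<in>Basis. (\<theta> (\<gamma> z) * G b (z + \<gamma> z *\<^sub>R e)) * D (- b))
          = - \<theta> (\<gamma> z) * (\<Sum>b\<in>Basis. G b y * D b)"
        using linear_neg[OF has_derivative_linear[OF D]]
        by (simp add: y_def sum_distrib_left sum_negf mult_ac)
      ultimately show ?case using tangential[OF y Dy] by simp
    qed
  qed measurable
  then have "(\<lambda>n. (\<integral>z. J n z \<partial>lborel) / c) \<longlonglongrightarrow> 0 / c" by (intro tendsto_divide) (use c in auto)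
  then have "(\<lambda>n. \<integral>z. H n z \<partial>lborel) \<longlonglongrightarrow> 0" using c by (simp add: fub)
  with lim1 show ?thesis unfolding S_def[symmetric] by (rule LIMSEQ_unique)
qed

section \<open>The divergence theorem on Lipschitz domains\<close>

lemma C1_onD:
  assumes "C1_on W f g"
  shows C1_on_open: "open W"
    and C1_on_derivative: "z \<in> W \<Longrightarrow> (f has_derivative (\<lambda>h. g z \<bullet> h)) (at z)"
    and C1_on_gradient_continuous: "continuous_on W g"
proof -
  note * = assms[unfolded C1_on_def]
  show "open W" by (rule *[THEN conjunct1])
  show "(f has_derivative (\<lambda>h. g z \<bullet> h)) (at z)" if "z \<in> W"
    by (rule *[THEN conjunct2, THEN conjunct1, THEN bspec, OF that])
  show "continuous_on W g" by (rule *[THEN conjunct2, THEN conjunct2])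
qed

lemma C1_on_cong_open_zero:
  assumes C: "C1_on W f g" and Z: "open Z" "\<forall>z\<in>W \<inter> Z. f z = 0" and z: "z \<in> W" "z \<in> Z"
  shows "g z = 0"
proof -
  have "((\<lambda>z. 0) has_derivative (\<lambda>h. g z \<bullet> h)) (at z)"
  proof (rule has_derivative_transform_within_open)
    show "(f has_derivative (\<lambda>h. g z \<bullet> h)) (at z)" using C z by (auto simp: C1_on_def)
    show "open (W \<inter> Z)" by (rule open_Int[OF C1_on_open[OF C] Z(1)])
    show "z \<in> W \<inter> Z" using z by (rule IntI)
    show "f y = 0" if "y \<in> W \<inter> Z" for y using bspec[OF Z(2) that] .
  qed
  from C1_on_gradient_unique[OF this, of 0] show ?thesis by simp
qed

lemma C1_on_mult:
  assumes "C1_on W f g" "C1_on W f' g'"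
  shows "C1_on W (\<lambda>z. f z * f' z) (\<lambda>z. f z *\<^sub>R g' z + f' z *\<^sub>R g z)"
  unfolding C1_on_def
proof (intro conjI ballI)
  show "open W" by (rule C1_on_open[OF assms(1)])
  show "continuous_on W (\<lambda>z. f z *\<^sub>R g' z + f' z *\<^sub>R g z)"
    by (intro continuous_intros C1_on_continuous[OF assms(1)] C1_on_continuous[OF assms(2)]
        C1_on_gradient_continuous[OF assms(1)] C1_on_gradient_continuous[OF assms(2)])
  fix z assume "z \<in> W"
  then have "(f has_derivative (\<lambda>h. g z \<bullet> h)) (at z)" "(f' has_derivative (\<lambda>h. g' z \<bullet> h)) (at z)"
    using C1_on_derivative assms by blast+
  from has_derivative_mult[OF this]
  show "((\<lambda>z. f z * f' z) has_derivative (\<lambda>h. (f z *\<^sub>R g' z + f' z *\<^sub>R g z) \<bullet> h)) (at z)"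
    by (simp add: inner_add_left mult_ac add_ac)
qed

lemma C1_on_const_diff:
  assumes "C1_on W f g"
  shows "C1_on W (\<lambda>z. c - f z) (\<lambda>z. - g z)"
  unfolding C1_on_def
proof (intro conjI ballI)
  show "open W" by (rule C1_on_open[OF assms])
  show "continuous_on W (\<lambda>z. - g z)"
    by (intro continuous_intros C1_on_gradient_continuous[OF assms])
  fix z assume "z \<in> W"
  then have "(f has_derivative (\<lambda>h. g z \<bullet> h)) (at z)"
    by (rule C1_on_derivative[OF assms])
  from has_derivative_diff[OF has_derivative_const[of c] this]
  show "((\<lambda>z. c - f z) has_derivative (\<lambda>h. (- g z) \<bullet> h)) (at z)" by simp
qed

lemma C1_on_subset:
  assumes "C1_on W f g" "open V" "V \<subseteq> W"
  shows "C1_on V f g"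
  unfolding C1_on_def
  by (intro conjI ballI assms(2) C1_on_derivative[OF assms(1)] subsetD[OF assms(3)]
      continuous_on_subset[OF C1_on_gradient_continuous[OF assms(1)] assms(3)])

text \<open>On \<open>W \<inter> Z\<close> the gradient vanishes together with \<open>f\<close>, so
  the gradient of \<open>f\<close> on \<open>W\<close> and the zero gradient on \<open>Z\<close> fit
  together to a continuous function on the open cover.\<close>

lemma C1_on_extend_zero:
  assumes C: "C1_on W f g" and Z: "open Z" "\<forall>z\<in>W \<inter> Z. f z = 0" and cov: "W \<union> Z = UNIV"
  shows "C1_on UNIV (\<lambda>z. if z \<in> W then f z else 0) (\<lambda>z. if z \<in> W then g z else 0)"
  unfolding C1_on_def
proof (intro conjI ballI open_UNIV)
  let ?f = "\<lambda>z. if z \<in> W then f z else 0" and ?g = "\<lambda>z. if z \<in> W then g z else 0"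
  have W: "open W" by (rule C1_on_open[OF C])
  note g0 = C1_on_cong_open_zero[OF C Z]
  have 1: "continuous_on W ?g" by (rule continuous_on_eq[OF C1_on_gradient_continuous[OF C]]) simp
  have 2: "continuous_on Z ?g"
  proof (rule continuous_on_eq)
    show "continuous_on Z (\<lambda>_. 0 :: 'a)" by (rule continuous_on_const)
    show "0 = ?g z" if "z \<in> Z" for z using g0[of z] that by simp
  qed
  from continuous_on_open_Un[OF W Z(1) 1 2] show "continuous_on UNIV ?g" by (simp add: cov)
  fix z
  show "(?f has_derivative (\<lambda>h. ?g z \<bullet> h)) (at z)"
  proof (cases "z \<in> W")
    case True
    have "(f has_derivative (\<lambda>h. ?g z \<bullet> h)) (at z)"
      using C1_on_derivative[OF C True] by (simp only: True if_True)
    then show ?thesis by (rule has_derivative_transform_within_open[OF _ W True]) auto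
  next
    case False
    then have z: "z \<in> Z" using cov by auto
    have "((\<lambda>_. 0) has_derivative (\<lambda>h. ?g z \<bullet> h)) (at z)"
      by (simp only: False if_False inner_zero_left has_derivative_const)
    then show ?thesis
      by (rule has_derivative_transform_within_open[OF _ Z(1) z]) (use Z(2) in auto)
  qed
qed

section \<open>Cutoff functions built from squared positive parts\<close>

lemma has_field_derivative_pos_square:
  "((\<lambda>u::real. (max 0 u)\<^sup>2) has_field_derivative 2 * max 0 u) (at u)"
proof -
  consider "u > 0" | "u < 0" | "u = 0" by linarith
  then show ?thesis
  proof cases
    case 1
    have "((\<lambda>u::real. u\<^sup>2) has_field_derivative 2 * max 0 u) (at u)"
      by (rule derivative_eq_intros refl)+ (use 1 in simp)
    then show ?thesis
      by (rule has_field_derivative_transform_within_open[OF _ open_greaterThan[of 0]]) (use 1 in auto)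
  next
    case 2
    have "((\<lambda>u::real. 0) has_field_derivative 2 * max 0 u) (at u)" using 2 by simp
    then show ?thesis
      by (rule has_field_derivative_transform_within_open[OF _ open_lessThan[of 0]]) (use 2 in auto)
  next
    case 3
    have "((\<lambda>h::real. (max 0 h)\<^sup>2 / h) \<longlongrightarrow> 0) (at 0)"
    proof (rule Lim_null_comparison)
      show "\<forall>\<^sub>F h in at (0::real). norm ((max 0 h)\<^sup>2 / h) \<le> \<bar>h\<bar>"
        by (intro always_eventually allI) (auto simp: max_def power2_eq_square)
      show "((\<lambda>h::real. \<bar>h\<bar>) \<longlongrightarrow> 0) (at 0)" by (intro tendsto_rabs_zero tendsto_ident_at)
    qed
    then show ?thesis using 3 by (simp add: DERIV_def)
  qed
qed

text \<open>With \<open>m\<close> the squared positive part, \<open>1 - m (1 - m (s z))\<close> is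
  C1, equals 1 where \<open>s z \<ge> 1\<close> and 0 where \<open>s z \<le> 0\<close>: the inner
  \<open>m\<close> flattens the bottom, the outer one the top. One continuous derivative is all the
  product rule below asks for.\<close>

lemma bump_exists:
  fixes c :: "'a::euclidean_space"
  assumes r: "r > 0"
  obtains \<psi> d where "C1_on UNIV \<psi> d" "\<And>z. z \<in> cball c (r / 2) \<Longrightarrow> \<psi> z = 1"
    "\<And>z. z \<notin> cball c (3 * r / 4) \<Longrightarrow> \<psi> z = 0"
proof -
  define m :: "real \<Rightarrow> real" where "m u = (max 0 u)\<^sup>2" for u
  \<comment> \<open>This normalises \<open>s\<close> to be 0 on the sphere of radius 3r/4 and 1 on
    the sphere of radius r/2.\<close>
  define k where "k = (3 * r / 4)\<^sup>2 - (r / 2)\<^sup>2"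
  have k: "k > 0" using r by (simp add: k_def power2_eq_square)
  define s where "s z = ((3 * r / 4)\<^sup>2 - (z - c) \<bullet> (z - c)) / k" for z
  define \<psi> where "\<psi> z = 1 - m (1 - m (s z))" for z
  define d where "d z = ((2 * max 0 (1 - m (s z))) * (2 * max 0 (s z)) * (- 2 / k)) *\<^sub>R (z - c)" for z
  have m: "(m has_field_derivative 2 * max 0 u) (at u)" for u
    unfolding m_def[abs_def] by (rule has_field_derivative_pos_square)
  have ms: "(m has_derivative (*) (2 * max 0 u)) (at u)" for u
    using m by (simp add: has_field_derivative_def)
  have sd: "(s has_derivative (\<lambda>h. (- 2 / k) * ((z - c) \<bullet> h))) (at z)" for z
    unfolding s_def[abs_def] divide_inverse
    by (rule derivative_eq_intros refl)+ (auto simp: algebra_simps inner_commute divide_inverse)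
  have \<psi>d: "(\<psi> has_derivative (\<lambda>h. d z \<bullet> h)) (at z)" for z
  proof -
    from has_derivative_compose[OF sd ms]
    have 1: "((\<lambda>z. m (s z)) has_derivative (\<lambda>h. 2 * max 0 (s z) * ((- 2 / k) * ((z - c) \<bullet> h)))) (at z)" .
    from has_derivative_diff[OF has_derivative_const[of 1] 1]
    have 2: "((\<lambda>z. 1 - m (s z)) has_derivative (\<lambda>h. 0 - 2 * max 0 (s z) * ((- 2 / k) * ((z - c) \<bullet> h)))) (at z)" .
    from has_derivative_diff[OF has_derivative_const[of 1] has_derivative_compose[OF 2 ms]]
    show ?thesis unfolding \<psi>_def[abs_def] d_def by (simp add: mult_ac)
  qed
  have mc: "continuous_on UNIV m" unfolding m_def[abs_def] by (intro continuous_intros)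
  have sc: "continuous_on UNIV s"
    unfolding s_def[abs_def] using k by (intro continuous_intros) auto
  have "continuous_on UNIV d" unfolding d_def[abs_def]
    by (intro continuous_intros sc continuous_on_compose2[OF mc sc]) auto
  then have C1: "C1_on UNIV \<psi> d" using \<psi>d by (simp add: C1_on_def)
  have one: "\<psi> z = 1" if "z \<in> cball c (r / 2)" for z
  proof -
    have "norm (z - c) \<le> r / 2" using that by (simp add: dist_norm norm_minus_commute)
    then have "(z - c) \<bullet> (z - c) \<le> (r / 2)\<^sup>2"
      by (simp add: power2_norm_eq_inner[symmetric] power_mono)
    then have "s z \<ge> 1" using k by (simp add: s_def le_divide_eq k_def)
    then have "m (s z) \<ge> 1" by (simp add: m_def)
    then have "m (1 - m (s z)) = 0" by (simp add: m_def[of "1 - m (s z)"])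
    then show ?thesis by (simp add: \<psi>_def)
  qed
  have zero: "\<psi> z = 0" if "z \<notin> cball c (3 * r / 4)" for z
  proof -
    have "norm (z - c) > 3 * r / 4" using that by (simp add: dist_norm norm_minus_commute not_le)
    then have "(z - c) \<bullet> (z - c) \<ge> (3 * r / 4)\<^sup>2"
      using r by (simp only: power2_norm_eq_inner[symmetric]) (intro power_mono; simp)
    then have "s z \<le> 0" using k by (simp add: s_def divide_le_0_iff)
    then have "m (s z) = 0" by (simp add: m_def)
    then show ?thesis by (simp add: \<psi>_def m_def)
  qed
  show ?thesis by (rule that[OF C1 one zero])
qed

section \<open>Boundary charts and outward normals\<close>

definition graph_chart :: "'a::euclidean_space set \<Rightarrow> 'a \<Rightarrow> real \<Rightarrow> bool" where
  "graph_chart \<Omega> x r \<longleftrightarrow> r > 0 \<and> (\<exists>\<gamma> e L. L-lipschitz_on UNIV \<gamma> \<and> (\<forall>z s. \<gamma> (z + s *\<^sub>R e) = \<gamma> z - s) \<and>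
     (\<forall>z\<in>ball x r. z \<in> \<Omega> \<longleftrightarrow> 0 < \<gamma> z))"

text \<open>The rigid motion is absorbed into \<open>\<gamma>\<close>, the height of the graph minus
  the height of the point, and into the direction \<open>e\<close> mapped by \<open>Q\<close> to the
  vertical axis. Since \<open>g\<close> ignores the vertical coordinate, moving along
  \<open>e\<close> changes only the subtracted height.\<close>

lemma lipschitz_domain_graph_chart:
  fixes \<Omega> :: "(real^'n::finite) set"
  assumes dom: "lipschitz_domain \<Omega>" and x: "x \<in> frontier \<Omega>"
  shows "\<exists>r. graph_chart \<Omega> x r"
proof -
  obtain Q :: "real^'n \<Rightarrow> real^'n" and k :: 'n and g :: "real^'n \<Rightarrow> real" and L r :: real where
    Q: "orthogonal_transformation Q" and r: "r > 0"
    and gL: "\<And>z w. \<bar>g z - g w\<bar> \<le> L * norm (z - w)"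
    and gk: "\<And>z. g z = g (z - (z $ k) *\<^sub>R axis k 1)"
    and ch: "\<And>z. z \<in> ball x r \<Longrightarrow> z \<in> \<Omega> \<longleftrightarrow> Q (z - x) $ k < g (Q (z - x))"
    using dom x unfolding lipschitz_domain_def by metis
  have lin: "linear Q" using Q by (rule orthogonal_transformation_linear)
  obtain e where e: "axis k 1 = Q e" using orthogonal_transformation_surj[OF Q] by (meson surjD)
  define \<gamma> where "\<gamma> z = g (Q (z - x)) - Q (z - x) $ k" for z
  \<comment> \<open>The definition puts no sign on \<open>L\<close>, hence the absolute value; the
    additional 1 bounds the coordinate function.\<close>
  have "\<bar>\<gamma> z - \<gamma> w\<bar> \<le> (\<bar>L\<bar> + 1) * norm (z - w)" for z w
  proof -
    have n: "norm (Q (z - x) - Q (w - x)) = norm (z - w)"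
      using orthogonal_transformation_norm[OF Q, of "z - w"]
      by (simp add: linear_diff[OF lin, symmetric])
    have "\<bar>Q (z - x) $ k - Q (w - x) $ k\<bar> \<le> norm (z - w)"
      using component_le_norm_cart[of "Q (z - x) - Q (w - x)" k] n by simp
    moreover have "\<bar>g (Q (z - x)) - g (Q (w - x))\<bar> \<le> \<bar>L\<bar> * norm (z - w)"
      using gL[of "Q (z - x)" "Q (w - x)"] unfolding n
      by (rule order_trans) (intro mult_right_mono; simp)
    ultimately show ?thesis by (simp add: \<gamma>_def algebra_simps)
  qed
  then have lip: "(\<bar>L\<bar> + 1)-lipschitz_on UNIV \<gamma>" by (auto simp: lipschitz_on_def dist_norm)
  have "\<gamma> (z + s *\<^sub>R e) = \<gamma> z - s" for z s
  proof -
    define w where "w = Q (z - x)"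
    have "Q (z + s *\<^sub>R e - x) = Q ((z - x) + s *\<^sub>R e)" by (simp add: algebra_simps)
    also have "\<dots> = w + s *\<^sub>R axis k 1"
      by (simp only: linear_add[OF lin] linear_scale[OF lin] e w_def)
    finally have 1: "Q (z + s *\<^sub>R e - x) = w + s *\<^sub>R axis k 1" .
    have "g (w + s *\<^sub>R axis k 1) = g w"
      using gk[of "w + s *\<^sub>R axis k 1"] gk[of w] by (simp add: axis_def algebra_simps)
    then show ?thesis unfolding \<gamma>_def 1 by (simp add: w_def axis_def)
  qed
  moreover have "\<forall>z\<in>ball x r. z \<in> \<Omega> \<longleftrightarrow> 0 < \<gamma> z" using ch by (simp add: \<gamma>_def)
  ultimately show ?thesis using r lip unfolding graph_chart_def by blast
qed

text \<open>The domain is where \<open>\<gamma>\<close> is positive, so the gradient points inward;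
  hence the minus sign. In the two cones of the definition the linear term has size at least
  \<open>\<epsilon> * norm m * norm (z - y)\<close> and the remainder at most half of that, so the
  linear term decides the sign of \<open>\<gamma> z\<close>.\<close>

lemma outward_normal_of_gradient:
  fixes \<Omega> :: "(real^'n::finite) set"
  assumes d: "d > 0" "\<And>z. z \<in> ball y d \<Longrightarrow> z \<in> \<Omega> \<longleftrightarrow> 0 < \<gamma> z"
    and y: "y \<in> frontier \<Omega>" "\<gamma> y = 0"
    and D: "(\<gamma> has_derivative (\<lambda>h. m \<bullet> h)) (at y)" and m: "m \<noteq> 0"
  shows "outward_normal \<Omega> y (- (1 / norm m) *\<^sub>R m)"
  unfolding outward_normal_def
proof (intro conjI allI impI)
  show "y \<in> frontier \<Omega>" by (rule y)
  show "norm (- (1 / norm m) *\<^sub>R m) = 1" using m by simp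
  fix \<epsilon> :: real assume \<epsilon>: "\<epsilon> > 0"
  have "\<epsilon> * norm m / 2 > 0" using \<epsilon> m by simp
  then obtain \<delta> where \<delta>: "\<delta> > 0" "\<And>z. norm (z - y) < \<delta> \<Longrightarrow>
      norm (\<gamma> z - \<gamma> y - m \<bullet> (z - y)) \<le> \<epsilon> * norm m / 2 * norm (z - y)"
    using D unfolding has_derivative_at_alt by blast
  show "\<exists>\<delta>>0. \<forall>z\<in>ball y \<delta>. z \<noteq> y \<longrightarrow>
        ((z - y) \<bullet> (- (1 / norm m) *\<^sub>R m) \<le> - \<epsilon> * norm (z - y) \<longrightarrow> z \<in> \<Omega>) \<and>
        ((z - y) \<bullet> (- (1 / norm m) *\<^sub>R m) \<ge> \<epsilon> * norm (z - y) \<longrightarrow> z \<notin> \<Omega>)"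
  proof (intro exI[of _ "min \<delta> d"] conjI ballI impI)
    show "min \<delta> d > 0" using \<delta> d by simp
    fix z assume z: "z \<in> ball y (min \<delta> d)" "z \<noteq> y"
    have nz: "norm (z - y) > 0" using z by simp
    have "norm (z - y) < \<delta>" using z(1) by (simp add: dist_norm norm_minus_commute)
    obtain q where q: "q = \<epsilon> * norm m * norm (z - y)" by simp
    from \<delta>(2)[OF \<open>norm (z - y) < \<delta>\<close>] have b: "\<bar>\<gamma> z - m \<bullet> (z - y)\<bar> \<le> q / 2"
      by (simp add: y q)
    have p: "q > 0" using \<epsilon> m nz by (simp add: q)
    have in_iff: "z \<in> \<Omega> \<longleftrightarrow> 0 < \<gamma> z" using z(1) d(2) by auto
    {
      assume "(z - y) \<bullet> (- (1 / norm m) *\<^sub>R m) \<le> - \<epsilon> * norm (z - y)"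
      then have "m \<bullet> (z - y) \<ge> \<epsilon> * norm m * norm (z - y)"
        using m by (simp add: inner_commute field_simps)
      then show "z \<in> \<Omega>" unfolding in_iff using b p unfolding q[symmetric] by linarith
    next
      assume "(z - y) \<bullet> (- (1 / norm m) *\<^sub>R m) \<ge> \<epsilon> * norm (z - y)"
      then have "- (m \<bullet> (z - y)) \<ge> \<epsilon> * norm m * norm (z - y)"
        using m by (simp add: inner_commute field_simps)
      then show "z \<notin> \<Omega>" unfolding in_iff using b p unfolding q[symmetric] by linarith
    }
  qed
qed

text \<open>The fields live in the chart ball, where \<open>\<Omega>\<close> is
  \<open>{z. 0 < \<gamma> z}\<close>. What remains is to turn tangency with respect to
  \<open>outward_normal\<close> into tangency with respect to derivatives of
  \<open>\<gamma>\<close>, by exhibiting a normal at each point of differentiability on the graph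
  inside the ball.\<close>

lemma divergence_local:
  fixes \<Omega> :: "(real^'n::finite) set"
  assumes chart: "graph_chart \<Omega> x r" and r': "r' < r"
    and C1: "\<And>b. b \<in> Basis \<Longrightarrow> C1_on UNIV (F b) (g b)"
    and supp: "\<And>b z. b \<in> Basis \<Longrightarrow> z \<notin> cball x r' \<Longrightarrow> F b z = 0"
    and tang: "\<And>y n. outward_normal \<Omega> y n \<Longrightarrow> (\<Sum>b\<in>Basis. F b y * (n \<bullet> b)) = 0"
  shows "(\<integral>z. indicator \<Omega> z * (\<Sum>b\<in>Basis. g b z \<bullet> b) \<partial>lborel) = 0"
proof -
  obtain \<gamma> e L where lip: "L-lipschitz_on UNIV \<gamma>"
    and shift: "\<And>z s. \<gamma> (z + s *\<^sub>R e) = \<gamma> z - s"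
    and ch: "\<And>z. z \<in> ball x r \<Longrightarrow> z \<in> \<Omega> \<longleftrightarrow> 0 < \<gamma> z" and r: "r > 0"
    using chart unfolding graph_chart_def by blast
  have cpt: "C1_compact (F b) (g b) (norm x + r')" if "b \<in> Basis" for b
  proof
    show "C1_on UNIV (F b) (g b)" by (rule C1[OF that])
    fix z :: "real^'n" assume "norm z > norm x + r'"
    then have "z \<notin> cball x r'"
      using norm_triangle_ineq2[of z x] by (auto simp: dist_norm norm_minus_commute)
    then show "F b z = 0" by (rule supp[OF that])
  qed
  have g0: "g b z = 0" if b: "b \<in> Basis" and z: "z \<notin> cball x r'" for b z
    by (rule C1_on_cong_open_zero[OF C1[OF b], of "- cball x r'"]) (use z supp[OF b] in auto)
  have "(\<integral>z. indicator {z. 0 < \<gamma> z} z * (\<Sum>b\<in>Basis. g b z \<bullet> b) \<partial>lborel) = 0"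
  proof (rule divergence_below_graph[OF lip shift cpt])
    fix y D assume y: "\<gamma> y = 0" and D: "(\<gamma> has_derivative D) (at y)"
    show "(\<Sum>b\<in>Basis. F b y * D b) = 0"
    proof (cases "y \<in> cball x r'")
      case False
      then show ?thesis by (simp add: supp)
    next
      case True
      then have yb: "y \<in> ball x r" using r' by auto
      define m where "m = (\<Sum>b\<in>Basis. D b *\<^sub>R b)"
      have lin: "linear D" using D by (rule has_derivative_linear)
      have Dm: "D h = m \<bullet> h" for h
      proof -
        have "D h = D (\<Sum>b\<in>Basis. (h \<bullet> b) *\<^sub>R b)" by (simp add: euclidean_representation)
        also have "\<dots> = (\<Sum>b\<in>Basis. (h \<bullet> b) * D b)"
          by (simp add: linear_sum[OF lin] linear_scale[OF lin])
        finally show ?thesis by (simp add: m_def inner_sum_left inner_sum_right inner_commute mult.commute)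
      qed
      \<comment> \<open>The difference quotient along \<open>e\<close> is constantly -1; this rules
        out a vanishing gradient.\<close>
      have De: "D e = - 1"
      proof (rule tendsto_unique[OF _ has_derivative_dq[OF D]])
        have "\<forall>\<^sub>F h in at 0. dq \<gamma> e h y = - 1"
          by (auto simp: eventually_at_filter dq_def shift)
        then show "((\<lambda>h. dq \<gamma> e h y) \<longlongrightarrow> - 1) (at 0)" by (rule tendsto_eventually)
      qed simp
      then have m: "m \<noteq> 0" using Dm by auto
      obtain d where d: "d > 0" "ball y d \<subseteq> ball x r" using openE[OF open_ball yb] by blast
      \<comment> \<open>The points \<open>y - t *\<^sub>R e\<close> with small \<open>t > 0\<close>
        have \<open>\<gamma>\<close>-value \<open>t\<close>, so they are in the domain.\<close>
      have "y \<in> closure \<Omega>" unfolding closure_approachable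
      proof (intro allI impI)
        fix \<epsilon> :: real assume \<epsilon>: "\<epsilon> > 0"
        define t where "t = min \<epsilon> d / (2 * (norm e + 1))"
        have ne: "norm e + 1 > 0" using norm_ge_zero[of e] by linarith
        have t: "t > 0" using \<epsilon> d ne by (simp add: t_def)
        have "norm (t *\<^sub>R e) \<le> t * (norm e + 1)" using t by (simp add: mult_left_mono)
        also have "\<dots> = min \<epsilon> d / 2"
        proof -
          obtain q where q: "q = norm e + 1" by simp
          show ?thesis using ne unfolding t_def q[symmetric] by simp
        qed
        also have "\<dots> < min \<epsilon> d" using \<epsilon> d(1) by (simp add: min_def)
        finally have n: "norm (t *\<^sub>R e) < min \<epsilon> d" .
        have "y + (- t) *\<^sub>R e \<in> ball y d" using n by (simp add: dist_norm)
        then have "y + (- t) *\<^sub>R e \<in> \<Omega>" 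
          using ch[OF subsetD[OF d(2)], of "y + (- t) *\<^sub>R e"] shift[of y "- t"] y t by simp
        moreover have "dist (y + (- t) *\<^sub>R e) y < \<epsilon>" using n by (simp add: dist_norm)
        ultimately show "\<exists>z\<in>\<Omega>. dist z y < \<epsilon>" by blast
      qed
      moreover have "y \<notin> \<Omega>" using ch[OF yb] y by simp
      ultimately have fr: "y \<in> frontier \<Omega>" using interior_subset by (auto simp: frontier_def)
      have "outward_normal \<Omega> y (- (1 / norm m) *\<^sub>R m)"
      proof (rule outward_normal_of_gradient[where \<gamma> = \<gamma>, OF d(1) _ fr _ _ m])
        show "\<gamma> y = 0" by (rule y)
        show "z \<in> \<Omega> \<longleftrightarrow> 0 < \<gamma> z" if "z \<in> ball y d" for z
          by (rule ch[OF subsetD[OF d(2) that]])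
        have "D = (\<lambda>h. m \<bullet> h)" using Dm by (rule ext)
        then show "(\<gamma> has_derivative (\<lambda>h. m \<bullet> h)) (at y)" using D by (simp only:)
      qed
      from tang[OF this] have "(\<Sum>b\<in>Basis. - (1 / norm m) * (F b y * D b)) = 0"
        by (simp add: Dm mult_ac)
      then show ?thesis using m by (simp only: sum_distrib_left[symmetric]) simp
    qed
  qed
  \<comment> \<open>The two sets agree inside the ball, and outside the support the gradients
    vanish.\<close>
  moreover have "indicator {z. 0 < \<gamma> z} z * (\<Sum>b\<in>Basis. g b z \<bullet> b)
      = indicator \<Omega> z * (\<Sum>b\<in>Basis. g b z \<bullet> b)" for z
  proof (cases "z \<in> cball x r'")
    case True
    then show ?thesis using ch[of z] r' by (auto simp: indicator_def)
  qed (simp add: g0)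
  ultimately show ?thesis by simp
qed

section \<open>From single charts to the whole domain\<close>

lemma integrable_continuous_compact:
  fixes f :: "'a::euclidean_space \<Rightarrow> real"
  assumes "compact K" "continuous_on K f" "\<Omega> \<subseteq> K" and [measurable]: "\<Omega> \<in> sets borel"
  shows "integrable lborel (\<lambda>z. indicator \<Omega> z * f z)"
proof -
  have "bounded (f ` K)" using assms by (intro compact_imp_bounded compact_continuous_image)
  then obtain M where M: "\<And>z. z \<in> K \<Longrightarrow> \<bar>f z\<bar> \<le> M" unfolding bounded_iff real_norm_def by blast
  obtain R where R: "\<And>z. z \<in> K \<Longrightarrow> norm z \<le> R"
    using compact_imp_bounded[OF assms(1)] unfolding bounded_iff by blast
  have "(\<lambda>z. indicator \<Omega> z *\<^sub>R f z) \<in> borel_measurable borel"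
    by (rule borel_measurable_continuous_on_indicator) (use assms continuous_on_subset in auto)
  then have m: "(\<lambda>z. indicator \<Omega> z * f z) \<in> borel_measurable borel" by simp
  show ?thesis
  proof (rule integrable_bounded_support[OF m, of "max 0 M" R])
    fix z
    show "\<bar>indicator \<Omega> z * f z\<bar> \<le> max 0 M" using M[of z] assms(3) by (auto simp: indicator_def)
    show "indicator \<Omega> z * f z = 0" if "norm z > R"
      using that R[of z] assms(3) by (auto simp: indicator_def not_le[symmetric])
  qed
qed

text \<open>For the full space the boundary layer is empty: both indicators are 1 and the integrand
  of the layer is 0.\<close>

lemma (in C1_compact) derivative_integral_zero: "(\<integral>z. g z \<bullet> b \<partial>lborel) = 0"
  using boundary_layer_limit[of UNIV b] by (simp add: LIMSEQ_const_iff)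

text \<open>Induction over finitely many charts replaces a partition of unity. A bump
  \<open>\<psi>\<close> at the next centre splits the field into \<open>\<psi> F\<close>, treated by
  \<open>divergence_local\<close>, and \<open>(1 - \<psi>) F\<close>, which vanishes on a further
  piece of the boundary; scalar factors preserve tangency. A field vanishing near the whole boundary
  is extended by zero to the full space, where the integral of its divergence is zero.\<close>

theorem divergence_theorem_tangential:
  fixes \<Omega> :: "(real^'n::finite) set"
  assumes dom: "lipschitz_domain \<Omega>" and W: "closure \<Omega> \<subseteq> W"
    and C1: "\<And>b. b \<in> Basis \<Longrightarrow> C1_on W (F b) (g b)"
    and tang: "\<And>y n. outward_normal \<Omega> y n \<Longrightarrow> (\<Sum>b\<in>Basis. F b y * (n \<bullet> b)) = 0"
  shows "(\<integral>z. indicator \<Omega> z * (\<Sum>b\<in>Basis. g b z \<bullet> b) \<partial>lborel) = 0"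
proof -
  have \<Omega>: "open \<Omega>" "bounded \<Omega>" using dom by (auto simp: lipschitz_domain_def)
  have [measurable]: "\<Omega> \<in> sets borel" using \<Omega>(1) by auto
  have oW: "open W"
  proof -
    obtain b :: "real^'n" where "b \<in> Basis" using nonempty_Basis by blast
    from C1[OF this] show ?thesis by (simp add: C1_on_def)
  qed
  have frW: "frontier \<Omega> \<subseteq> W" using W by (auto simp: frontier_def)
  have \<Omega>W: "\<Omega> \<subseteq> W" using W closure_subset by blast
  have compact_cl: "compact (closure \<Omega>)" using \<Omega> by simp
  have int: "integrable lborel (\<lambda>z. indicator \<Omega> z * (\<Sum>b\<in>Basis. g b z \<bullet> b))"
    if "\<And>b. b \<in> Basis \<Longrightarrow> C1_on W (F b) (g b)" for F g :: "real^'n \<Rightarrow> real^'n \<Rightarrow> _"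
  proof (rule integrable_continuous_compact[OF compact_cl])
    show "continuous_on (closure \<Omega>) (\<lambda>z. \<Sum>b\<in>Basis. g b z \<bullet> b)"
      by (intro continuous_intros continuous_on_subset[OF C1_on_gradient_continuous[OF that] W])
  qed (use closure_subset in auto)
  \<comment> \<open>The field is general because each round replaces it; \<open>Z\<close> records an
    open set on which it already vanishes.\<close>
  have *: "(\<integral>z. indicator \<Omega> z * (\<Sum>b\<in>Basis. g b z \<bullet> b) \<partial>lborel) = 0"
    if "finite C" and "\<And>x. x \<in> C \<Longrightarrow> graph_chart \<Omega> x (\<rho> x) \<and> ball x (\<rho> x) \<subseteq> W"
      and "\<And>b. b \<in> Basis \<Longrightarrow> C1_on W (F b) (g b)"
      and "\<And>y n. outward_normal \<Omega> y n \<Longrightarrow> (\<Sum>b\<in>Basis. F b y * (n \<bullet> b)) = 0"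
      and "open Z" "frontier \<Omega> \<subseteq> Z \<union> (\<Union>x\<in>C. ball x (\<rho> x / 2))"
      and "\<And>b z. b \<in> Basis \<Longrightarrow> z \<in> W \<Longrightarrow> z \<in> Z \<Longrightarrow> F b z = 0"
    for C \<rho> and F :: "real^'n \<Rightarrow> real^'n \<Rightarrow> real" and g :: "real^'n \<Rightarrow> real^'n \<Rightarrow> real^'n" and Z
    using that
  proof (induction C arbitrary: F g Z rule: finite_induct)
    case empty
    \<comment> \<open>No charts are left, so the boundary lies in \<open>Z\<close>; together with
      \<open>\<Omega>\<close>, the sets \<open>Z\<close> and the exterior cover the space.\<close>
    obtain R where R: "\<And>z. z \<in> \<Omega> \<Longrightarrow> norm z \<le> R" using \<Omega>(2) unfolding bounded_iff by blast
    define Fe where "Fe b z = (if z \<in> \<Omega> then F b z else 0)" for b z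
    define ge where "ge b z = (if z \<in> \<Omega> then g b z else 0)" for b z
    have "C1_on UNIV (Fe b) (ge b)" if b: "b \<in> Basis" for b
      unfolding Fe_def[abs_def] ge_def[abs_def]
    proof (rule C1_on_extend_zero)
      show "C1_on \<Omega> (F b) (g b)" by (rule C1_on_subset[OF empty.prems(2)[OF b] \<Omega>(1) \<Omega>W])
      show "open (Z \<union> - closure \<Omega>)" using empty.prems(4) by auto
      show "\<forall>z\<in>\<Omega> \<inter> (Z \<union> - closure \<Omega>). F b z = 0"
        using empty.prems(6)[OF b] \<Omega>W closure_subset[of \<Omega>] by blast
      show "\<Omega> \<union> (Z \<union> - closure \<Omega>) = UNIV"
        using empty.prems(5) \<Omega>(1) by (auto simp: frontier_def interior_open)
    qed
    then have cpt: "C1_compact (Fe b) (ge b) R" if "b \<in> Basis" for b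
      using that by unfold_locales (use R in \<open>auto simp: Fe_def not_le[symmetric]\<close>)
    have "(\<integral>z. indicator \<Omega> z * (\<Sum>b\<in>Basis. g b z \<bullet> b) \<partial>lborel) = (\<integral>z. (\<Sum>b\<in>Basis. ge b z \<bullet> b) \<partial>lborel)"
      by (intro Bochner_Integration.integral_cong) (auto simp: ge_def indicator_def)
    also have "\<dots> = (\<Sum>b\<in>Basis. \<integral>z. ge b z \<bullet> b \<partial>lborel)"
    proof (rule Bochner_Integration.integral_sum)
      fix b :: "real^'n" assume b: "b \<in> Basis"
      have "integrable lborel (\<lambda>z. indicator \<Omega> z * (g b z \<bullet> b))"
        by (intro integrable_continuous_compact[OF compact_cl] continuous_intros closure_subset
            continuous_on_subset[OF C1_on_gradient_continuous[OF empty.prems(2)[OF b]] W]) simp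
      also have "(\<lambda>z. indicator \<Omega> z * (g b z \<bullet> b)) = (\<lambda>z. ge b z \<bullet> b)"
        by (auto simp: ge_def indicator_def)
      finally show "integrable lborel (\<lambda>z. ge b z \<bullet> b)" .
    qed
    also have "\<dots> = 0" using C1_compact.derivative_integral_zero[OF cpt] by simp
    finally show ?case .
  next
    case (insert x C)
    have ch: "graph_chart \<Omega> x (\<rho> x)" and bW: "ball x (\<rho> x) \<subseteq> W" using insert.prems(1)[of x] by auto
    have \<rho>: "\<rho> x > 0" using ch by (simp add: graph_chart_def)
    obtain \<psi> d where \<psi>: "C1_on UNIV \<psi> d" and one: "\<And>z. z \<in> cball x (\<rho> x / 2) \<Longrightarrow> \<psi> z = 1"
      and zero: "\<And>z. z \<notin> cball x (3 * \<rho> x / 4) \<Longrightarrow> \<psi> z = 0"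
      by (rule bump_exists[OF \<rho>, of x]) (rule that; assumption)
    have \<psi>W: "C1_on W \<psi> d" by (rule C1_on_subset[OF \<psi> oW]) simp
    \<comment> \<open>\<open>F\<close> is controlled only on \<open>W\<close>, whereas
      \<open>divergence_local\<close> takes fields on the full space; the support of
      \<open>\<psi>\<close> lies in \<open>W\<close>, so setting the product to zero elsewhere is
      smooth.\<close>
    let ?F1 = "\<lambda>b z. if z \<in> W then \<psi> z * F b z else 0"
    let ?g1 = "\<lambda>b z. if z \<in> W then \<psi> z *\<^sub>R g b z + F b z *\<^sub>R d z else 0"
    let ?F2 = "\<lambda>b z. (1 - \<psi> z) * F b z"
    let ?g2 = "\<lambda>b z. (1 - \<psi> z) *\<^sub>R g b z + F b z *\<^sub>R - d z"
    have C1F1: "C1_on UNIV (?F1 b) (?g1 b)" if b: "b \<in> Basis" for b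
    proof (rule C1_on_extend_zero[OF C1_on_mult[OF \<psi>W insert.prems(2)[OF b]]])
      show "open (- cball x (3 * \<rho> x / 4))" by auto
      show "W \<union> - cball x (3 * \<rho> x / 4) = UNIV" using bW \<rho> by (auto simp: subset_iff)
    qed (simp add: zero)
    have 1: "(\<integral>z. indicator \<Omega> z * (\<Sum>b\<in>Basis. ?g1 b z \<bullet> b) \<partial>lborel) = 0"
    proof (rule divergence_local[OF ch _ C1F1])
      show "3 * \<rho> x / 4 < \<rho> x" using \<rho> by simp
      show "?F1 b z = 0" if "z \<notin> cball x (3 * \<rho> x / 4)" for b z using zero[OF that] by simp
      fix y n assume n: "outward_normal \<Omega> y n"
      have "(\<Sum>b\<in>Basis. ?F1 b y * (n \<bullet> b)) = (if y \<in> W then \<psi> y else 0) * (\<Sum>b\<in>Basis. F b y * (n \<bullet> b))"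
        by (auto simp: sum_distrib_left mult.assoc)
      then show "(\<Sum>b\<in>Basis. ?F1 b y * (n \<bullet> b)) = 0" using insert.prems(3)[OF n] by simp
    qed
    have C1F2: "C1_on W (?F2 b) (?g2 b)" if b: "b \<in> Basis" for b
      by (rule C1_on_mult[OF C1_on_const_diff[OF \<psi>W] insert.prems(2)[OF b]])
    have 2: "(\<integral>z. indicator \<Omega> z * (\<Sum>b\<in>Basis. ?g2 b z \<bullet> b) \<partial>lborel) = 0"
    proof (rule insert.IH)
      show "C1_on W (?F2 b) (?g2 b)" if "b \<in> Basis" for b by (rule C1F2[OF that])
      show "graph_chart \<Omega> z (\<rho> z) \<and> ball z (\<rho> z) \<subseteq> W" if "z \<in> C" for z using insert.prems(1) that by simp
      \<comment> \<open>The factor \<open>1 - \<psi>\<close> vanishes on this ball, which is why the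
        cover uses balls of half the chart radius.\<close>
      show "open (Z \<union> ball x (\<rho> x / 2))" using insert.prems(4) by auto
      show "frontier \<Omega> \<subseteq> Z \<union> ball x (\<rho> x / 2) \<union> (\<Union>x\<in>C. ball x (\<rho> x / 2))"
        using insert.prems(5) by auto
      show "?F2 b z = 0" if "b \<in> Basis" "z \<in> W" "z \<in> Z \<union> ball x (\<rho> x / 2)" for b z
        using that insert.prems(6)[of b z] one[of z] by auto
      fix y n assume n: "outward_normal \<Omega> y n"
      have "(\<Sum>b\<in>Basis. ?F2 b y * (n \<bullet> b)) = (1 - \<psi> y) * (\<Sum>b\<in>Basis. F b y * (n \<bullet> b))"
        by (simp add: sum_distrib_left mult.assoc)
      then show "(\<Sum>b\<in>Basis. ?F2 b y * (n \<bullet> b)) = 0" using insert.prems(3)[OF n] by simp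
    qed
    have i1: "integrable lborel (\<lambda>z. indicator \<Omega> z * (\<Sum>b\<in>Basis. ?g1 b z \<bullet> b))"
      by (rule int[of ?F1], rule C1_on_subset[OF C1F1 oW]) auto
    have i2: "integrable lborel (\<lambda>z. indicator \<Omega> z * (\<Sum>b\<in>Basis. ?g2 b z \<bullet> b))"
      by (rule int[of ?F2], rule C1F2)
    have "indicator \<Omega> z * (\<Sum>b\<in>Basis. g b z \<bullet> b)
      = indicator \<Omega> z * (\<Sum>b\<in>Basis. ?g1 b z \<bullet> b) + indicator \<Omega> z * (\<Sum>b\<in>Basis. ?g2 b z \<bullet> b)" for z
    proof (cases "z \<in> \<Omega>")
      case True
      then have "?g1 b z + ?g2 b z = g b z" for b using \<Omega>W by (auto simp: algebra_simps)
      then have "g b z \<bullet> b = ?g1 b z \<bullet> b + ?g2 b z \<bullet> b" for b by (metis inner_add_left)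
      then show ?thesis using True by (simp only: sum.distrib distrib_left)
    qed simp
    then show ?case using 1 2 Bochner_Integration.integral_add[OF i1 i2] by simp
  qed
  have "\<exists>r. graph_chart \<Omega> x r \<and> ball x r \<subseteq> W" if x: "x \<in> frontier \<Omega>" for x
  proof -
    obtain r where r: "graph_chart \<Omega> x r" using lipschitz_domain_graph_chart[OF dom x] by blast
    obtain d where d: "d > 0" "ball x d \<subseteq> W" using openE[OF oW, of x] x frW by blast
    have "graph_chart \<Omega> x (min r d)" using r d unfolding graph_chart_def by (metis ball_min_Int IntD1 min_less_iff_conj)
    moreover have "ball x (min r d) \<subseteq> W" using d(2) by auto
    ultimately show ?thesis by blast
  qed
  then obtain \<rho> where \<rho>: "\<And>x. x \<in> frontier \<Omega> \<Longrightarrow> graph_chart \<Omega> x (\<rho> x) \<and> ball x (\<rho> x) \<subseteq> W" by metis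
  have "compact (frontier \<Omega>)" using \<Omega> by (simp add: compact_frontier_bounded)
  moreover have "frontier \<Omega> \<subseteq> (\<Union>x\<in>frontier \<Omega>. ball x (\<rho> x / 2))"
    using \<rho> by (auto simp: graph_chart_def)
  ultimately obtain C where C: "C \<subseteq> frontier \<Omega>" "finite C" "frontier \<Omega> \<subseteq> (\<Union>x\<in>C. ball x (\<rho> x / 2))"
    by (rule compactE_image[OF _ open_ball])
  show ?thesis
    by (rule *[of C \<rho> F g "{}"]) (use C \<rho> C1 tang in auto)
qed

section \<open>Partial derivatives of smooth space-time fields\<close>

lemma C1_on_has_real_derivative_line:
  assumes C: "C1_on U f g" and w: "w + s *\<^sub>R b \<in> U"
  shows "((\<lambda>s. f (w + s *\<^sub>R b)) has_real_derivative g (w + s *\<^sub>R b) \<bullet> b) (at s)"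
proof -
  have "((\<lambda>s::real. w + s *\<^sub>R b) has_derivative (\<lambda>h. h *\<^sub>R b)) (at s)"
    by (auto intro!: derivative_eq_intros)
  from has_derivative_compose[OF this C1_on_derivative[OF C w]]
  have "((\<lambda>s. f (w + s *\<^sub>R b)) has_derivative (\<lambda>h. g (w + s *\<^sub>R b) \<bullet> (h *\<^sub>R b))) (at s)" .
  moreover have "(\<lambda>h. g (w + s *\<^sub>R b) \<bullet> (h *\<^sub>R b)) = (*) (g (w + s *\<^sub>R b) \<bullet> b)"
    by (auto simp: fun_eq_iff)
  ultimately show ?thesis by (simp add: has_field_derivative_def)
qed

text \<open>The mean value theorem is applied along \<open>b\<close> to the difference of
  \<open>f\<close> under the shift by \<open>h *\<^sub>R c\<close>, and then along \<open>c\<close>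
  to the resulting difference of \<open>g z \<bullet> b\<close>.\<close>

lemma second_difference_mean_value:
  assumes f: "C1_on U f g" and gb: "C1_on U (\<lambda>z. g z \<bullet> b) k"
    and h: "h > 0" and U: "\<And>s r. 0 \<le> s \<Longrightarrow> s \<le> h \<Longrightarrow> 0 \<le> r \<Longrightarrow> r \<le> h \<Longrightarrow> z + s *\<^sub>R b + r *\<^sub>R c \<in> U"
  obtains s r where "0 < s" "s < h" "0 < r" "r < h"
    "f (z + h *\<^sub>R b + h *\<^sub>R c) - f (z + h *\<^sub>R b) - f (z + h *\<^sub>R c) + f z = h * h * (k (z + s *\<^sub>R b + r *\<^sub>R c) \<bullet> c)"
proof -
  let ?G = "\<lambda>s. f (z + h *\<^sub>R c + s *\<^sub>R b) - f (z + s *\<^sub>R b)"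
  have "\<exists>s. 0 < s \<and> s < h \<and> ?G h - ?G 0 = (h - 0) * (g (z + h *\<^sub>R c + s *\<^sub>R b) \<bullet> b - g (z + s *\<^sub>R b) \<bullet> b)"
  proof (rule MVT2[OF h])
    fix s assume s: "0 \<le> s" "s \<le> h"
    have "z + h *\<^sub>R c + s *\<^sub>R b \<in> U" "z + s *\<^sub>R b \<in> U"
      using U[OF s, of h] U[OF s, of 0] h by (simp_all add: add_ac)
    then show "DERIV ?G s :> g (z + h *\<^sub>R c + s *\<^sub>R b) \<bullet> b - g (z + s *\<^sub>R b) \<bullet> b"
      by (intro DERIV_diff C1_on_has_real_derivative_line[OF f])
  qed
  then obtain s where s: "0 < s" "s < h"
    "?G h - ?G 0 = h * (g (z + h *\<^sub>R c + s *\<^sub>R b) \<bullet> b - g (z + s *\<^sub>R b) \<bullet> b)" by auto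
  let ?H = "\<lambda>r. g (z + s *\<^sub>R b + r *\<^sub>R c) \<bullet> b"
  have "\<exists>r. 0 < r \<and> r < h \<and> ?H h - ?H 0 = (h - 0) * (k (z + s *\<^sub>R b + r *\<^sub>R c) \<bullet> c)"
  proof (rule MVT2[OF h])
    fix r assume "0 \<le> r" "r \<le> h"
    then have "z + s *\<^sub>R b + r *\<^sub>R c \<in> U" using U[of s r] s by simp
    then show "DERIV ?H r :> k (z + s *\<^sub>R b + r *\<^sub>R c) \<bullet> c"
      by (rule C1_on_has_real_derivative_line[OF gb])
  qed
  then obtain r where r: "0 < r" "r < h" "?H h - ?H 0 = h * (k (z + s *\<^sub>R b + r *\<^sub>R c) \<bullet> c)" by auto
  have "f (z + h *\<^sub>R b + h *\<^sub>R c) - f (z + h *\<^sub>R b) - f (z + h *\<^sub>R c) + f z = ?G h - ?G 0"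
    by (simp add: add_ac)
  also have "\<dots> = h * (?H h - ?H 0)" using s(3) by (simp add: add_ac)
  also have "\<dots> = h * h * (k (z + s *\<^sub>R b + r *\<^sub>R c) \<bullet> c)" using r(3) by simp
  finally show ?thesis using that[OF s(1,2) r(1,2)] by blast
qed

text \<open>The second difference of \<open>f\<close> is symmetric in \<open>b\<close> and
  \<open>c\<close>, but \<open>second_difference_mean_value\<close> evaluates it in either order; so
  the two mixed derivatives coincide at points arbitrarily close to \<open>z\<close>, and continuity
  excludes a gap at \<open>z\<close>.\<close>

lemma mixed_partials_commute:
  assumes f: "C1_on U f g" and gb: "C1_on U (\<lambda>z. g z \<bullet> b) k" and gc: "C1_on U (\<lambda>z. g z \<bullet> c) l"
    and z: "z \<in> U"
  shows "k z \<bullet> c = l z \<bullet> b"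
proof (rule ccontr)
  assume ne: "k z \<bullet> c \<noteq> l z \<bullet> b"
  define \<epsilon> where "\<epsilon> = \<bar>k z \<bullet> c - l z \<bullet> b\<bar> / 2"
  have \<epsilon>: "\<epsilon> > 0" using ne by (simp add: \<epsilon>_def)
  have op: "open U" by (rule C1_on_open[OF f])
  obtain d0 where d0: "d0 > 0" "ball z d0 \<subseteq> U" using openE[OF op z] by blast
  have "continuous_on U (\<lambda>z. k z \<bullet> c)" "continuous_on U (\<lambda>z. l z \<bullet> b)"
    by (intro continuous_intros C1_on_gradient_continuous[OF gb] C1_on_gradient_continuous[OF gc])+
  then have ck: "isCont (\<lambda>z. k z \<bullet> c) z" and cl: "isCont (\<lambda>z. l z \<bullet> b) z"
    using op z by (simp_all add: continuous_on_eq_continuous_at)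
  obtain d1 where d1: "d1 > 0" "\<And>w. dist w z < d1 \<Longrightarrow> \<bar>k w \<bullet> c - k z \<bullet> c\<bar> < \<epsilon>"
    using ck \<epsilon> unfolding continuous_at_eps_delta dist_real_def by blast
  obtain d2 where d2: "d2 > 0" "\<And>w. dist w z < d2 \<Longrightarrow> \<bar>l w \<bullet> b - l z \<bullet> b\<bar> < \<epsilon>"
    using cl \<epsilon> unfolding continuous_at_eps_delta dist_real_def by blast
  define d where "d = min d0 (min d1 d2)"
  have d: "d > 0" "d \<le> d0" "d \<le> d1" "d \<le> d2" using d0 d1 d2 by (auto simp: d_def)
  \<comment> \<open>The summand 1 keeps \<open>q\<close> positive even for zero directions. With
    \<open>h * q = d / 2\<close> the whole parallelogram of sides \<open>h *\<^sub>R b\<close>,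
    \<open>h *\<^sub>R c\<close> stays within distance \<open>d\<close> of \<open>z\<close>.\<close>
  obtain q where q: "q = norm b + norm c + 1" by simp
  have qp: "q > 0" using norm_ge_zero[of b] norm_ge_zero[of c] unfolding q by linarith
  define h where "h = d / (2 * q)"
  have h: "h > 0" using d qp by (simp add: h_def)
  have hq: "h * q < d" using d qp by (simp add: h_def)
  have near: "dist (z + s *\<^sub>R b + r *\<^sub>R c) z < d" if "0 \<le> s" "s \<le> h" "0 \<le> r" "r \<le> h" for s r
  proof -
    have "dist (z + s *\<^sub>R b + r *\<^sub>R c) z = norm (s *\<^sub>R b + r *\<^sub>R c)" by (simp add: dist_norm add.assoc)
    also have "\<dots> \<le> s * norm b + r * norm c"
      using norm_triangle_ineq[of "s *\<^sub>R b" "r *\<^sub>R c"] that by simp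
    also have "\<dots> \<le> h * norm b + h * norm c" using that by (intro add_mono mult_right_mono) auto
    also have "\<dots> \<le> h * q" using h by (simp add: q algebra_simps)
    finally show ?thesis using hq by simp
  qed
  have inU: "z + s *\<^sub>R b + r *\<^sub>R c \<in> U" if "0 \<le> s" "s \<le> h" "0 \<le> r" "r \<le> h" for s r
    using near[OF that] d d0 by (intro subsetD[OF d0(2)]) (simp add: dist_commute)
  have inU': "z + s *\<^sub>R c + r *\<^sub>R b \<in> U" if "0 \<le> s" "s \<le> h" "0 \<le> r" "r \<le> h" for s r
    using inU[OF that(3,4,1,2)] by (simp add: add_ac)
  obtain s r where 1: "0 < s" "s < h" "0 < r" "r < h"
    "f (z + h *\<^sub>R b + h *\<^sub>R c) - f (z + h *\<^sub>R b) - f (z + h *\<^sub>R c) + f z = h * h * (k (z + s *\<^sub>R b + r *\<^sub>R c) \<bullet> c)"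
    by (rule second_difference_mean_value[OF f gb h inU]; assumption?)
  obtain s' r' where 2: "0 < s'" "s' < h" "0 < r'" "r' < h"
    "f (z + h *\<^sub>R c + h *\<^sub>R b) - f (z + h *\<^sub>R c) - f (z + h *\<^sub>R b) + f z = h * h * (l (z + s' *\<^sub>R c + r' *\<^sub>R b) \<bullet> b)"
    by (rule second_difference_mean_value[OF f gc h inU']; assumption?)
  have "h * h * (k (z + s *\<^sub>R b + r *\<^sub>R c) \<bullet> c) = h * h * (l (z + s' *\<^sub>R c + r' *\<^sub>R b) \<bullet> b)"
    using 1(5) 2(5) by (simp only: add.assoc add.commute[of "h *\<^sub>R c" "h *\<^sub>R b"])
  then have eq: "k (z + s *\<^sub>R b + r *\<^sub>R c) \<bullet> c = l (z + s' *\<^sub>R c + r' *\<^sub>R b) \<bullet> b" using h by simp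
  have A: "\<bar>k (z + s *\<^sub>R b + r *\<^sub>R c) \<bullet> c - k z \<bullet> c\<bar> < \<epsilon>"
    using near[of s r] 1 d by (intro d1(2)) auto
  have B: "\<bar>l (z + s' *\<^sub>R c + r' *\<^sub>R b) \<bullet> b - l z \<bullet> b\<bar> < \<epsilon>"
    using near[of r' s'] 2 d by (intro d2(2)) (auto simp: add_ac)
  from A B eq show False unfolding \<epsilon>_def by (auto simp: abs_if split: if_splits)
qed

lemma C1_on_cong_gradient:
  assumes "C1_on U f g" "\<And>z. z \<in> U \<Longrightarrow> f z = f' z" "\<And>z. z \<in> U \<Longrightarrow> g z = g' z"
  shows "C1_on U f' g'"
  unfolding C1_on_def
proof (intro conjI ballI)
  show op: "open U" by (rule C1_on_open[OF assms(1)])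
  show "continuous_on U g'" by (rule continuous_on_eq[OF C1_on_gradient_continuous[OF assms(1)]]) (rule assms)
  fix z assume z: "z \<in> U"
  have "(f has_derivative (\<lambda>h. g' z \<bullet> h)) (at z)"
    using C1_on_derivative[OF assms(1) z] by (simp only: assms(3)[OF z])
  then show "(f' has_derivative (\<lambda>h. g' z \<bullet> h)) (at z)"
    by (rule has_derivative_transform_within_open[OF _ op z]) (rule assms)
qed

section \<open>Iterated differentiability and space-time partial derivatives\<close>

lemma Ck_continuous: "Ck k U f \<Longrightarrow> continuous_on U f"
  by (cases k) (auto intro: differentiable_imp_continuous_on)

lemma Ck_cong:
  assumes "open U" "Ck k U f" "\<And>z. z \<in> U \<Longrightarrow> f z = g z"
  shows "Ck k U g"
  using assms(2,3)
proof (induction k arbitrary: f g)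
  case 0
  then show ?case by (auto intro: continuous_on_eq)
next
  case (Suc k)
  have d: "(g has_derivative frechet_derivative f (at z)) (at z)" if z: "z \<in> U" for z
  proof -
    have "f differentiable (at z)"
      using Suc.prems(1) z assms(1) by (auto simp: differentiable_on_eq_differentiable_at)
    then have "(f has_derivative frechet_derivative f (at z)) (at z)"
      by (simp add: frechet_derivative_works)
    then show ?thesis
      by (rule has_derivative_transform_within_open[OF _ assms(1) z]) (rule Suc.prems(2))
  qed
  have "g differentiable_on U"
    using d assms(1) by (auto simp: differentiable_on_eq_differentiable_at differentiable_def)
  moreover have "Ck k U (\<lambda>z. frechet_derivative g (at z) b)" if "b \<in> Basis" for b
  proof (rule Suc.IH)
    show "Ck k U (\<lambda>z. frechet_derivative f (at z) b)" using Suc.prems(1) that by simp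
    show "frechet_derivative f (at z) b = frechet_derivative g (at z) b" if "z \<in> U" for z
      by (rule arg_cong[OF frechet_derivative_at[OF d[OF that]], where f = "\<lambda>D. D b"])
  qed
  ultimately show ?case by simp
qed

lemma Ck_Suc_C1_on:
  assumes U: "open U" and C: "Ck (Suc k) U f"
  shows "C1_on U f (\<lambda>z. \<Sum>b\<in>Basis. frechet_derivative f (at z) b *\<^sub>R b)"
  unfolding C1_on_def
proof (intro conjI ballI U)
  show "continuous_on U (\<lambda>z. \<Sum>b\<in>Basis. frechet_derivative f (at z) b *\<^sub>R b)"
    using C by (intro continuous_intros Ck_continuous) auto
  fix z assume z: "z \<in> U"
  let ?D = "frechet_derivative f (at z)"
  have "f differentiable (at z)"
    using C z U by (auto simp: differentiable_on_eq_differentiable_at)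
  then have D: "(f has_derivative ?D) (at z)" by (simp add: frechet_derivative_works)
  have lin: "linear ?D" using D by (rule has_derivative_linear)
  have "?D h = (\<Sum>b\<in>Basis. ?D b *\<^sub>R b) \<bullet> h" for h
  proof -
    have "?D h = ?D (\<Sum>b\<in>Basis. (h \<bullet> b) *\<^sub>R b)" by (simp add: euclidean_representation)
    also have "\<dots> = (\<Sum>b\<in>Basis. (h \<bullet> b) * ?D b)" by (simp add: linear_sum[OF lin] linear_scale[OF lin])
    finally show ?thesis unfolding inner_sum_left inner_scaleR_left
      by (simp only: inner_commute mult.commute)
  qed
  then have "?D = (\<lambda>h. (\<Sum>b\<in>Basis. ?D b *\<^sub>R b) \<bullet> h)" by (rule ext)
  with D show "(f has_derivative (\<lambda>h. (\<Sum>b\<in>Basis. ?D b *\<^sub>R b) \<bullet> h)) (at z)" by (simp only:)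
qed

definition joint :: "('a \<Rightarrow> real \<Rightarrow> 'b) \<Rightarrow> 'a \<times> real \<Rightarrow> 'b" where
  "joint u = (\<lambda>z. u (fst z) (snd z))"

definition stgrad :: "(real^'n::finite \<Rightarrow> real \<Rightarrow> real) \<Rightarrow> (real^'n) \<times> real \<Rightarrow> (real^'n) \<times> real" where
  "stgrad u z = (grad u (fst z) (snd z), dt u (fst z) (snd z))"

lemma C1_on_joint_partials:
  fixes u :: "real^'n::finite \<Rightarrow> real \<Rightarrow> real"
  assumes C: "C1_on U (joint u) g" and z: "(x, t) \<in> U"
  shows "dx i u x t = g (x, t) \<bullet> (axis i 1, 0)" "dt u x t = g (x, t) \<bullet> (0, 1)"
    "((\<lambda>s. u x s) has_real_derivative dt u x t) (at t)"
proof -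
  have "((\<lambda>s. joint u ((x, t) + s *\<^sub>R (axis i 1, 0))) has_real_derivative
      g ((x, t) + 0 *\<^sub>R (axis i 1, 0)) \<bullet> (axis i 1, 0)) (at 0)"
    by (rule C1_on_has_real_derivative_line[OF C]) (use z in simp)
  then show "dx i u x t = g (x, t) \<bullet> (axis i 1, 0)"
    unfolding dx_def joint_def by (intro DERIV_imp_deriv) simp
  have "((\<lambda>s. joint u ((x, 0) + s *\<^sub>R (0, 1))) has_real_derivative
      g ((x, 0) + t *\<^sub>R (0, 1)) \<bullet> (0, 1)) (at t)"
    by (rule C1_on_has_real_derivative_line[OF C]) (use z in simp)
  then have D: "((\<lambda>s. u x s) has_real_derivative g (x, t) \<bullet> (0, 1)) (at t)"
    by (simp add: joint_def)
  then show eq: "dt u x t = g (x, t) \<bullet> (0, 1)" unfolding dt_def by (rule DERIV_imp_deriv)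
  show "((\<lambda>s. u x s) has_real_derivative dt u x t) (at t)" using D by (simp only: eq)
qed

lemma C1_on_joint_stgrad:
  fixes u :: "real^'n::finite \<Rightarrow> real \<Rightarrow> real"
  assumes C: "C1_on U (joint u) g" and z: "z \<in> U"
  shows "g z = stgrad u z"
proof (rule prod_eqI)
  obtain x t where xt: "z = (x, t)" by (cases z)
  note p = C1_on_joint_partials[OF C, of x t, OF z[unfolded xt]]
  show "fst (g z) = fst (stgrad u z)"
    by (simp add: vec_eq_iff stgrad_def grad_def xt p(1) inner_prod_def inner_axis)
  show "snd (g z) = snd (stgrad u z)"
    by (simp add: stgrad_def xt p(2) inner_prod_def)
qed

lemma smooth_field_continuous:
  assumes "smooth_field k \<Omega> T u"
  shows "continuous_on (closure \<Omega> \<times> {0<..<T}) (joint u)"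
  using assms unfolding smooth_field_def joint_def[symmetric]
  by (meson Ck_continuous continuous_on_subset)

text \<open>\<open>Ck\<close> speaks of Frechet derivatives on the product space, the equations of
  \<open>dx\<close> and \<open>dt\<close>, defined by one-variable \<open>deriv\<close>. Both agree
  on the open set \<open>U\<close>, so one order of smoothness of \<open>u\<close> passes to its
  partial derivatives there.\<close>

lemma smooth_field_SucE:
  fixes u :: "real^'n::finite \<Rightarrow> real \<Rightarrow> real"
  assumes "smooth_field (Suc k) \<Omega> T u"
  obtains U where "closure \<Omega> \<times> {0<..<T} \<subseteq> U" "C1_on U (joint u) (stgrad u)"
    "\<And>i. Ck k U (joint (dx i u))" "Ck k U (joint (dt u))"
proof -
  obtain U where U: "open U" "closure \<Omega> \<times> {0<..<T} \<subseteq> U" "Ck (Suc k) U (joint u)"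
    using assms unfolding smooth_field_def joint_def by blast
  define g where "g = (\<lambda>z. \<Sum>b\<in>Basis. frechet_derivative (joint u) (at z) b *\<^sub>R b)"
  have C: "C1_on U (joint u) g" unfolding g_def by (rule Ck_Suc_C1_on[OF U(1,3)])
  have gb: "g z \<bullet> b = frechet_derivative (joint u) (at z) b" if "b \<in> Basis" for z b
    using that by (simp add: g_def)
  have "C1_on U (joint u) (stgrad u)"
    by (rule C1_on_cong_gradient[OF C]) (simp_all add: C1_on_joint_stgrad[OF C])
  moreover have "Ck k U (joint (dx i u))" for i
  proof (rule Ck_cong[OF U(1)])
    have b: "(axis i 1, 0) \<in> (Basis :: ((real^'n) \<times> real) set)" by (simp add: Basis_prod_def axis_in_Basis_iff)
    show "Ck k U (\<lambda>z. frechet_derivative (joint u) (at z) (axis i 1, 0))" using U(3) b by simp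
    show "frechet_derivative (joint u) (at z) (axis i 1, 0) = joint (dx i u) z" if "z \<in> U" for z
      using C1_on_joint_partials(1)[OF C, of "fst z" "snd z" i] that gb[OF b, of z] by (simp add: joint_def)
  qed
  moreover have "Ck k U (joint (dt u))"
  proof (rule Ck_cong[OF U(1)])
    have b: "(0, 1) \<in> (Basis :: ((real^'n) \<times> real) set)" by (simp add: Basis_prod_def)
    show "Ck k U (\<lambda>z. frechet_derivative (joint u) (at z) (0, 1))" using U(3) b by simp
    show "frechet_derivative (joint u) (at z) (0, 1) = joint (dt u) z" if "z \<in> U" for z
      using C1_on_joint_partials(2)[OF C, of "fst z" "snd z"] that gb[OF b, of z] by (simp add: joint_def)
  qed
  ultimately show ?thesis using that U(2) by blast
qed

lemma smooth_field_dx_dt: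
  fixes u :: "real^'n::finite \<Rightarrow> real \<Rightarrow> real"
  assumes "smooth_field (Suc k) \<Omega> T u"
  shows "smooth_field k \<Omega> T (dx i u)" "smooth_field k \<Omega> T (dt u)"
  using smooth_field_SucE[OF assms] unfolding smooth_field_def joint_def
  by (metis C1_on_open)+

lemma smooth_field_dt:
  fixes u :: "real^'n::finite \<Rightarrow> real \<Rightarrow> real"
  assumes "smooth_field (Suc k) \<Omega> T u" and "x \<in> closure \<Omega>" "t \<in> {0<..<T}"
  shows "((\<lambda>s. u x s) has_real_derivative dt u x t) (at t)"
proof -
  obtain U where U: "closure \<Omega> \<times> {0<..<T} \<subseteq> U" "C1_on U (joint u) (stgrad u)"
    by (rule smooth_field_SucE[OF assms(1)])
  have "(x, t) \<in> U" using U(1) assms by blast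
  from C1_on_joint_partials(3)[OF U(2) this] show ?thesis .
qed

text \<open>Exchanging space derivatives turns the divergence of the transposed velocity gradient
  into grad div v; exchanging space and time derivatives is needed for the gradient energy.\<close>

lemma smooth_field_mixed:
  fixes u :: "real^'n::finite \<Rightarrow> real \<Rightarrow> real"
  assumes "smooth_field 2 \<Omega> T u" and "x \<in> closure \<Omega>" "t \<in> {0<..<T}"
  shows "dx i (dx k u) x t = dx k (dx i u) x t" "dt (dx i u) x t = dx i (dt u) x t"
proof -
  have "smooth_field (Suc 1) \<Omega> T u" using assms(1) by (simp add: numeral_2_eq_2)
  then obtain U where U: "closure \<Omega> \<times> {0<..<T} \<subseteq> U" "C1_on U (joint u) (stgrad u)"
    and "\<And>i. Ck 1 U (joint (dx i u))" "Ck 1 U (joint (dt u))"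
    by (rule smooth_field_SucE) (rule that; assumption)
  then have Ck: "\<And>i. Ck (Suc 0) U (joint (dx i u))" "Ck (Suc 0) U (joint (dt u))" by simp_all
  have z: "(x, t) \<in> U" using U(1) assms by blast
  note op = C1_on_open[OF U(2)]
  have ex: "C1_on U w (stgrad r)" if "Ck (Suc 0) U (joint r)" "\<And>z. joint r z = w z" for w r
  proof -
    note C = Ck_Suc_C1_on[OF op that(1)]
    show ?thesis
      by (rule C1_on_cong_gradient[OF C]) (simp_all add: C1_on_joint_stgrad[OF C] that(2))
  qed
  have gx: "C1_on U (\<lambda>z. stgrad u z \<bullet> (axis i 1, 0)) (stgrad (dx i u))" for i
    by (rule ex[OF Ck(1)]) (simp add: joint_def stgrad_def inner_prod_def grad_def inner_axis)
  have gt: "C1_on U (\<lambda>z. stgrad u z \<bullet> (0, 1)) (stgrad (dt u))"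
    by (rule ex[OF Ck(2)]) (simp add: joint_def stgrad_def inner_prod_def)
  show "dx i (dx k u) x t = dx k (dx i u) x t"
    using mixed_partials_commute[OF U(2) gx[of k] gx[of i] z]
    by (simp add: stgrad_def inner_prod_def grad_def inner_axis)
  show "dt (dx i u) x t = dx i (dt u) x t"
    using mixed_partials_commute[OF U(2) gx[of i] gt z]
    by (simp add: stgrad_def inner_prod_def grad_def inner_axis)
qed

section \<open>Calculus of spatial partial derivatives at a fixed time\<close>

definition pd :: "'n::finite \<Rightarrow> (real^'n \<Rightarrow> real) \<Rightarrow> real^'n \<Rightarrow> real" where
  "pd i f x = deriv (\<lambda>s. f (x + s *\<^sub>R axis i 1)) 0"

lemma dx_eq_pd: "dx i u x t = pd i (\<lambda>y. u y t) x"
  by (simp add: dx_def pd_def)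

text \<open>The gradient can stay hidden because it is determined by \<open>pd\<close> (see
  \<open>C1_nearE\<close>). Smoothness beyond the boundary is kept, since the divergence theorem
  differentiates the flux on a neighbourhood of the closure.\<close>

definition C1_near :: "(real^'n::finite) set \<Rightarrow> (real^'n \<Rightarrow> real) \<Rightarrow> bool" where
  "C1_near K f \<longleftrightarrow> (\<exists>W g. K \<subseteq> W \<and> C1_on W f g)"

lemma C1_on_pd:
  assumes C: "C1_on W f g" and x: "x \<in> W"
  shows "g x = (\<chi> i. pd i f x)"
proof -
  have "pd i f x = g x $ i" for i
  proof -
    have "((\<lambda>s. f (x + s *\<^sub>R axis i 1)) has_real_derivative g (x + 0 *\<^sub>R axis i 1) \<bullet> axis i 1) (at 0)"
      by (rule C1_on_has_real_derivative_line[OF C]) (use x in simp)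
    then show ?thesis unfolding pd_def by (intro DERIV_imp_deriv) (simp add: inner_axis)
  qed
  then show ?thesis by (simp add: vec_eq_iff)
qed

lemma C1_nearE:
  assumes "C1_near K f"
  obtains W where "K \<subseteq> W" "C1_on W f (\<lambda>x. \<chi> i. pd i f x)"
proof -
  obtain W g where W: "K \<subseteq> W" "C1_on W f g" using assms by (auto simp: C1_near_def)
  have "C1_on W f (\<lambda>x. \<chi> i. pd i f x)"
    by (rule C1_on_cong_gradient[OF W(2)]) (simp_all add: C1_on_pd[OF W(2)])
  with W(1) show ?thesis by (rule that)
qed

lemma C1_near_DERIV:
  assumes "C1_near K f" "x \<in> K"
  shows "((\<lambda>s. f (x + s *\<^sub>R axis i 1)) has_real_derivative pd i f x) (at 0)"
proof -
  obtain W where W: "K \<subseteq> W" "C1_on W f (\<lambda>x. \<chi> i. pd i f x)" by (rule C1_nearE[OF assms(1)])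
  have "x + 0 *\<^sub>R axis i 1 \<in> W" using W(1) assms(2) by auto
  from C1_on_has_real_derivative_line[OF W(2) this] show ?thesis by (simp add: inner_axis)
qed

lemma C1_near_const[intro, simp]: "C1_near K (\<lambda>x. c)"
proof -
  have "C1_on UNIV (\<lambda>x. c) (\<lambda>x. 0)" by (auto simp: C1_on_def)
  then show ?thesis unfolding C1_near_def by blast
qed

lemma C1_near_component[intro, simp]: "C1_near K (\<lambda>x. x $ i)"
proof -
  have "C1_on UNIV (\<lambda>x. x $ i) (\<lambda>x. axis i 1)"
    by (auto simp: C1_on_def inner_axis' intro!: bounded_linear_imp_has_derivative)
  then show ?thesis unfolding C1_near_def by blast
qed

lemma C1_near_common:
  assumes "C1_near K f" "C1_near K g"
  obtains W where "K \<subseteq> W" "C1_on W f (\<lambda>x. \<chi> i. pd i f x)" "C1_on W g (\<lambda>x. \<chi> i. pd i g x)"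
proof -
  obtain V W where V: "K \<subseteq> V" "C1_on V f (\<lambda>x. \<chi> i. pd i f x)"
    and W: "K \<subseteq> W" "C1_on W g (\<lambda>x. \<chi> i. pd i g x)"
    using C1_nearE[OF assms(1)] C1_nearE[OF assms(2)] by metis
  have op: "open (V \<inter> W)" by (intro open_Int C1_on_open[OF V(2)] C1_on_open[OF W(2)])
  show ?thesis
    by (rule that[OF _ C1_on_subset[OF V(2) op] C1_on_subset[OF W(2) op]]) (use V(1) W(1) in auto)
qed

lemma C1_near_mult[intro]:
  assumes "C1_near K f" "C1_near K g"
  shows "C1_near K (\<lambda>x. f x * g x)"
  by (rule C1_near_common[OF assms]) (unfold C1_near_def, blast intro: C1_on_mult)

lemma C1_on_add:
  assumes "C1_on W f g" "C1_on W f' g'"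
  shows "C1_on W (\<lambda>z. f z + f' z) (\<lambda>z. g z + g' z)"
  unfolding C1_on_def
proof (intro conjI ballI)
  show "open W" by (rule C1_on_open[OF assms(1)])
  show "continuous_on W (\<lambda>z. g z + g' z)"
    by (intro continuous_intros C1_on_gradient_continuous[OF assms(1)] C1_on_gradient_continuous[OF assms(2)])
  fix z assume "z \<in> W"
  from has_derivative_add[OF C1_on_derivative[OF assms(1) this] C1_on_derivative[OF assms(2) this]]
  show "((\<lambda>z. f z + f' z) has_derivative (\<lambda>h. (g z + g' z) \<bullet> h)) (at z)"
    by (simp only: inner_add_left)
qed

lemma C1_near_add[intro]:
  assumes "C1_near K f" "C1_near K g"
  shows "C1_near K (\<lambda>x. f x + g x)"
  by (rule C1_near_common[OF assms]) (unfold C1_near_def, blast intro: C1_on_add)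

lemma C1_near_sum[intro]:
  assumes "\<And>k. k \<in> A \<Longrightarrow> C1_near K (f k)"
  shows "C1_near K (\<lambda>x. \<Sum>k\<in>A. f k x)"
  using assms by (induction A rule: infinite_finite_induct) auto

lemma C1_near_minus[intro]:
  assumes "C1_near K f" shows "C1_near K (\<lambda>x. - f x)"
  using C1_near_mult[OF C1_near_const[of K "-1"] assms] by simp

lemma C1_near_diff[intro]:
  assumes "C1_near K f" "C1_near K g"
  shows "C1_near K (\<lambda>x. f x - g x)"
  using C1_near_add[OF assms(1) C1_near_minus[OF assms(2)]] by simp

lemma C1_near_power2[intro]:
  assumes "C1_near K f" shows "C1_near K (\<lambda>x. (f x)\<^sup>2)"
  using C1_near_mult[OF assms assms] by (simp add: power2_eq_square)

lemma pd_const: "pd i (\<lambda>x. c) x = 0"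
  by (simp add: pd_def)

lemma pd_component: "pd i (\<lambda>x :: real^'n::finite. x $ k) x = (if i = k then 1 else 0)"
proof -
  have "((\<lambda>s. (x + s *\<^sub>R axis i 1) $ k) has_real_derivative (if i = k then 1 else 0)) (at 0)"
    by (auto simp: axis_def intro!: derivative_eq_intros)
  then show ?thesis unfolding pd_def by (rule DERIV_imp_deriv)
qed

context
  fixes K :: "(real^'n::finite) set" and x
  assumes x: "x \<in> K"
begin

lemma pd_mult:
  assumes "C1_near K f" "C1_near K g"
  shows "pd i (\<lambda>x. f x * g x) x = f x * pd i g x + g x * pd i f x"
  using DERIV_mult[OF C1_near_DERIV[OF assms(1) x] C1_near_DERIV[OF assms(2) x], of i i]
  unfolding pd_def[of i "\<lambda>x. f x * g x"] by (intro DERIV_imp_deriv) (simp add: algebra_simps)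

lemma pd_add:
  assumes "C1_near K f" "C1_near K g"
  shows "pd i (\<lambda>x. f x + g x) x = pd i f x + pd i g x"
  using DERIV_add[OF C1_near_DERIV[OF assms(1) x] C1_near_DERIV[OF assms(2) x], of i i]
  unfolding pd_def[of i "\<lambda>x. f x + g x"] by (intro DERIV_imp_deriv)

lemma pd_minus:
  assumes "C1_near K f"
  shows "pd i (\<lambda>x. - f x) x = - pd i f x"
  using pd_mult[OF C1_near_const[of K "-1"] assms] by (simp add: pd_const)

lemma pd_diff:
  assumes "C1_near K f" "C1_near K g"
  shows "pd i (\<lambda>x. f x - g x) x = pd i f x - pd i g x"
  using pd_add[OF assms(1) C1_near_minus[OF assms(2)]] by (simp add: pd_minus[OF assms(2)])

lemma pd_sum:
  assumes "\<And>k. k \<in> A \<Longrightarrow> C1_near K (f k)"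
  shows "pd i (\<lambda>x. \<Sum>k\<in>A. f k x) x = (\<Sum>k\<in>A. pd i (f k) x)"
  using assms
proof (induction A rule: infinite_finite_induct)
  case (insert a A)
  then have "pd i (\<lambda>x. f a x + (\<Sum>k\<in>A. f k x)) x = pd i (f a) x + pd i (\<lambda>x. \<Sum>k\<in>A. f k x) x"
    by (intro pd_add C1_near_sum) auto
  with insert show ?case by simp
qed (simp_all add: pd_const)

lemma pd_power2:
  assumes "C1_near K f"
  shows "pd i (\<lambda>x. (f x)\<^sup>2) x = 2 * (f x * pd i f x)"
  using pd_mult[OF assms assms, of i] by (simp add: power2_eq_square)

end

lemma C1_near_continuous: "C1_near K f \<Longrightarrow> continuous_on K f"
  unfolding C1_near_def by (meson C1_on_continuous continuous_on_subset)

lemma pd_continuous: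
  assumes "C1_near K f" shows "continuous_on K (pd i f)"
proof -
  obtain W where W: "K \<subseteq> W" "C1_on W f (\<lambda>x. \<chi> i. pd i f x)" by (rule C1_nearE[OF assms])
  have "continuous_on W (\<lambda>x. (\<chi> i. pd i f x) $ i)"
    by (intro continuous_intros C1_on_gradient_continuous[OF W(2)])
  then show ?thesis using W(1) continuous_on_subset by auto
qed

text \<open>The slice at time \<open>t\<close> of the space-time neighbourhood is an open
  neighbourhood of the closed domain.\<close>

lemma smooth_field_C1_near:
  fixes u :: "real^'n::finite \<Rightarrow> real \<Rightarrow> real"
  assumes "smooth_field (Suc k) \<Omega> T u" and t: "t \<in> {0<..<T}"
  shows "C1_near (closure \<Omega>) (\<lambda>x. u x t)"
proof -
  obtain U where U: "closure \<Omega> \<times> {0<..<T} \<subseteq> U" "C1_on U (joint u) (stgrad u)"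
    by (rule smooth_field_SucE[OF assms(1)])
  define W where "W = (\<lambda>x. (x, t)) -` U"
  have "C1_on W (\<lambda>x. u x t) (\<lambda>x. grad u x t)"
    unfolding C1_on_def
  proof (intro conjI ballI)
    show "open W" unfolding W_def
      by (rule open_vimage[OF C1_on_open[OF U(2)]]) (intro continuous_intros)
    have "continuous_on W (\<lambda>x. fst (stgrad u (x, t)))"
      by (intro continuous_intros continuous_on_compose2[OF C1_on_gradient_continuous[OF U(2)]])
        (auto simp: W_def)
    then show "continuous_on W (\<lambda>x. grad u x t)" by (simp add: stgrad_def)
    fix x assume "x \<in> W"
    then have x: "(x, t) \<in> U" by (simp add: W_def)
    have "((\<lambda>x. (x, t)) has_derivative (\<lambda>h. (h, 0))) (at x)"
      by (auto intro!: derivative_eq_intros)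
    from has_derivative_compose[OF this C1_on_derivative[OF U(2) x]]
    show "((\<lambda>x. u x t) has_derivative (\<lambda>h. grad u x t \<bullet> h)) (at x)"
      by (simp add: joint_def stgrad_def inner_prod_def)
  qed
  moreover have "closure \<Omega> \<subseteq> W" using subsetD[OF U(1)] t by (auto simp: W_def)
  ultimately show ?thesis unfolding C1_near_def by blast
qed

section \<open>Integrals over the domain: divergence and differentiation in time\<close>

lemma sum_Basis_axis: "(\<Sum>b\<in>(Basis :: (real^'n::finite) set). f b) = (\<Sum>i\<in>UNIV. f (axis i 1))"
proof -
  have eq: "(Basis :: (real^'n) set) = (\<lambda>i. axis i 1) ` UNIV" by (auto simp: Basis_vec_def)
  have inj: "inj (\<lambda>i::'n. axis i (1::real))" by (auto simp: inj_on_def axis_eq_axis)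
  show ?thesis unfolding eq by (rule sum.reindex[OF inj, unfolded comp_def])
qed

lemma divergence_theorem_pd:
  fixes \<Omega> :: "(real^'n::finite) set"
  assumes dom: "lipschitz_domain \<Omega>"
    and C1: "\<And>i. C1_near (closure \<Omega>) (F i)"
    and tang: "\<And>y n. outward_normal \<Omega> y n \<Longrightarrow> (\<Sum>i\<in>UNIV. F i y * n $ i) = 0"
  shows "(\<integral>z. indicator \<Omega> z * (\<Sum>i\<in>UNIV. pd i (F i) z) \<partial>lborel) = 0"
proof -
  have "\<forall>i. \<exists>W. closure \<Omega> \<subseteq> W \<and> C1_on W (F i) (\<lambda>x. \<chi> k. pd k (F i) x)"
    using C1_nearE[OF C1] by metis
  then obtain W where W: "\<And>i. closure \<Omega> \<subseteq> W i" "\<And>i. C1_on (W i) (F i) (\<lambda>x. \<chi> k. pd k (F i) x)"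
    by metis
  define V where "V = (\<Inter>i. W i)"
  have V: "open V" "closure \<Omega> \<subseteq> V" "\<And>i. V \<subseteq> W i"
    unfolding V_def using W(1) C1_on_open[OF W(2)] by (auto intro: open_INT)
  let ?g = "\<lambda>i x. \<chi> k. pd k (F i) x"
  have "(\<integral>z. indicator \<Omega> z * (\<Sum>b\<in>Basis. ?g (axis_index b) z \<bullet> b) \<partial>lborel) = 0"
  proof (rule divergence_theorem_tangential[OF dom V(2), where F = "\<lambda>b. F (axis_index b)"])
    show "C1_on V (F (axis_index b)) (?g (axis_index b))" for b
      by (rule C1_on_subset[OF W(2) V(1,3)])
    show "(\<Sum>b\<in>Basis. F (axis_index b) y * (n \<bullet> b)) = 0" if "outward_normal \<Omega> y n" for y n
      using tang[OF that] by (simp add: sum_Basis_axis axis_index_axis inner_axis)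
  qed
  then show ?thesis by (simp add: sum_Basis_axis axis_index_axis inner_axis)
qed

text \<open>The energy is written with the Henstock-Kurzweil \<open>integral\<close>, whereas
  dominated convergence and the divergence theorem use Lebesgue integrals with an indicator; for
  integrands continuous up to the boundary both agree.\<close>

lemma integral_continuous_closure:
  fixes f :: "real^'n::finite \<Rightarrow> real"
  assumes "open \<Omega>" "bounded \<Omega>" "continuous_on (closure \<Omega>) f"
  shows "integrable lborel (\<lambda>z. indicator \<Omega> z * f z)" "f integrable_on \<Omega>"
    "integral \<Omega> f = (\<integral>z. indicator \<Omega> z * f z \<partial>lborel)"
proof -
  show i: "integrable lborel (\<lambda>z. indicator \<Omega> z * f z)"
    using assms closure_subset by (intro integrable_continuous_compact[of "closure \<Omega>"]) auto
  have *: "(\<lambda>z. indicator \<Omega> z * f z) = (\<lambda>z. if z \<in> \<Omega> then f z else 0)"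
    by (auto simp: indicator_def)
  have "(f has_integral (\<integral>z. indicator \<Omega> z * f z \<partial>lborel)) \<Omega>"
    using has_integral_integral_lborel[OF i] unfolding * by (simp only: has_integral_restrict_UNIV)
  then show "f integrable_on \<Omega>" "integral \<Omega> f = (\<integral>z. indicator \<Omega> z * f z \<partial>lborel)"
    by (auto simp: integral_unique)
qed

text \<open>On a compact slab of times around \<open>t\<close> the derivative \<open>e'\<close> is
  bounded up to the spatial boundary. By the mean value inequality this bound dominates the
  difference quotients on the bounded domain, so dominated convergence applies along every sequence
  of increments.\<close>

lemma leibniz_rule_bounded_domain:
  fixes e e' :: "real^'n::finite \<Rightarrow> real \<Rightarrow> real"
  assumes \<Omega>: "open \<Omega>" "bounded \<Omega>"
    and D: "\<And>x s. x \<in> \<Omega> \<Longrightarrow> s \<in> {0<..<T} \<Longrightarrow> ((\<lambda>s. e x s) has_real_derivative e' x s) (at s)"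
    and ce: "continuous_on (closure \<Omega> \<times> {0<..<T}) (joint e)"
    and ce': "continuous_on (closure \<Omega> \<times> {0<..<T}) (joint e')"
    and t: "t \<in> {0<..<T}"
  shows "((\<lambda>s. integral \<Omega> (\<lambda>x. e x s)) has_real_derivative integral \<Omega> (\<lambda>x. e' x t)) (at t)"
proof -
  have slice: "continuous_on (closure \<Omega>) (\<lambda>x. w x s)"
    if "continuous_on (closure \<Omega> \<times> {0<..<T}) (joint w)" "s \<in> {0<..<T}" for w :: "real^'n \<Rightarrow> real \<Rightarrow> real" and s
  proof -
    have "continuous_on (closure \<Omega>) (\<lambda>x. joint w (x, s))"
      by (intro continuous_on_compose2[OF that(1)] continuous_intros) (use that(2) in auto)
    then show ?thesis by (simp add: joint_def)
  qed
  note I = integral_continuous_closure[OF \<Omega> slice[OF ce]]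
  note I' = integral_continuous_closure[OF \<Omega> slice[OF ce' t]]
  \<comment> \<open>Half the distance to the ends of the time interval keeps the closed slab inside
    it, since nothing is known at times 0 and \<open>T\<close>.\<close>
  define \<delta> where "\<delta> = min t (T - t) / 2"
  have "\<delta> > 0" "\<delta> < t" "\<delta> < T - t" using t by (auto simp: \<delta>_def min_def)
  then have \<delta>: "\<delta> > 0" "\<And>s. \<bar>s - t\<bar> \<le> \<delta> \<Longrightarrow> s \<in> {0<..<T}" by auto
  have "compact (joint e' ` (closure \<Omega> \<times> {t - \<delta>..t + \<delta>}))"
    by (intro compact_continuous_image continuous_on_subset[OF ce'] compact_Times)
      (use \<Omega> \<delta>(2) in \<open>auto simp: abs_le_iff\<close>)
  then obtain M where "\<forall>y\<in>joint e' ` (closure \<Omega> \<times> {t - \<delta>..t + \<delta>}). norm y \<le> M"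
    using compact_imp_bounded bounded_iff by metis
  then have M: "\<bar>joint e' z\<bar> \<le> M" if "z \<in> closure \<Omega> \<times> {t - \<delta>..t + \<delta>}" for z
    using that by (metis imageI real_norm_def)
  have Mb: "\<bar>e' x s\<bar> \<le> M" if "x \<in> \<Omega>" "\<bar>s - t\<bar> \<le> \<delta>" for x s
    using M[of "(x, s)"] that closure_subset[of \<Omega>] by (auto simp: joint_def abs_le_iff)
  have quot: "\<bar>(e x (t + h) - e x t) / h\<bar> \<le> M" if x: "x \<in> \<Omega>" and h: "\<bar>h\<bar> < \<delta>" "h \<noteq> 0" for x h
  proof -
    have "norm (e x (t + h) - e x t) \<le> M * norm (t + h - t)"
    proof (rule field_differentiable_bound[of "cball t \<delta>"])
      have st: "\<bar>s - t\<bar> \<le> \<delta>" if "s \<in> cball t \<delta>" for s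
        using that by (simp add: dist_real_def abs_minus_commute)
      show "((\<lambda>s. e x s) has_field_derivative e' x s) (at s within cball t \<delta>)" if "s \<in> cball t \<delta>" for s
        by (rule has_field_derivative_at_within[OF D[OF x \<delta>(2)[OF st[OF that]]]])
      show "norm (e' x s) \<le> M" if "s \<in> cball t \<delta>" for s
        using Mb[OF x st[OF that]] by (simp only: real_norm_def)
    qed (use h \<delta> in \<open>auto simp: dist_real_def\<close>)
    then show ?thesis using h by (simp add: abs_divide pos_divide_le_eq)
  qed
  \<comment> \<open>Restricting the increments to a ball makes the bound hold for every term of a
    sequence, not just eventually.\<close>
  have "((\<lambda>h. (integral \<Omega> (\<lambda>x. e x (t + h)) - integral \<Omega> (\<lambda>x. e x t)) / h) \<longlongrightarrow> integral \<Omega> (\<lambda>x. e' x t))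
      (at 0 within ball 0 \<delta>)"
    unfolding tendsto_at_iff_sequentially
  proof (intro allI impI)
    fix X :: "nat \<Rightarrow> real" assume X: "\<forall>i. X i \<in> ball 0 \<delta> - {0}" "X \<longlonglongrightarrow> 0"
    have Xi: "\<bar>X i\<bar> < \<delta>" "X i \<noteq> 0" for i using X(1) by (auto simp: dist_real_def)
    have Xt: "t + X i \<in> {0<..<T}" for i using Xi[of i] by (intro \<delta>(2)) auto
    have "(\<lambda>n. \<integral>x. indicator \<Omega> x * ((e x (t + X n) - e x t) / X n) \<partial>lborel)
      \<longlonglongrightarrow> (\<integral>x. indicator \<Omega> x * e' x t \<partial>lborel)"
    proof (rule integral_dominated_convergence[where w = "\<lambda>x. indicator \<Omega> x * M"])
      show "(\<lambda>x. indicator \<Omega> x * e' x t) \<in> borel_measurable lborel"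
        using I'(1) by (rule borel_measurable_integrable)
      show "(\<lambda>x. indicator \<Omega> x * ((e x (t + X n) - e x t) / X n)) \<in> borel_measurable lborel" for n
      proof -
        have "(\<lambda>x. (indicator \<Omega> x * e x (t + X n) - indicator \<Omega> x * e x t) / X n) \<in> borel_measurable lborel"
          by (intro borel_measurable_divide borel_measurable_diff borel_measurable_const
              borel_measurable_integrable[OF I(1)] Xt t)
        also have "(\<lambda>x. (indicator \<Omega> x * e x (t + X n) - indicator \<Omega> x * e x t) / X n)
            = (\<lambda>x. indicator \<Omega> x * ((e x (t + X n) - e x t) / X n))"
          by (auto simp: indicator_def)
        finally show ?thesis .
      qed
      show "integrable lborel (\<lambda>x. indicator \<Omega> x * M)"
        using \<Omega> by (intro integrable_mult_left integrable_real_indicator emeasure_bounded_finite) auto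
      show "AE x in lborel. (\<lambda>n. indicator \<Omega> x * ((e x (t + X n) - e x t) / X n)) \<longlonglongrightarrow> indicator \<Omega> x * e' x t"
      proof (intro AE_I2)
        fix x
        show "(\<lambda>n. indicator \<Omega> x * ((e x (t + X n) - e x t) / X n)) \<longlonglongrightarrow> indicator \<Omega> x * e' x t"
        proof (cases "x \<in> \<Omega>")
          case True
          have "((\<lambda>h. (e x (t + h) - e x t) / h) \<longlongrightarrow> e' x t) (at 0)"
            using D[OF True t] by (simp add: DERIV_def)
          moreover have "filterlim X (at 0) sequentially"
            using X(2) Xi(2) by (intro filterlim_atI) auto
          ultimately have "(\<lambda>n. (e x (t + X n) - e x t) / X n) \<longlonglongrightarrow> e' x t"
            by (rule filterlim_compose)
          then show ?thesis by (intro tendsto_mult tendsto_const)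
        qed simp
      qed
      show "AE x in lborel. norm (indicator \<Omega> x * ((e x (t + X n) - e x t) / X n)) \<le> indicator \<Omega> x * M" for n
      proof (intro AE_I2)
        fix x
        show "norm (indicator \<Omega> x * ((e x (t + X n) - e x t) / X n)) \<le> indicator \<Omega> x * M"
          using quot[of x, OF _ Xi(1,2)[of n]] by (cases "x \<in> \<Omega>") (simp_all add: indicator_def)
      qed
    qed
    moreover have "(\<integral>x. indicator \<Omega> x * ((e x (t + X n) - e x t) / X n) \<partial>lborel)
        = (integral \<Omega> (\<lambda>x. e x (t + X n)) - integral \<Omega> (\<lambda>x. e x t)) / X n" for n
    proof -
      have "(\<lambda>x. indicator \<Omega> x * ((e x (t + X n) - e x t) / X n))
          = (\<lambda>x. (indicator \<Omega> x * e x (t + X n) - indicator \<Omega> x * e x t) / X n)"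
        by (auto simp: indicator_def)
      then show ?thesis
        using I(1,3)[OF Xt] I(1,3)[OF t] by simp
    qed
    ultimately show "((\<lambda>h. (integral \<Omega> (\<lambda>x. e x (t + h)) - integral \<Omega> (\<lambda>x. e x t)) / h) \<circ> X)
        \<longlonglongrightarrow> integral \<Omega> (\<lambda>x. e' x t)"
      by (simp only: comp_def I'(3))
  qed
  moreover have "at 0 within ball 0 \<delta> = at (0::real)" using \<delta>(1) by (intro at_within_open) auto
  ultimately show ?thesis by (simp add: DERIV_def)
qed

text \<open>As a sum of squared positive parts the potential is visibly C1, and no derivatives have
  to be matched at \<open>s = 1\<close> and \<open>s = - 1\<close>.\<close>

lemma fpot_pos_squares:
  "fpot s = (max 0 (s - 1))\<^sup>2 + (max 0 (- s - 1))\<^sup>2 + (1/4) * (max 0 (1 - s\<^sup>2))\<^sup>2"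
proof -
  consider "s < - 1" | "- 1 \<le> s" "s \<le> 1" | "s > 1" by linarith
  then show ?thesis
  proof cases
    case 1
    then have "s\<^sup>2 > 1" using one_less_power[of "- s" 2] by simp
    with 1 show ?thesis by (simp add: fpot_def power2_eq_square algebra_simps)
  next
    case 2
    then have "s\<^sup>2 \<le> 1" by (simp add: abs_square_le_1 abs_le_iff)
    with 2 show ?thesis by (simp add: fpot_def power2_commute)
  next
    case 3
    then have "s\<^sup>2 > 1" using one_less_power[of s 2] by simp
    with 3 show ?thesis by (simp add: fpot_def)
  qed
qed

lemma fpot_has_real_derivative: "(fpot has_real_derivative deriv fpot s) (at s)"
  and continuous_deriv_fpot: "continuous_on UNIV (deriv fpot)"
proof -
  define d where "d s = 2 * max 0 (s - 1) - 2 * max 0 (- s - 1) - max 0 (1 - s\<^sup>2) * s" for s :: real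
  have "((\<lambda>s. (max 0 (s - 1))\<^sup>2 + (max 0 (- s - 1))\<^sup>2 + (1/4) * (max 0 (1 - s\<^sup>2))\<^sup>2)
      has_real_derivative d s) (at s)" for s
  proof -
    have 1: "((\<lambda>s. (max 0 (s - 1))\<^sup>2) has_real_derivative 2 * max 0 (s - 1) * 1) (at s)"
      by (rule DERIV_chain2[OF has_field_derivative_pos_square]) (auto intro!: derivative_eq_intros)
    have 2: "((\<lambda>s. (max 0 (- s - 1))\<^sup>2) has_real_derivative 2 * max 0 (- s - 1) * (- 1)) (at s)"
      by (rule DERIV_chain2[OF has_field_derivative_pos_square]) (auto intro!: derivative_eq_intros)
    have 3: "((\<lambda>s. (max 0 (1 - s\<^sup>2))\<^sup>2) has_real_derivative 2 * max 0 (1 - s\<^sup>2) * (- (2 * s))) (at s)"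
      by (rule DERIV_chain2[OF has_field_derivative_pos_square]) (auto intro!: derivative_eq_intros)
    show ?thesis
      using DERIV_add[OF DERIV_add[OF 1 2] DERIV_cmult[OF 3, of "1/4"]] by (simp add: d_def)
  qed
  then have D: "(fpot has_real_derivative d s) (at s)" for s
    by (simp only: fpot_pos_squares[symmetric])
  then have eq: "deriv fpot = d" by (intro ext DERIV_imp_deriv)
  show "(fpot has_real_derivative deriv fpot s) (at s)" unfolding eq by (rule D)
  show "continuous_on UNIV (deriv fpot)" unfolding eq d_def[abs_def] by (intro continuous_intros)
qed

section \<open>The energy balance\<close>

lemma rhohat_affine: "rhohat r1 r2 s = (1 + r2 / r1) / 2 + rhohat' r1 r2 * s"
proof -
  obtain R where R: "r2 / r1 = R" by simp
  show ?thesis unfolding rhohat_def rhohat'_def R by (simp add: field_simps)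
qed

lemma norm_power2_eq_sum: "(norm (x :: real^'n::finite))\<^sup>2 = (\<Sum>k\<in>UNIV. (x $ k)\<^sup>2)"
  unfolding power2_norm_eq_inner inner_vec_def by (simp add: power2_eq_square)

text \<open>The choice of \<open>alpha\<close> is exactly what makes the algebraic density satisfy the transport
  equation \<open>\<partial>\<^sub>t rhohat + v \<bullet> \<nabla>rhohat + rhohat div v = 0\<close>.\<close>
lemma rhohat_transport:
  assumes r: "r1 > 0" "r2 > 0"
    and phase: "a + phi * d = l"
    and div: "d = alpha_const r1 r2 * l"
  shows "rhohat' r1 r2 * a = - rhohat r1 r2 phi * d"
proof -
  have "alpha_const r1 r2 * (1 + r2 / r1) / 2 = - rhohat' r1 r2"
  proof -
    have 1: "1 + r2 / r1 = (r2 + r1) / r1" using r by (simp add: add_divide_distrib)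
    have "(r2 - r1) / (r2 + r1) * ((r2 + r1) / r1) = (r2 - r1) / r1" using r by simp
    also have "\<dots> = r2 / r1 - 1" using r by (simp add: diff_divide_distrib)
    finally show ?thesis unfolding alpha_const_def rhohat'_def 1[symmetric]
      by (simp add: diff_divide_distrib)
  qed
  then have "(1 + r2 / r1) / 2 * d = - rhohat' r1 r2 * l"
    unfolding div by (metis mult.assoc mult.commute times_divide_eq_right)
  moreover have "rhohat' r1 r2 * a = rhohat' r1 r2 * l - rhohat' r1 r2 * phi * d"
    using phase by (simp add: algebra_simps flip: phase)
  ultimately show ?thesis by (simp add: rhohat_affine algebra_simps)
qed

text \<open>Pure algebra between values at one point: \<open>d\<close> is div v, \<open>q\<close> is
  |v|^2, a prefix \<open>v\<close> marks the product of the velocity with a gradient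
  (\<open>vphi\<close>, \<open>vmu\<close>, \<open>vp\<close>, \<open>vrho\<close>) or with grad div
  v (\<open>vdg\<close>), the Laplacian of v (\<open>vlap\<close>) or its time derivative
  (\<open>vvt\<close>). \<open>conv\<close> is v tested against its own convection,
  \<open>pp\<close> is grad phi . grad dt phi, \<open>mm\<close> is |grad mu|^2, \<open>G\<close> is
  |grad v|^2 and \<open>yv\<close> the vertical velocity. The large parenthesis on the right is the
  expanded divergence of the flux.\<close>

lemma energy_balance_pointwise:
  fixes Pe Cn We Re Fr lam :: real
  assumes nz: "Pe \<noteq> 0" "Cn \<noteq> 0" "We \<noteq> 0" "Re \<noteq> 0" and r: "r1 > 0" "r2 > 0"
    and rh: "rh = rhohat r1 r2 phi" "rh > 0" and rh': "rh' = rhohat' r1 r2"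
    and phase: "phit + vphi + phi * d = (1 / Pe) * lapmu"
    and mu: "mu = (1 / Cn) * f' - Cn * lapphi - p / rh * rh'"
    and mom: "rho * (vvt + conv) = - (1 / We) * (vp + phi * vmu - p / rh * rh' * vphi)
        + (1 / Re) * (vlap + vdg + lam * vdg) - Fr * rh * yv"
    and div: "d = alpha_const r1 r2 / Pe * lapmu"
    and mass: "rhot + (rho * d + vrho) = 0"
  shows "(1/2) * (rhot * q + rho * (2 * vvt)) + 1 / (We * Cn) * (f' * phit) + Cn / (2 * We) * (2 * pp)
      + Fr * (rh' * phit) * y
    = ((- (1/2) * (rho * q) - 1 / We * (mu * phi) - 1 / We * p - Fr * (y * rh) + (lam + 1) / Re * d) * d
      + (- (1/2) * (rho * (2 * conv) + q * vrho) - 1 / We * (mu * vphi + phi * vmu) - 1 / We * vp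
          - Fr * (y * (rh' * vphi) + rh * yv) + (lam + 1) / Re * vdg)
      + Cn / We * (phit * lapphi + pp) + 1 / (Pe * We) * (mu * lapmu + mm) + 1 / Re * (vlap + G))
      - 1 / Re * G - (1 + lam) / Re * d\<^sup>2 - 1 / (Pe * We) * mm"
proof -
  \<comment> \<open>This is the pressure part of the chemical potential. The transport identity
    turns its product with the material derivative of phi into \<open>- p * d\<close>, which removes
    the quotient and completes v . grad p to a divergence.\<close>
  define c where "c = p / rh * rh'"
  have tr: "rh' * (phit + vphi) = - rh * d"
    unfolding rh rh' by (rule rhohat_transport[OF r, of _ _ _ "lapmu / Pe"])
      (use phase div in simp_all)
  have "c * (phit + vphi) = p / rh * (rh' * (phit + vphi))" by (simp add: c_def)
  also have "\<dots> = - p * d" unfolding tr using rh(2) by simp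
  finally have cp: "c * phit = - p * d - c * vphi" by (simp add: algebra_simps)
  have f': "f' = Cn * (mu + Cn * lapphi + c)" using mu nz(2) by (simp add: c_def)
  have lapmu: "lapmu = Pe * (phit + vphi + phi * d)" using phase nz(1) by simp
  have m: "rho * vvt = - (1 / We) * (vp + phi * vmu - c * vphi)
      + (1 / Re) * (vlap + vdg + lam * vdg) - Fr * rh * yv - rho * conv"
    using mom by (simp add: c_def algebra_simps)
  have rt: "rhot = - rho * d - vrho" using mass by simp
  have g: "rh' * phit = - rh * d - rh' * vphi" using tr by (simp add: algebra_simps)
  have "(1/2) * (rhot * q + rho * (2 * vvt)) = (1/2) * rhot * q + rho * vvt" by (simp add: algebra_simps)
  moreover have "1 / (We * Cn) * (f' * phit) = 1 / We * (mu * phit + Cn * (lapphi * phit) + c * phit)"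
    unfolding f' using nz by (simp add: field_simps)
  moreover have "Cn / (2 * We) * (2 * pp) = Cn / We * pp" using nz by simp
  moreover have "1 / (Pe * We) * (mu * lapmu + mm) = 1 / We * (mu * (phit + vphi + phi * d)) + 1 / (Pe * We) * mm"
    unfolding lapmu using nz by (simp add: field_simps)
  ultimately show ?thesis
    unfolding m rt g cp by (simp add: algebra_simps power2_eq_square add_divide_distrib diff_divide_distrib)
qed

theorem theorem1:
  fixes \<Omega> :: "(real^'n::finite) set"
    and vert :: 'n
    and T Pe Cn We Re Fr2inv lam rho1 rho2 :: real
    and phi mu p rho :: "real^'n \<Rightarrow> real \<Rightarrow> real"
    and v :: "real^'n \<Rightarrow> real \<Rightarrow> real^'n"
  assumes dim: "CARD('n) = 2 \<or> CARD('n) = 3"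
    and dom: "lipschitz_domain \<Omega>"
    and T: "T > 0"
    and params: "Pe > 0" "Cn > 0" "We > 0" "Re > 0" "Fr2inv \<ge> 0"
    and lam: "lam \<ge> - 2 / real CARD('n)"
    and dens: "rho1 > 0" "rho2 > 0"
    and smooth: "smooth_field 2 \<Omega> T phi" "smooth_field 2 \<Omega> T mu"
      "\<forall>k. smooth_field 2 \<Omega> T (vcomp v k)"
      "smooth_field 1 \<Omega> T p" "smooth_field 1 \<Omega> T rho"
    and eq_phi: "\<forall>x\<in>\<Omega>. \<forall>t\<in>{0<..<T}.
        dt phi x t + v x t \<bullet> grad phi x t + phi x t * divg v x t = (1 / Pe) * lap mu x t"
    and eq_mu: "\<forall>x\<in>\<Omega>. \<forall>t\<in>{0<..<T}.
        mu x t = (1 / Cn) * deriv fpot (phi x t) - Cn * lap phi x t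
                 - p x t / rhohat rho1 rho2 (phi x t) * rhohat' rho1 rho2"
    and eq_v: "\<forall>x\<in>\<Omega>. \<forall>t\<in>{0<..<T}. \<forall>k.
        rho x t * (dt (vcomp v k) x t + (\<Sum>i\<in>UNIV. v x t $ i * dx i (vcomp v k) x t))
        = - (1 / We) * (dx k p x t + phi x t * dx k mu x t
                        - p x t / rhohat rho1 rho2 (phi x t) * rhohat' rho1 rho2 * dx k phi x t)
          + (1 / Re) * ((\<Sum>i\<in>UNIV. dx i (\<lambda>y s. dx i (vcomp v k) y s + dx k (vcomp v i) y s) x t)
                        + lam * dx k (divg v) x t)
          - Fr2inv * rhohat rho1 rho2 (phi x t) * (axis vert 1 :: real^'n) $ k"
    and eq_div: "\<forall>x\<in>\<Omega>. \<forall>t\<in>{0<..<T}.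
        divg v x t = alpha_const rho1 rho2 / Pe * lap mu x t"
    and eq_rho: "\<forall>x\<in>\<Omega>. \<forall>t\<in>{0<..<T}.
        dt rho x t + divg (\<lambda>y s. rho y s *\<^sub>R v y s) x t = 0"
    and bc_v: "\<forall>x\<in>frontier \<Omega>. \<forall>t\<in>{0<..<T}. v x t = 0"
    and bc_neumann: "\<forall>x n. outward_normal \<Omega> x n \<longrightarrow> (\<forall>t\<in>{0<..<T}.
        grad phi x t \<bullet> n = 0 \<and> grad mu x t \<bullet> n = 0)"
    and pos: "\<forall>x\<in>\<Omega>. \<forall>t\<in>{0<..<T}. rho x t > 0 \<and> rhohat rho1 rho2 (phi x t) > 0"
  shows "\<forall>t\<in>{0<..<T}.
     ((\<lambda>s. integral \<Omega> (\<lambda>x. (1/2) * rho x s * (norm (v x s))^2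
                            + 1 / (We * Cn) * fpot (phi x s)
                            + Cn / (2 * We) * (norm (grad phi x s))^2
                            + Fr2inv * rhohat rho1 rho2 (phi x s) * x $ vert))
      has_real_derivative
        (- (1 / Re) * integral \<Omega> (\<lambda>x. \<Sum>i\<in>UNIV. \<Sum>k\<in>UNIV. (dx i (vcomp v k) x t)^2)
         - (1 + lam) / Re * integral \<Omega> (\<lambda>x. (divg v x t)^2)
         - 1 / (Pe * We) * integral \<Omega> (\<lambda>x. (norm (grad mu x t))^2))) (at t)
     \<and> - (1 / Re) * integral \<Omega> (\<lambda>x. \<Sum>i\<in>UNIV. \<Sum>k\<in>UNIV. (dx i (vcomp v k) x t)^2)
         - (1 + lam) / Re * integral \<Omega> (\<lambda>x. (divg v x t)^2)
         - 1 / (Pe * We) * integral \<Omega> (\<lambda>x. (norm (grad mu x t))^2) \<le> 0"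
proof -
  let ?KT = "closure \<Omega> \<times> {0<..<T}"
  have \<Omega>: "open \<Omega>" "bounded \<Omega>" using dom by (auto simp: lipschitz_domain_def)
  have sub: "\<Omega> \<subseteq> closure \<Omega>" by (rule closure_subset)
  have phi2: "smooth_field (Suc 1) \<Omega> T phi" and mu2: "smooth_field (Suc 1) \<Omega> T mu"
    and v2: "smooth_field (Suc 1) \<Omega> T (vcomp v k)" for k
    using smooth by (simp_all add: numeral_2_eq_2)
  have p1: "smooth_field (Suc 0) \<Omega> T p" and rho1': "smooth_field (Suc 0) \<Omega> T rho"
    using smooth by simp_all
  have dphi: "smooth_field (Suc 0) \<Omega> T (dx i phi)" and dtphi: "smooth_field (Suc 0) \<Omega> T (dt phi)"
    and dmu: "smooth_field (Suc 0) \<Omega> T (dx i mu)"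
    and dv: "smooth_field (Suc 0) \<Omega> T (dx i (vcomp v k))" for i k
    using smooth_field_dx_dt[OF phi2] smooth_field_dx_dt[OF mu2] smooth_field_dx_dt[OF v2] by simp_all
  define e where "e = (\<lambda>x s. (1/2) * rho x s * (norm (v x s))^2
                            + 1 / (We * Cn) * fpot (phi x s)
                            + Cn / (2 * We) * (norm (grad phi x s))^2
                            + Fr2inv * rhohat rho1 rho2 (phi x s) * x $ vert)"
  define e' where "e' = (\<lambda>x s. (1/2) * (dt rho x s * (\<Sum>k\<in>UNIV. (vcomp v k x s)\<^sup>2)
          + rho x s * (2 * (\<Sum>k\<in>UNIV. vcomp v k x s * dt (vcomp v k) x s)))
      + 1 / (We * Cn) * (deriv fpot (phi x s) * dt phi x s)
      + Cn / (2 * We) * (2 * (\<Sum>i\<in>UNIV. dx i phi x s * dt (dx i phi) x s))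
      + Fr2inv * (rhohat' rho1 rho2 * dt phi x s) * x $ vert)"
  \<comment> \<open>Norms become sums over components and \<open>rhohat\<close> its affine form, so
    that only polynomial rules and the chain rule for \<open>fpot\<close> remain.\<close>
  have e_eq: "e x s = (1/2) * (rho x s * (\<Sum>k\<in>UNIV. (vcomp v k x s)\<^sup>2))
      + 1 / (We * Cn) * fpot (phi x s) + Cn / (2 * We) * (\<Sum>i\<in>UNIV. (dx i phi x s)\<^sup>2)
      + Fr2inv * ((1 + rho2 / rho1) / 2 + rhohat' rho1 rho2 * phi x s) * x $ vert" for x s
    by (simp add: e_def norm_power2_eq_sum vcomp_def grad_def rhohat_affine)
  have De: "((\<lambda>s. e x s) has_real_derivative e' x s) (at s)" if x: "x \<in> \<Omega>" and s: "s \<in> {0<..<T}" for x s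
  proof -
    have xc: "x \<in> closure \<Omega>" using x sub by blast
    note d = smooth_field_dt[OF phi2 xc s] smooth_field_dt[OF rho1' xc s] smooth_field_dt[OF v2 xc s]
      smooth_field_dt[OF dphi xc s] DERIV_chain2[OF fpot_has_real_derivative smooth_field_dt[OF phi2 xc s]]
    have v2d: "((\<lambda>s. \<Sum>k\<in>UNIV. (vcomp v k x s)\<^sup>2) has_real_derivative
        2 * (\<Sum>k\<in>UNIV. vcomp v k x s * dt (vcomp v k) x s)) (at s)"
      unfolding sum_distrib_left
      by (intro DERIV_sum) (auto intro!: derivative_eq_intros d)
    have g2d: "((\<lambda>s. \<Sum>i\<in>UNIV. (dx i phi x s)\<^sup>2) has_real_derivative
        2 * (\<Sum>i\<in>UNIV. dx i phi x s * dt (dx i phi) x s)) (at s)"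
      unfolding sum_distrib_left
      by (intro DERIV_sum) (auto intro!: derivative_eq_intros d)
    have A: "((\<lambda>s. (1/2) * (rho x s * (\<Sum>k\<in>UNIV. (vcomp v k x s)\<^sup>2))) has_real_derivative
       (1/2) * (dt rho x s * (\<Sum>k\<in>UNIV. (vcomp v k x s)\<^sup>2)
          + (2 * (\<Sum>k\<in>UNIV. vcomp v k x s * dt (vcomp v k) x s)) * rho x s)) (at s)"
      by (intro DERIV_cmult DERIV_mult d v2d)
    have B: "((\<lambda>s. Fr2inv * ((1 + rho2 / rho1) / 2 + rhohat' rho1 rho2 * phi x s) * x $ vert) has_real_derivative
       Fr2inv * (0 + rhohat' rho1 rho2 * dt phi x s) * x $ vert) (at s)"
      by (intro DERIV_cmult_right DERIV_cmult DERIV_add DERIV_const d)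
    have "((\<lambda>s. (1/2) * (rho x s * (\<Sum>k\<in>UNIV. (vcomp v k x s)\<^sup>2))
      + 1 / (We * Cn) * fpot (phi x s) + Cn / (2 * We) * (\<Sum>i\<in>UNIV. (dx i phi x s)\<^sup>2)
      + Fr2inv * ((1 + rho2 / rho1) / 2 + rhohat' rho1 rho2 * phi x s) * x $ vert) has_real_derivative e' x s) (at s)"
      using DERIV_add[OF DERIV_add[OF DERIV_add[OF A DERIV_cmult[OF d(5)]] DERIV_cmult[OF g2d]] B]
      by (simp only: e'_def mult.commute[of _ "rho x s"] add_0_left)
    then show ?thesis by (simp only: e_eq)
  qed
  have cj: "continuous_on ?KT (\<lambda>z. w (fst z) (snd z))" if "smooth_field k \<Omega> T w" for k w
    using smooth_field_continuous[OF that] by (simp add: joint_def)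
  note cjs = cj[OF phi2] cj[OF rho1'] cj[OF v2] cj[OF dphi] cj[OF dtphi]
    cj[OF smooth_field_dx_dt(2)[OF rho1']] cj[OF smooth_field_dx_dt(2)[OF v2]]
    cj[OF smooth_field_dx_dt(2)[OF dphi]]
  have fc: "continuous_on UNIV fpot"
    using fpot_has_real_derivative by (meson DERIV_isCont continuous_at_imp_continuous_on)
  have ce: "continuous_on ?KT (joint e)"
    unfolding joint_def e_eq
    by (intro continuous_intros cjs continuous_on_compose2[OF fc cjs(1)]) auto
  have ce': "continuous_on ?KT (joint e')"
    unfolding joint_def e'_def
    by (intro continuous_intros cjs continuous_on_compose2[OF continuous_deriv_fpot cjs(1)]) auto
  define rate where "rate = (\<lambda>t. - (1 / Re) * integral \<Omega> (\<lambda>x. \<Sum>i\<in>UNIV. \<Sum>k\<in>UNIV. (dx i (vcomp v k) x t)^2)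
         - (1 + lam) / Re * integral \<Omega> (\<lambda>x. (divg v x t)^2)
         - 1 / (Pe * We) * integral \<Omega> (\<lambda>x. (norm (grad mu x t))^2))"
  have "\<forall>t\<in>{0<..<T}. ((\<lambda>s. integral \<Omega> (\<lambda>x. e x s)) has_real_derivative rate t) (at t) \<and> rate t \<le> 0"
  proof (intro ballI conjI)
    fix t assume t: "t \<in> {0<..<T}"
    let ?K = "closure \<Omega>"
    define R where "R = (\<lambda>y. rho y t)"
    define V where "V = (\<lambda>k y. v y t $ k)"
    define P where "P = (\<lambda>y. p y t)"
    define M where "M = (\<lambda>y. mu y t)"
    define \<Phi> where "\<Phi> = (\<lambda>y. phi y t)"
    define \<Phi>t where "\<Phi>t = (\<lambda>y. dt phi y t)"
    define g\<Phi> where "g\<Phi> = (\<lambda>i y. dx i phi y t)"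
    define gM where "gM = (\<lambda>i y. dx i mu y t)"
    define gV where "gV = (\<lambda>i k y. dx i (vcomp v k) y t)"
    define Dv where "Dv = (\<lambda>y. divg v y t)"
    have Dv_eq: "Dv = (\<lambda>y. \<Sum>i\<in>UNIV. gV i i y)" by (simp add: Dv_def divg_def gV_def)
    have C: "C1_near ?K R" "C1_near ?K (V k)" "C1_near ?K P" "C1_near ?K M" "C1_near ?K \<Phi>"
      "C1_near ?K \<Phi>t" "C1_near ?K (g\<Phi> i)" "C1_near ?K (gM i)" "C1_near ?K (gV i k)" for i k
      unfolding R_def V_def P_def M_def \<Phi>_def \<Phi>t_def g\<Phi>_def gM_def gV_def
      using smooth_field_C1_near[OF rho1' t] smooth_field_C1_near[OF v2 t, of k] smooth_field_C1_near[OF p1 t]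
        smooth_field_C1_near[OF mu2 t] smooth_field_C1_near[OF phi2 t] smooth_field_C1_near[OF dtphi t]
        smooth_field_C1_near[OF dphi t] smooth_field_C1_near[OF dmu t] smooth_field_C1_near[OF dv t]
      by (simp_all add: vcomp_def)
    have CD: "C1_near ?K Dv" unfolding Dv_eq by (intro C1_near_sum C)
    have pd\<Phi>: "pd i \<Phi> = g\<Phi> i" and pdM: "pd i M = gM i" and pdV: "pd i (V k) = gV i k" for i k
      by (auto simp: fun_eq_iff \<Phi>_def g\<Phi>_def M_def gM_def V_def gV_def dx_eq_pd vcomp_def)
    \<comment> \<open>The coefficient of v in the flux collects kinetic energy, advected mu phi,
      pressure and gravitational potential with a minus sign; the last term is the part of the
      viscous work involving grad div v, with one unit of \<open>lam + 1\<close> coming from the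
      symmetric gradient.\<close>
    define a where "a = (\<lambda>y. - (1/2) * (R y * (\<Sum>k\<in>UNIV. (V k y)\<^sup>2)) - 1 / We * (M y * \<Phi> y) - 1 / We * P y
        - Fr2inv * (y $ vert * ((1 + rho2 / rho1) / 2 + rhohat' rho1 rho2 * \<Phi> y)) + (lam + 1) / Re * Dv y)"
    \<comment> \<open>Besides transport by v, the flux contains dt phi grad phi from the gradient
      energy, mu grad mu from diffusion, and the sum of v_k grad v_k from viscosity.\<close>
    define F where "F = (\<lambda>i y. a y * V i y + Cn / We * (\<Phi>t y * g\<Phi> i y) + 1 / (Pe * We) * (M y * gM i y)
        + 1 / Re * (\<Sum>k\<in>UNIV. V k y * gV i k y))"
    have Ca: "C1_near ?K a" unfolding a_def
      by (intro C1_near_add C1_near_diff C1_near_mult C1_near_const C1_near_component C1_near_sum C1_near_power2 C CD)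
    have CF: "C1_near ?K (F i)" for i unfolding F_def
      by (intro C1_near_add C1_near_mult C1_near_const C1_near_sum C Ca)
    have div0: "(\<integral>x. indicator \<Omega> x * (\<Sum>i\<in>UNIV. pd i (F i) x) \<partial>lborel) = 0"
    proof (rule divergence_theorem_pd[OF dom CF])
      fix y n assume n: "outward_normal \<Omega> y n"
      then have "y \<in> frontier \<Omega>" by (simp add: outward_normal_def)
      then have V0: "V k y = 0" for k using bc_v t by (simp add: V_def)
      have "(\<Sum>i\<in>UNIV. g\<Phi> i y * n $ i) = 0" "(\<Sum>i\<in>UNIV. gM i y * n $ i) = 0"
        using bc_neumann[rule_format, OF n t] by (simp_all add: inner_vec_def grad_def g\<Phi>_def gM_def)
      moreover have "(\<Sum>i\<in>UNIV. F i y * n $ i) = Cn / We * \<Phi>t y * (\<Sum>i\<in>UNIV. g\<Phi> i y * n $ i)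
          + 1 / (Pe * We) * M y * (\<Sum>i\<in>UNIV. gM i y * n $ i)"
        by (simp add: F_def V0 sum_distrib_left sum.distrib[symmetric] algebra_simps)
      ultimately show "(\<Sum>i\<in>UNIV. F i y * n $ i) = 0" by simp
    qed
    define G where "G = (\<lambda>x. \<Sum>i\<in>UNIV. \<Sum>k\<in>UNIV. (gV i k x)\<^sup>2)"
    define MM where "MM = (\<lambda>x. \<Sum>i\<in>UNIV. (gM i x)\<^sup>2)"
    have pointwise: "e' x t = (\<Sum>i\<in>UNIV. pd i (F i) x) - 1 / Re * G x - (1 + lam) / Re * (Dv x)\<^sup>2
        - 1 / (Pe * We) * MM x" if x: "x \<in> \<Omega>" for x
    proof -
      have xc: "x \<in> ?K" using x sub by blast
      define rh where "rh = rhohat rho1 rho2 (\<Phi> x)"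
      define rh' where "rh' = rhohat' rho1 rho2"
      define q where "q = (\<Sum>k\<in>UNIV. (V k x)\<^sup>2)"
      define vphi where "vphi = (\<Sum>i\<in>UNIV. V i x * g\<Phi> i x)"
      define vmu where "vmu = (\<Sum>i\<in>UNIV. V i x * gM i x)"
      define vp where "vp = (\<Sum>i\<in>UNIV. V i x * pd i P x)"
      define vrho where "vrho = (\<Sum>i\<in>UNIV. V i x * pd i R x)"
      define vdg where "vdg = (\<Sum>i\<in>UNIV. V i x * pd i Dv x)"
      define conv where "conv = (\<Sum>i\<in>UNIV. V i x * (\<Sum>k\<in>UNIV. V k x * gV i k x))"
      define vvt where "vvt = (\<Sum>k\<in>UNIV. V k x * dt (vcomp v k) x t)"
      define lapV where "lapV k = (\<Sum>i\<in>UNIV. pd i (gV i k) x)" for k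
      define vlap where "vlap = (\<Sum>k\<in>UNIV. V k x * lapV k)"
      define pp where "pp = (\<Sum>i\<in>UNIV. g\<Phi> i x * pd i \<Phi>t x)"
      define lapphi where "lapphi = (\<Sum>i\<in>UNIV. pd i (g\<Phi> i) x)"
      define lapmu where "lapmu = (\<Sum>i\<in>UNIV. pd i (gM i) x)"
      have lapphi: "lap phi x t = lapphi" and lapmu: "lap mu x t = lapmu"
        by (simp_all add: lap_def lapphi_def lapmu_def g\<Phi>_def gM_def dx_eq_pd)
      have Dvx: "Dv x = (\<Sum>i\<in>UNIV. gV i i x)" by (simp add: Dv_eq)
      have phase: "\<Phi>t x + vphi + \<Phi> x * Dv x = (1 / Pe) * lapmu"
        using eq_phi x t unfolding lapmu[symmetric]
        by (simp add: \<Phi>t_def vphi_def \<Phi>_def Dv_def inner_vec_def grad_def V_def g\<Phi>_def)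
      have mueq: "M x = (1 / Cn) * deriv fpot (\<Phi> x) - Cn * lapphi - P x / rh * rh'"
        using eq_mu x t unfolding lapphi[symmetric] by (simp add: M_def \<Phi>_def P_def rh_def rh'_def)
      have div: "Dv x = alpha_const rho1 rho2 / Pe * lapmu"
        using eq_div x t unfolding lapmu[symmetric] by (simp add: Dv_def)
      have mass: "dt rho x t + (R x * Dv x + vrho) = 0"
      proof -
        have "divg (\<lambda>y s. rho y s *\<^sub>R v y s) x t = (\<Sum>i\<in>UNIV. pd i (\<lambda>y. R y * V i y) x)"
          by (simp add: divg_def dx_eq_pd vcomp_def R_def V_def)
        also have "\<dots> = (\<Sum>i\<in>UNIV. R x * gV i i x + V i x * pd i R x)"
          by (simp add: pd_mult[OF xc C(1,2)] pdV)
        also have "\<dots> = R x * Dv x + vrho"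
          by (simp add: Dvx vrho_def sum.distrib sum_distrib_left)
        finally show ?thesis using eq_rho[rule_format, OF x t] by (simp only:)
      qed
      \<comment> \<open>The symmetric part contributes the Laplacian of the component plus, by
        exchange of derivatives, a derivative of div v; this is where the extra dissipation of div v
        originates.\<close>
      have visc: "(\<Sum>i\<in>UNIV. dx i (\<lambda>y s. dx i (vcomp v k) y s + dx k (vcomp v i) y s) x t)
          = lapV k + pd k Dv x" for k
      proof -
        have "dx i (\<lambda>y s. dx i (vcomp v k) y s + dx k (vcomp v i) y s) x t
            = pd i (gV i k) x + pd k (gV i i) x" for i
        proof -
          have "dx i (\<lambda>y s. dx i (vcomp v k) y s + dx k (vcomp v i) y s) x t
              = pd i (\<lambda>y. gV i k y + gV k i y) x"
            by (simp only: dx_def pd_def gV_def)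
          also have "\<dots> = pd i (gV i k) x + pd i (gV k i) x" by (rule pd_add[OF xc C(9) C(9)])
          also have "pd i (gV k i) x = dx i (dx k (vcomp v i)) x t"
            by (simp only: dx_def[of i "dx k (vcomp v i)"] pd_def gV_def)
          also have "\<dots> = dx k (dx i (vcomp v i)) x t"
            by (rule smooth_field_mixed(1)[OF _ xc t]) (use smooth in blast)
          also have "\<dots> = pd k (gV i i) x"
            by (simp only: dx_def[of k "dx i (vcomp v i)"] pd_def gV_def)
          finally show ?thesis .
        qed
        then show ?thesis
          by (simp add: sum.distrib lapV_def Dv_eq pd_sum[OF xc C(9)])
      qed
      \<comment> \<open>The componentwise equations are multiplied by the velocity components and
        summed.\<close>
      have mom: "R x * (vvt + conv) = - (1 / We) * (vp + \<Phi> x * vmu - P x / rh * rh' * vphi)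
        + (1 / Re) * (vlap + vdg + lam * vdg) - Fr2inv * rh * V vert x"
      proof -
        have eqk: "R x * (dt (vcomp v k) x t + (\<Sum>i\<in>UNIV. V i x * gV i k x))
          = - (1 / We) * (pd k P x + \<Phi> x * gM k x - P x / rh * rh' * g\<Phi> k x)
          + (1 / Re) * (lapV k + pd k Dv x + lam * pd k Dv x)
          - Fr2inv * rh * (if k = vert then 1 else 0)" for k
          using eq_v[rule_format, OF x t, of k] unfolding visc
          by (simp add: R_def V_def gV_def P_def \<Phi>_def gM_def g\<Phi>_def rh_def rh'_def Dv_def dx_def[of k p]
              dx_def[of k "divg v"] pd_def axis_def)
        have "R x * (vvt + conv) = (\<Sum>k\<in>UNIV. V k x * (R x * (dt (vcomp v k) x t + (\<Sum>i\<in>UNIV. V i x * gV i k x))))"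
        proof -
          have "conv = (\<Sum>k\<in>UNIV. V k x * (\<Sum>i\<in>UNIV. V i x * gV i k x))"
            unfolding conv_def sum_distrib_left by (subst sum.swap) (simp add: mult_ac)
          then show ?thesis
            by (simp only: vvt_def sum.distrib[symmetric] sum_distrib_left[of "R x"])
              (intro sum.cong refl, simp add: algebra_simps)
        qed
        also have "\<dots> = - (1 / We) * (vp + \<Phi> x * vmu - P x / rh * rh' * vphi)
          + (1 / Re) * (vlap + vdg + lam * vdg) - Fr2inv * rh * (\<Sum>k\<in>UNIV. V k x * (if k = vert then 1 else 0))"
          unfolding eqk vp_def vmu_def vphi_def vlap_def vdg_def
          unfolding sum_distrib_left sum.distrib[symmetric] sum_subtractf[symmetric]
          by (intro sum.cong refl) (simp add: algebra_simps)
        also have "(\<Sum>k\<in>UNIV. V k x * (if k = vert then 1 else 0)) = V vert x"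
          by (simp add: if_distrib cong: if_cong)
        finally show ?thesis .
      qed
      have rhpos: "rh > 0" using pos x t by (simp add: rh_def \<Phi>_def)
      have ax: "a x = - (1/2) * (R x * q) - 1 / We * (M x * \<Phi> x) - 1 / We * P x - Fr2inv * (x $ vert * rh)
          + (lam + 1) / Re * Dv x"
        by (simp add: a_def q_def rh_def rhohat_affine)
      have pda: "pd i a x = - (1/2) * (R x * (\<Sum>k\<in>UNIV. 2 * (V k x * gV i k x)) + q * pd i R x)
          - 1 / We * (M x * g\<Phi> i x + \<Phi> x * gM i x) - 1 / We * pd i P x
          - Fr2inv * (x $ vert * (rh' * g\<Phi> i x) + rh * (if i = vert then 1 else 0)) + (lam + 1) / Re * pd i Dv x" for i
      proof -
        note ci = C1_near_add C1_near_diff C1_near_mult C1_near_const C1_near_component C1_near_sum C1_near_power2 C CD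
        have 1: "pd i (\<lambda>y. - (1/2) * (R y * (\<Sum>k\<in>UNIV. (V k y)\<^sup>2))) x
          = - (1/2) * (R x * (\<Sum>k\<in>UNIV. 2 * (V k x * gV i k x)) + q * pd i R x)"
        proof -
          have "pd i (\<lambda>y. \<Sum>k\<in>UNIV. (V k y)\<^sup>2) x = (\<Sum>k\<in>UNIV. 2 * (V k x * gV i k x))"
            by (subst pd_sum[OF xc]) (auto intro!: ci simp: pd_power2[OF xc C(2)] pdV)
          then show ?thesis
            by (subst pd_mult[OF xc], (intro ci)+, subst pd_mult[OF xc], (intro ci)+)
              (simp add: pd_const q_def)
        qed
        have 2: "pd i (\<lambda>y. 1 / We * (M y * \<Phi> y)) x = 1 / We * (M x * g\<Phi> i x + \<Phi> x * gM i x)"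
          by (subst pd_mult[OF xc], (intro ci)+, subst pd_mult[OF xc], (intro ci)+)
            (simp add: pd_const pd\<Phi> pdM)
        have 3: "pd i (\<lambda>y. 1 / We * P y) x = 1 / We * pd i P x"
          by (subst pd_mult[OF xc], (intro ci)+) (simp add: pd_const)
        have 4: "pd i (\<lambda>y. Fr2inv * (y $ vert * ((1 + rho2 / rho1) / 2 + rhohat' rho1 rho2 * \<Phi> y))) x
          = Fr2inv * (x $ vert * (rh' * g\<Phi> i x) + rh * (if i = vert then 1 else 0))"
        proof -
          have "pd i (\<lambda>y. rhohat' rho1 rho2 * \<Phi> y) x = rh' * g\<Phi> i x"
            by (subst pd_mult[OF xc], (intro ci)+) (simp add: pd_const pd\<Phi> rh'_def)
          then have "pd i (\<lambda>y. (1 + rho2 / rho1) / 2 + rhohat' rho1 rho2 * \<Phi> y) x = rh' * g\<Phi> i x"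
            by (subst pd_add[OF xc], (intro ci)+) (simp add: pd_const)
          then show ?thesis
            by (subst pd_mult[OF xc], (intro ci)+, subst pd_mult[OF xc], (intro ci)+)
              (simp add: pd_const pd_component rh_def rhohat_affine)
        qed
        have 5: "pd i (\<lambda>y. (lam + 1) / Re * Dv y) x = (lam + 1) / Re * pd i Dv x"
          by (subst pd_mult[OF xc], (intro ci)+) (simp add: pd_const)
        show ?thesis unfolding a_def
          by (subst pd_add[OF xc], (intro ci)+, subst pd_diff[OF xc], (intro ci)+,
              subst pd_diff[OF xc], (intro ci)+, subst pd_diff[OF xc], (intro ci)+)
            (simp only: 1 2 3 4 5)
      qed
      have pdF: "pd i (F i) x = (a x * gV i i x + V i x * pd i a x)
          + Cn / We * (\<Phi>t x * pd i (g\<Phi> i) x + g\<Phi> i x * pd i \<Phi>t x)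
          + 1 / (Pe * We) * (M x * pd i (gM i) x + gM i x * gM i x)
          + 1 / Re * (\<Sum>k\<in>UNIV. V k x * pd i (gV i k) x + gV i k x * gV i k x)" for i
      proof -
        note ci = C1_near_add C1_near_mult C1_near_const C1_near_sum C Ca
        have 1: "pd i (\<lambda>y. a y * V i y) x = a x * gV i i x + V i x * pd i a x"
          by (simp add: pd_mult[OF xc Ca C(2)] pdV)
        have 2: "pd i (\<lambda>y. Cn / We * (\<Phi>t y * g\<Phi> i y)) x
            = Cn / We * (\<Phi>t x * pd i (g\<Phi> i) x + g\<Phi> i x * pd i \<Phi>t x)"
          by (subst pd_mult[OF xc], (intro ci)+, subst pd_mult[OF xc], (intro ci)+) (simp add: pd_const)
        have 3: "pd i (\<lambda>y. 1 / (Pe * We) * (M y * gM i y)) x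
            = 1 / (Pe * We) * (M x * pd i (gM i) x + gM i x * gM i x)"
          by (subst pd_mult[OF xc], (intro ci)+, subst pd_mult[OF xc], (intro ci)+) (simp add: pd_const pdM)
        have "pd i (\<lambda>y. \<Sum>k\<in>UNIV. V k y * gV i k y) x
            = (\<Sum>k\<in>UNIV. V k x * pd i (gV i k) x + gV i k x * gV i k x)"
          by (subst pd_sum[OF xc]) (auto intro!: ci simp: pd_mult[OF xc C(2) C(9)] pdV)
        then have 4: "pd i (\<lambda>y. 1 / Re * (\<Sum>k\<in>UNIV. V k y * gV i k y)) x
            = 1 / Re * (\<Sum>k\<in>UNIV. V k x * pd i (gV i k) x + gV i k x * gV i k x)"
          by (subst pd_mult[OF xc], (intro ci)+) (simp add: pd_const)
        show ?thesis unfolding F_def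
          by (subst pd_add[OF xc], (intro ci)+, subst pd_add[OF xc], (intro ci)+,
              subst pd_add[OF xc], (intro ci)+) (simp only: 1 2 3 4)
      qed
      have Sa: "(\<Sum>i\<in>UNIV. V i x * pd i a x) = - (1/2) * (R x * (2 * conv) + q * vrho)
          - 1 / We * (M x * vphi + \<Phi> x * vmu) - 1 / We * vp
          - Fr2inv * (x $ vert * (rh' * vphi) + rh * V vert x) + (lam + 1) / Re * vdg"
      proof -
        \<comment> \<open>Writing the vertical component as a sum over all \<open>i\<close> allows
          both sides to be merged into one sum and compared termwise.\<close>
        have y: "V vert x = (\<Sum>i\<in>UNIV. V i x * (if i = vert then 1 else 0))"
          by (simp add: if_distrib cong: if_cong)
        show ?thesis
          unfolding pda y conv_def vrho_def vphi_def vmu_def vp_def vdg_def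
          unfolding sum_distrib_left sum.distrib[symmetric] sum_subtractf[symmetric]
          by (intro sum.cong refl) (simp add: algebra_simps sum_distrib_left sum_distrib_right)
      qed
      have S1: "(\<Sum>i\<in>UNIV. a x * gV i i x + V i x * pd i a x) = a x * Dv x + (\<Sum>i\<in>UNIV. V i x * pd i a x)"
        by (simp add: Dvx sum.distrib sum_distrib_left)
      have S2: "(\<Sum>i\<in>UNIV. Cn / We * (\<Phi>t x * pd i (g\<Phi> i) x + g\<Phi> i x * pd i \<Phi>t x))
          = Cn / We * (\<Phi>t x * lapphi + pp)"
        by (simp only: lapphi_def pp_def sum.distrib sum_distrib_left[symmetric])
      have S3: "(\<Sum>i\<in>UNIV. 1 / (Pe * We) * (M x * pd i (gM i) x + gM i x * gM i x))
          = 1 / (Pe * We) * (M x * lapmu + MM x)"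
        by (simp only: lapmu_def MM_def sum.distrib sum_distrib_left[symmetric] power2_eq_square)
      have S4: "(\<Sum>i\<in>UNIV. 1 / Re * (\<Sum>k\<in>UNIV. V k x * pd i (gV i k) x + gV i k x * gV i k x))
          = 1 / Re * (vlap + G x)"
      proof -
        have "vlap = (\<Sum>i\<in>UNIV. \<Sum>k\<in>UNIV. V k x * pd i (gV i k) x)"
          unfolding vlap_def lapV_def sum_distrib_left by (rule sum.swap)
        then show ?thesis
          by (simp only: G_def sum.distrib sum_distrib_left[symmetric] power2_eq_square)
      qed
      have SF: "(\<Sum>i\<in>UNIV. pd i (F i) x) = (a x * Dv x + (\<Sum>i\<in>UNIV. V i x * pd i a x))
          + Cn / We * (\<Phi>t x * lapphi + pp) + 1 / (Pe * We) * (M x * lapmu + MM x) + 1 / Re * (vlap + G x)"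
        unfolding pdF S1[symmetric] S2[symmetric] S3[symmetric] S4[symmetric] by (simp only: sum.distrib)
      \<comment> \<open>This identifies the time derivative of the gradient energy with the term
        produced by the divergence of dt phi grad phi.\<close>
      have mixed: "dt (dx i phi) x t = pd i \<Phi>t x" for i
        using smooth_field_mixed(2)[OF smooth(1) xc t, of i] by (simp add: dx_def[of i "dt phi"] pd_def \<Phi>t_def)
      have e'x: "e' x t = (1/2) * (dt rho x t * q + R x * (2 * vvt)) + 1 / (We * Cn) * (deriv fpot (\<Phi> x) * \<Phi>t x)
          + Cn / (2 * We) * (2 * pp) + Fr2inv * (rh' * \<Phi>t x) * x $ vert"
        by (simp add: e'_def q_def V_def R_def vvt_def \<Phi>_def \<Phi>t_def pp_def g\<Phi>_def rh'_def vcomp_def mixed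
            mixed[unfolded \<Phi>t_def])
      show ?thesis
        unfolding e'x SF Sa ax
        by (rule energy_balance_pointwise[OF _ _ _ _ dens rh_def rhpos rh'_def phase mueq mom div mass])
          (use params in auto)
    qed
    have cV: "continuous_on ?K (gV i k)" "continuous_on ?K (gM i)" "continuous_on ?K Dv" for i k
      using C1_near_continuous[OF C(9)] C1_near_continuous[OF C(8)] C1_near_continuous[OF CD] by auto
    have cG: "continuous_on ?K G" "continuous_on ?K (\<lambda>x. (Dv x)\<^sup>2)" "continuous_on ?K MM"
      unfolding G_def MM_def by (intro continuous_intros cV)+
    have cdF: "continuous_on ?K (\<lambda>x. \<Sum>i\<in>UNIV. pd i (F i) x)"
      by (intro continuous_intros pd_continuous CF)
    note IG = integral_continuous_closure[OF \<Omega> cG(1)] and ID = integral_continuous_closure[OF \<Omega> cG(2)]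
      and IM = integral_continuous_closure[OF \<Omega> cG(3)] and IF = integral_continuous_closure[OF \<Omega> cdF]
    have "integral \<Omega> (\<lambda>x. e' x t) = integral \<Omega> (\<lambda>x. (\<Sum>i\<in>UNIV. pd i (F i) x) - 1 / Re * G x
        - (1 + lam) / Re * (Dv x)\<^sup>2 - 1 / (Pe * We) * MM x)"
      by (rule integral_cong) (rule pointwise)
    also have "\<dots> = integral \<Omega> (\<lambda>x. \<Sum>i\<in>UNIV. pd i (F i) x) - 1 / Re * integral \<Omega> G
        - (1 + lam) / Re * integral \<Omega> (\<lambda>x. (Dv x)\<^sup>2) - 1 / (Pe * We) * integral \<Omega> MM"
      by (intro integral_unique has_integral_diff has_integral_mult_right integrable_integral
          IG(2) ID(2) IM(2) IF(2))
    also have "integral \<Omega> (\<lambda>x. \<Sum>i\<in>UNIV. pd i (F i) x) = 0" unfolding IF(3) by (rule div0)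
    finally have I: "integral \<Omega> (\<lambda>x. e' x t) = - (1 / Re) * integral \<Omega> G
        - (1 + lam) / Re * integral \<Omega> (\<lambda>x. (Dv x)\<^sup>2) - 1 / (Pe * We) * integral \<Omega> MM" by simp
    have MM_eq: "MM = (\<lambda>x. (norm (grad mu x t))\<^sup>2)"
      by (simp add: MM_def norm_power2_eq_sum grad_def gM_def)
    have target: "rate t = integral \<Omega> (\<lambda>x. e' x t)"
      unfolding I MM_eq G_def gV_def Dv_def rate_def ..
    show "((\<lambda>s. integral \<Omega> (\<lambda>x. e x s)) has_real_derivative rate t) (at t)"
      unfolding target by (rule leibniz_rule_bounded_domain[OF \<Omega> De ce ce' t])
    have nn: "0 \<le> integral \<Omega> G" "0 \<le> integral \<Omega> (\<lambda>x. (Dv x)\<^sup>2)" "0 \<le> integral \<Omega> MM"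
      by (intro Henstock_Kurzweil_Integration.integral_nonneg IG(2) ID(2) IM(2);
          simp add: G_def MM_def sum_nonneg)+
    \<comment> \<open>In dimension 2 or 3 the lower bound \<open>- 2 / d\<close> is at least
      -1.\<close>
    have "1 + lam \<ge> 0" using lam dim by auto
    then have "0 \<le> 1 / Re * integral \<Omega> G" "0 \<le> (1 + lam) / Re * integral \<Omega> (\<lambda>x. (Dv x)\<^sup>2)"
      "0 \<le> 1 / (Pe * We) * integral \<Omega> MM"
      using nn params by (auto intro!: mult_nonneg_nonneg divide_nonneg_nonneg)
    then show "rate t \<le> 0" unfolding target I by simp
  qed
  then show ?thesis unfolding e_def rate_def .
qed

end
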